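(* For every $n\in\mathbb N$ let $\Theta^{(n)}$ be a random vector uniformly distributed on the unit sphere $\mathbb{S}^{n-1}$. Then the sequence of random probability measures $(\mu_{\Theta^{(n)}}^{\mathrm{discr}})_{n\in \mathbb N}$ satisfies a (full) large deviation principle on $\mathcal M_1(\mathbb R)$ at speed $n$ and with a good rate function $I: \mathcal M_1(\mathbb R)\to [0,+\infty]$ given by $$ I(\nu(\alpha)) = - \frac{1}{2} \log \left( 1 - \|\alpha\|_2^2 \right) $$ whenever $\nu(\alpha)$ is equal to the law of the random variable $$ \sqrt{1 - \|\alpha\|_2^2 }\, Z + \sum_{ k =1}^\infty \alpha_k V_k, $$ where $\alpha_1\geq \alpha_2\geq \ldots \geq 0$ is a non-increasing sequence of non-negative reals satisfying $\|\alpha\|_2^2 := \sum_{ k = 1}^\infty \alpha_k^2 < 1$, $Z$ is a standard Gaussian random variable, $V_1,V_2,\ldots$ are Rademacher random variables, and $Z,V_1,V_2,\ldots$ are independent. Whenever $\nu\in\mathcal M_1(\mathbb R)$ is not of this form, $I(\nu) = + \infty$.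
   Context: $\mathbb S^{n-1}=\{x\in\mathbb R^n: \|x\|_2=1\}$ is the Euclidean unit sphere. $\mathcal M_1(\mathbb R)$ is the set of Borel probability measures on $\mathbb R$ endowed with the weak topology (topology of weak convergence of probability measures, which is metrizable). A Rademacher random variable $V$ satisfies $\mathbb P[V=+1]=\mathbb P[V=-1]=\frac12$. For a deterministic $\theta=(\theta_1,\ldots,\theta_n)\in\mathbb S^{n-1}$, $\mu^{\mathrm{discr}}_{\theta}$ is the probability measure on $\mathbb R$ given by $\mu^{\mathrm{discr}}_{\theta}(A):=\mathbb P[\langle V^{(n)},\theta\rangle\in A]$ for Borel $A\subset\mathbb R$, where $V^{(n)}=(V_1,\ldots,V_n)$ has independent Rademacher coordinates (i.e. is uniformly distributed on $\{-1,+1\}^n$); that is, $\mu^{\mathrm{discr}}_\theta$ is the law of $\theta_1V_1+\ldots+\theta_nV_n$. When $\theta$ is replaced by the random vector $\Theta^{(n)}$, $\mu^{\mathrm{discr}}_{\Theta^{(n)}}$ is a random element of $\mathcal M_1(\mathbb R)$. Large deviation principle: let $(\xi_n)_{n\in\mathbb N}$ be random elements of a metric space $M$, $(s_n)$ positive reals with $s_n\uparrow\infty$, and $\mathcal I:M\to[0,+\infty]$ lower semicontinuous. $(\xi_n)$ satisfies a (full) LDP with speed $s_n$ and rate function $\mathcal I$ if for all Borel sets $A\subset M$ $$-\inf_{x\in A^\circ}\mathcal I(x)\le\liminf_{n\to\infty}\frac1{s_n}\log\mathbb P[\xi_n\in A]\le\limsup_{n\to\infty}\frac1{s_n}\log\mathbb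 P[\xi_n\in A]\le-\inf_{x\in\overline A}\mathcal I(x),$$ where $A^\circ$ and $\overline A$ are the interior and closure of $A$. The rate function is good if $\{x\in M:\mathcal I(x)\le c\}$ is compact for every finite $c\ge0$. *)

theory Defs
  imports "HOL-Probability.Probability"
begin

section \<open>Large deviation principles\<close>

definition borel_of_topology :: "'m topology \<Rightarrow> 'm measure" where
  "borel_of_topology T = sigma (topspace T) {U. openin T U}"

definition lower_semicontinuous_on_topology :: "'m topology \<Rightarrow> ('m \<Rightarrow> ereal) \<Rightarrow> bool" where
  "lower_semicontinuous_on_topology T I \<longleftrightarrow> (\<forall>c. openin T {x \<in> topspace T. c < I x})"

definition rate_function :: "'m topology \<Rightarrow> ('m \<Rightarrow> ereal) \<Rightarrow> bool" where
  "rate_function T I \<longleftrightarrow>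
     (\<forall>x \<in> topspace T. 0 \<le> I x) \<and> lower_semicontinuous_on_topology T I"

definition good_rate_function :: "'m topology \<Rightarrow> ('m \<Rightarrow> ereal) \<Rightarrow> bool" where
  "good_rate_function T I \<longleftrightarrow>
     rate_function T I \<and>
     (\<forall>c::real. 0 \<le> c \<longrightarrow> compactin T {x \<in> topspace T. I x \<le> ereal c})"

text \<open>The logarithm of a probability, with \<open>log 0 = -\<infinity>\<close> (the library has \<open>ln 0 = 0\<close>).\<close>

definition log_prob :: "real \<Rightarrow> ereal" where
  "log_prob p = (if p = 0 then -\<infinity> else ereal (ln p))"

text \<open>
  A full large deviation principle for random elements \<open>\<xi> n\<close> of \<open>T\<close>, each defined on its own
  probability space \<open>P n\<close>, with speed \<open>s\<close> and rate function \<open>I\<close>. Sequences are indexed by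
  \<open>n = 1, 2, \<dots>\<close>; nothing is required at \<open>n = 0\<close>.
  Infima are taken in \<open>ereal\<close>, so the infimum over the empty set is \<open>\<infinity>\<close>.
\<close>

definition satisfies_LDP ::
  "(nat \<Rightarrow> 'a measure) \<Rightarrow> 'm topology \<Rightarrow> (nat \<Rightarrow> 'a \<Rightarrow> 'm) \<Rightarrow> (nat \<Rightarrow> real) \<Rightarrow> ('m \<Rightarrow> ereal) \<Rightarrow> bool"
where
  "satisfies_LDP P T \<xi> s I \<longleftrightarrow>
     (\<forall>n\<ge>1. prob_space (P n) \<and> \<xi> n \<in> P n \<rightarrow>\<^sub>M borel_of_topology T) \<and>
     (\<forall>n\<ge>1. 0 < s n) \<and> mono_on {1..} s \<and> filterlim s at_top sequentially \<and>
     rate_function T I \<and>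
     (\<forall>A \<in> sets (borel_of_topology T).
        let a = (\<lambda>n. ereal (1 / s n) * log_prob (measure (P n) {\<omega> \<in> space (P n). \<xi> n \<omega> \<in> A}))
        in - (INF x \<in> T interior_of A. I x) \<le> liminf a \<and>
           liminf a \<le> limsup a \<and>
           limsup a \<le> - (INF x \<in> T closure_of A. I x))"


section \<open>The space of Borel probability measures on the real line\<close>

text \<open>
  The weak topology is the coarsest topology on the set of Borel probability measures for which
  integration against every bounded continuous function is continuous. (The case \<open>U = UNIV\<close>
  makes the whole set open, so it is the underlying set of the topology.)
\<close>

definition weak_topology :: "real measure topology" where
  "weak_topology = topology_generated_by
     {{\<mu>. real_distribution \<mu> \<and> (\<integral>x. f x \<partial>\<mu>) \<in> U} | (f :: real \<Rightarrow> real) U.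
        continuous_on UNIV f \<and> bounded (range f) \<and> open U}"

lemma topspace_weak_topology [simp]: "topspace weak_topology = {\<mu>. real_distribution \<mu>}"
proof -
  have "{\<mu>. real_distribution \<mu>} \<in>
      {{\<mu>. real_distribution \<mu> \<and> (\<integral>x. f x \<partial>\<mu>) \<in> U} | (f :: real \<Rightarrow> real) U.
        continuous_on UNIV f \<and> bounded (range f) \<and> open U}"
    by (intro CollectI exI[of _ "\<lambda>_. 0"] exI[of _ UNIV]) auto
  then show ?thesis
    unfolding weak_topology_def topology_generated_by_topspace by blast
qed


section \<open>Random projections of Rademacher vectors\<close>

definition rademacher :: "real measure" where
  "rademacher = measure_pmf (pmf_of_set {-1, 1})"

text \<open>
  Vectors in \<open>\<real>\<^sup>n\<close> are extensional functions on \<open>{..<n}\<close>, i.e. coordinates are numbered from \<open>0\<close>,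
  and \<open>L2_set x {..<n}\<close> is the Euclidean norm.
  The uniform distribution on the unit sphere is the normalised surface measure, which assigns to
  \<open>A\<close> the relative volume in the unit ball of the cone \<open>{r * x | x \<in> A, 0 < r \<le> 1}\<close>: it is the
  law of \<open>X / \<parallel>X\<parallel>\<close> with \<open>X\<close> uniform in the ball. It is only meant for \<open>n \<ge> 1\<close>.
\<close>

definition uniform_sphere :: "nat \<Rightarrow> (nat \<Rightarrow> real) measure" where
  "uniform_sphere n =
     distr (uniform_measure (\<Pi>\<^sub>M i\<in>{..<n}. lborel) {x \<in> {..<n} \<rightarrow>\<^sub>E UNIV. L2_set x {..<n} \<le> 1})
       (\<Pi>\<^sub>M i\<in>{..<n}. borel)
       (\<lambda>x. \<lambda>i\<in>{..<n}. x i / L2_set x {..<n})"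

definition mu_discr :: "nat \<Rightarrow> (nat \<Rightarrow> real) \<Rightarrow> real measure" where
  "mu_discr n \<theta> = distr (\<Pi>\<^sub>M i\<in>{..<n}. rademacher) borel (\<lambda>v. \<Sum>i<n. \<theta> i * v i)"


section \<open>The limit laws\<close>

text \<open>The sequences \<open>\<alpha>\<^sub>1 \<ge> \<alpha>\<^sub>2 \<ge> \<dots> \<ge> 0\<close> with \<open>\<parallel>\<alpha>\<parallel>\<^sup>2 < 1\<close> are indexed from \<open>0\<close>.\<close>

definition sq_norm :: "(nat \<Rightarrow> real) \<Rightarrow> real" where
  "sq_norm \<alpha> = (\<Sum>k. (\<alpha> k)\<^sup>2)"

definition admissible :: "(nat \<Rightarrow> real) \<Rightarrow> bool" where
  "admissible \<alpha> \<longleftrightarrow>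
     decseq \<alpha> \<and> (\<forall>k. 0 \<le> \<alpha> k) \<and> summable (\<lambda>k. (\<alpha> k)\<^sup>2) \<and> sq_norm \<alpha> < 1"

text \<open>
  The random series converges almost surely when \<open>\<alpha>\<close> is square-summable; on the null set where it
  diverges \<open>suminf\<close> has an irrelevant value.
\<close>

definition nu :: "(nat \<Rightarrow> real) \<Rightarrow> real measure" where
  "nu \<alpha> = distr (std_normal_distribution \<Otimes>\<^sub>M (\<Pi>\<^sub>M k\<in>UNIV. rademacher)) borel
     (\<lambda>(z, v). sqrt (1 - sq_norm \<alpha>) * z + (\<Sum>k. \<alpha> k * v k))"

end

theory Submission
  imports Defs
begin

text \<open>
  Let \<open>K\<close> be the set of nonincreasing nonnegative sequences \<open>\<alpha>\<close> with \<open>\<parallel>\<alpha>\<parallel> \<le> 1\<close>, which is compact for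
  coordinatewise convergence. The map \<open>\<alpha> \<mapsto> nu \<alpha>\<close> is continuous there: the characteristic function is
  \<open>exp (-t\<^sup>2/2)\<close> times the product of \<open>cos (\<alpha>\<^sub>k t) exp (\<alpha>\<^sub>k\<^sup>2 t\<^sup>2/2) = 1 + O (\<alpha>\<^sub>k\<^sup>4 t\<^sup>4)\<close>, whose tails are
  uniformly small. By symmetry \<open>mu_discr n \<theta>\<close> is the law that belongs to the decreasing rearrangement
  of \<open>\<bar>\<theta>\<bar>\<close>, so a large deviation principle for the largest coordinates carries over to the laws.
  Upper bound: by compactness, laws in a closed set on which \<open>I > r\<close> force \<open>m\<close> of the coordinates
  of \<open>\<theta>\<close> to carry mass at least \<open>c = 1 - exp (-2 r)\<close>; then the other coordinates of a point of the unit
  ball lie in a ball of radius \<open>sqrt (1 - c)\<close>, and comparing volumes gives \<open>(1 - c) powr (n/2)\<close> up to a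
  polynomial factor. Lower bound: prescribe the first \<open>m\<close> coordinates and let the others fill a thin shell
  of radius \<open>sqrt (1 - \<parallel>\<alpha>\<parallel>\<^sup>2)\<close>, on which all coordinates are typically small.
\<close>

section \<open>The weak topology\<close>

text \<open>Along coordinatewise limits squared mass can leak to infinity, so
  \<open>\<parallel>\<alpha>\<parallel>\<close> is not continuous on \<open>K\<close>. The Gaussian
  component compensates exactly for this leak: each truncated coefficient sequence is completed by a
  Gaussian to total variance one, while a unit vector needs no completion. Hence one family of
  functions, \<open>gauss_cos\<close>, describes both \<open>mu_discr\<close> and \<open>nu\<close>.
  The number \<open>m\<close> of heavy coordinates depends on the closed set and on the level, but
  not on the dimension \<open>n\<close>. Choosing their positions therefore costs only a power of
  \<open>n\<close>, invisible at speed \<open>n\<close>. Events on the sphere are measured through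
  the volumes of cones in the unit ball. The estimates then come from inclusions between products of
  balls and boxes, without asymptotics of the Gamma function. For the rate to be a function of the
  law, \<open>sq_norm \<alpha>\<close> must be recoverable from \<open>nu \<alpha>\<close>. It is
  read off from the quadratic growth of the logarithm of the Laplace transform, without recovering
  the single coefficients.\<close>

lemma openin_weak_topology_basis:
  fixes f :: "real \<Rightarrow> real"
  assumes "continuous_on UNIV f" "bounded (range f)" "open U"
  shows "openin weak_topology {\<mu>. real_distribution \<mu> \<and> (\<integral>x. f x \<partial>\<mu>) \<in> U}"
  unfolding weak_topology_def
  by (rule topology_generated_by_Basis) (use assms in blast)

text \<open>Open sets arise from integral conditions by finite intersections and unions, so
  induction over the generation reduces the claim to one bounded continuous \<open>f\<close>, where
  Levy's continuity theorem applies. Convergence of characteristic functions thus places laws in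
  open sets without a metric on the space of measures.\<close>

lemma eventually_weak_topology:
  fixes M :: "nat \<Rightarrow> real measure"
  assumes rd: "\<And>n. real_distribution (M n)"
    and char: "\<And>t. (\<lambda>n. char (M n) t) \<longlonglongrightarrow> char \<mu> t"
    and U: "openin weak_topology U" "\<mu> \<in> U"
  shows "\<forall>\<^sub>F n in sequentially. M n \<in> U"
proof -
  have \<mu>: "real_distribution \<mu>"
    using openin_subset[OF U(1)] U(2) by auto
  have weak: "weak_conv_m M \<mu>"
    by (rule levy_continuity[OF rd \<mu> char])
  from U(1) have "generate_topology_on {{\<mu>. real_distribution \<mu> \<and> (\<integral>x. f x \<partial>\<mu>) \<in> U} | (f :: real \<Rightarrow> real) U.
        continuous_on UNIV f \<and> bounded (range f) \<and> open U} U"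
    unfolding weak_topology_def by (rule openin_topology_generated_by)
  then show ?thesis
    using U(2)
  proof (induction rule: generate_topology_on.induct)
    case (Int a b)
    then show ?case
      by (auto intro: eventually_conj)
  next
    case (UN K)
    then obtain k where k: "k \<in> K" "\<mu> \<in> k" by auto
    show ?case
      by (rule eventually_mono[OF UN.IH[OF k]]) (use k in auto)
  next
    case (Basis s)
    then obtain f :: "real \<Rightarrow> real" and V where s: "s = {\<mu>. real_distribution \<mu> \<and> (\<integral>x. f x \<partial>\<mu>) \<in> V}"
      and f: "continuous_on UNIV f" "bounded (range f)" and V: "open V"
      by blast
    from f(2) obtain B where B: "\<And>x. norm (f x) \<le> B"
      by (auto simp: bounded_iff)
    have "(\<lambda>n. integral\<^sup>L (M n) f) \<longlonglongrightarrow> integral\<^sup>L \<mu> f"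
      by (rule weak_conv_imp_integral_bdd_continuous_conv[OF rd \<mu> weak _ B])
        (use f(1) in \<open>simp add: continuous_on_eq_continuous_at\<close>)
    moreover have "integral\<^sup>L \<mu> f \<in> V"
      using Basis s by auto
    ultimately have "\<forall>\<^sub>F n in sequentially. integral\<^sup>L (M n) f \<in> V"
      using V topological_tendstoD by blast
    then show ?case
      by eventually_elim (simp add: s rd)
  qed simp
qed

lemma char_eq_integrals:
  assumes "real_distribution \<mu>"
  shows "char \<mu> t = Complex (\<integral>x. cos (t * x) \<partial>\<mu>) (\<integral>x. sin (t * x) \<partial>\<mu>)"
proof -
  interpret real_distribution \<mu> by fact
  have int: "integrable \<mu> (\<lambda>x. iexp (t * x))"
    by (rule integrable_iexp) auto
  have "Re (char \<mu> t) = (\<integral>x. cos (t * x) \<partial>\<mu>)" "Im (char \<mu> t) = (\<integral>x. sin (t * x) \<partial>\<mu>)"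
    unfolding char_def integral_Re[OF int, symmetric] integral_Im[OF int, symmetric]
    by (simp_all add: Re_exp Im_exp)
  then show ?thesis
    by (simp add: complex_eq_iff)
qed

text \<open>Distinct laws differ in their characteristic functions, so \<open>cos (t * x)\<close> or
  \<open>sin (t * x)\<close> is a bounded continuous function whose integrals separate them. The
  Hausdorff property later makes the compact level sets of the rate closed.\<close>

lemma Hausdorff_weak_topology: "Hausdorff_space weak_topology"
  unfolding Hausdorff_space_def
proof (intro allI impI)
  fix \<mu> \<nu> :: "real measure"
  assume *: "\<mu> \<in> topspace weak_topology \<and> \<nu> \<in> topspace weak_topology \<and> \<mu> \<noteq> \<nu>"
  have sep: "\<exists>U V. openin weak_topology U \<and> openin weak_topology V \<and> \<mu> \<in> U \<and> \<nu> \<in> V \<and> disjnt U V"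
    if f: "continuous_on UNIV f" "bounded (range f)" and ne: "integral\<^sup>L \<mu> f \<noteq> integral\<^sup>L \<nu> f"
    for f :: "real \<Rightarrow> real"
  proof -
    obtain U V where UV: "open U" "open V" "integral\<^sup>L \<mu> f \<in> U" "integral\<^sup>L \<nu> f \<in> V" "U \<inter> V = {}"
      using hausdorff[OF ne] by blast
    show ?thesis
      by (intro exI conjI, rule openin_weak_topology_basis[OF f UV(1)],
          rule openin_weak_topology_basis[OF f UV(2)]) (use * UV in \<open>auto simp: disjnt_def\<close>)
  qed
  from * obtain t where "char \<mu> t \<noteq> char \<nu> t"
    using Levy_uniqueness by (metis ext mem_Collect_eq topspace_weak_topology)
  with * consider "(\<integral>x. cos (t * x) \<partial>\<mu>) \<noteq> (\<integral>x. cos (t * x) \<partial>\<nu>)"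
    | "(\<integral>x. sin (t * x) \<partial>\<mu>) \<noteq> (\<integral>x. sin (t * x) \<partial>\<nu>)"
    by (auto simp: char_eq_integrals)
  then show "\<exists>U V. openin weak_topology U \<and> openin weak_topology V \<and> \<mu> \<in> U \<and> \<nu> \<in> V \<and> disjnt U V"
  proof cases
    case 1
    show ?thesis
      by (rule sep[OF _ _ 1]) (auto intro!: continuous_intros boundedI[of _ 1])
  next
    case 2
    show ?thesis
      by (rule sep[OF _ _ 2]) (auto intro!: continuous_intros boundedI[of _ 1])
  qed
qed

section \<open>Rademacher series\<close>

abbreviation signs :: "(nat \<Rightarrow> real) measure" where
  "signs \<equiv> \<Pi>\<^sub>M k\<in>UNIV. rademacher"

interpretation rademacher: prob_space rademacher
  unfolding rademacher_def by (rule prob_space_measure_pmf)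

interpretation signs: sequence_space rademacher
  by unfold_locales

lemma sets_rademacher [simp]: "sets rademacher = UNIV"
  by (simp add: rademacher_def)

lemma space_rademacher [simp]: "space rademacher = UNIV"
  by (simp add: rademacher_def)

lemma measurable_rademacher [measurable]: "f \<in> rademacher \<rightarrow>\<^sub>M M \<longleftrightarrow> f \<in> UNIV \<rightarrow> space M"
  by (auto simp: measurable_def)

lemma space_signs [simp]: "space signs = UNIV"
  by (simp add: space_PiM)

text \<open>The factors \<open>rademacher\<close> carry the power set as sigma-algebra; every
  function on them is Borel, so coordinates become real random variables by composing with the
  identity.\<close>

lemma measurable_component_rademacher [measurable (raw)]:
  assumes "f \<in> M \<rightarrow>\<^sub>M (\<Pi>\<^sub>M i\<in>J. rademacher)" "i \<in> J"
  shows "(\<lambda>x. f x i) \<in> borel_measurable M"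
proof -
  have "(\<lambda>v. v i) \<in> (\<Pi>\<^sub>M i\<in>J. rademacher) \<rightarrow>\<^sub>M rademacher"
    using assms(2) by (rule measurable_component_singleton)
  moreover have "(\<lambda>x. x) \<in> borel_measurable rademacher"
    by (simp add: measurable_rademacher)
  ultimately have "(\<lambda>v. v i) \<in> borel_measurable (\<Pi>\<^sub>M i\<in>J. rademacher)"
    using measurable_compose by blast
  with assms(1) show ?thesis
    by (rule measurable_compose)
qed

lemma integral_rademacher:
  fixes f :: "real \<Rightarrow> 'b :: {banach, second_countable_topology}"
  shows "integral\<^sup>L rademacher f = (f (-1) + f 1) /\<^sub>R 2"
  unfolding rademacher_def
  by (subst integral_measure_pmf[of "{-1, 1}"]) (auto simp: algebra_simps)

lemma integrable_rademacher [simp]: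
  fixes f :: "real \<Rightarrow> 'b :: {banach, second_countable_topology}"
  shows "integrable rademacher f"
  unfolding rademacher_def by (rule integrable_measure_pmf_finite) simp

lemma nn_integral_rademacher:
  "(\<integral>\<^sup>+s. g s \<partial>rademacher) = (g (-1) + g 1) / 2"
  unfolding rademacher_def by (subst nn_integral_pmf_of_set) auto

text \<open>A sign sequence is a first sign followed by an independent sequence of the same law.
  This recursion drives the inductions for the maximal inequality and for the Laplace
  transform.\<close>

lemma nn_integral_signs_first:
  assumes [measurable]: "f \<in> borel_measurable signs"
  shows "(\<integral>\<^sup>+v. f v \<partial>signs) = ((\<integral>\<^sup>+v. f (case_nat (-1) v) \<partial>signs) + (\<integral>\<^sup>+v. f (case_nat 1 v) \<partial>signs)) / 2"
proof -
  have "(\<integral>\<^sup>+v. f v \<partial>signs) = (\<integral>\<^sup>+v. f v \<partial>distr (rademacher \<Otimes>\<^sub>M signs) signs (\<lambda>(s, v). case_nat s v))"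
    by (simp add: signs.PiM_iter)
  also have "\<dots> = (\<integral>\<^sup>+p. f (case p of (s, v) \<Rightarrow> case_nat s v) \<partial>(rademacher \<Otimes>\<^sub>M signs))"
    by (rule nn_integral_distr) measurable
  also have "\<dots> = (\<integral>\<^sup>+s. (\<integral>\<^sup>+v. f (case_nat s v) \<partial>signs) \<partial>rademacher)"
    by (subst signs.nn_integral_fst[symmetric]) auto
  also have "\<dots> = ((\<integral>\<^sup>+v. f (case_nat (-1) v) \<partial>signs) + (\<integral>\<^sup>+v. f (case_nat 1 v) \<partial>signs)) / 2"
    by (rule nn_integral_rademacher)
  finally show ?thesis .
qed

section \<open>Kolmogorov's maximal inequality and almost sure convergence\<close>

lemma measure_signs_first:
  assumes E [measurable]: "Measurable.pred signs E"
  shows "measure signs {v. E v} =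
    (measure signs {v. E (case_nat (-1) v)} + measure signs {v. E (case_nat 1 v)}) / 2"
proof -
  have [measurable]: "(\<lambda>v. case_nat s v) \<in> signs \<rightarrow>\<^sub>M signs" for s
    by (rule measurable_PiM_single') (auto split: nat.split)
  have *: "emeasure signs {v. F v} = (\<integral>\<^sup>+v. indicator {v. F v} v \<partial>signs)" if "Measurable.pred signs F" for F
    using that by (subst nn_integral_indicator) (auto simp: pred_def)
  have [measurable]: "Measurable.pred signs (\<lambda>v. E (case_nat s v))" for s
    by measurable
  have "emeasure signs {v. E v} = 
    (emeasure signs {v. E (case_nat (-1) v)} + emeasure signs {v. E (case_nat 1 v)}) / 2"
    unfolding *[OF E] *[OF \<open>\<And>s. Measurable.pred signs (\<lambda>v. E (case_nat s v))\<close>]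
    by (subst nn_integral_signs_first) (simp_all add: indicator_def[abs_def])
  also have "\<dots> = ennreal ((measure signs {v. E (case_nat (-1) v)} + measure signs {v. E (case_nat 1 v)}) / 2)"
    by (simp add: signs.P.emeasure_eq_measure ennreal_plus[symmetric] divide_ennreal[symmetric] ennreal_divide_numeral[symmetric] del: ennreal_plus)
  finally show ?thesis
    by (simp add: signs.P.emeasure_eq_measure)
qed

text \<open>The starting point \<open>x\<close> and the coefficients \<open>a\<close> are general so
  that conditioning on the first sign restarts the walk at \<open>x + a 0\<close> or
  \<open>x - a 0\<close>; the mean of the two squares is \<open>x\<^sup>2 + (a 0)\<^sup>2\<close>. A
  walk that starts at level \<open>L\<close> or beyond is trivial, since the bound is then at least
  one.\<close>

lemma maximal_inequality_aux:
  assumes "0 < L"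
  shows "measure signs {v. \<exists>k\<le>n. L \<le> \<bar>x + (\<Sum>i<k. a i * v i)\<bar>} \<le> (x\<^sup>2 + (\<Sum>i<n. (a i)\<^sup>2)) / L\<^sup>2"
proof (induction n arbitrary: x a)
  case 0
  show ?case
  proof (cases "L \<le> \<bar>x\<bar>")
    case True
    then have "L\<^sup>2 \<le> x\<^sup>2"
      using assms by (simp add: abs_le_square_iff[symmetric])
    then show ?thesis
      using assms True by (auto simp: signs.P.prob_space[simplified])
  qed auto
next
  case (Suc n)
  show ?case
  proof (cases "L \<le> \<bar>x\<bar>")
    case True
    then have "L\<^sup>2 \<le> x\<^sup>2"
      using assms by (simp add: abs_le_square_iff[symmetric])
    then have "1 \<le> (x\<^sup>2 + (\<Sum>i<Suc n. (a i)\<^sup>2)) / L\<^sup>2"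
      using assms by (simp add: sum_nonneg add_increasing2 del: sum.lessThan_Suc)
    then show ?thesis
      using signs.P.prob_le_1 order_trans by blast
  next
    case False
    have eq: "(\<exists>k\<le>Suc n. L \<le> \<bar>x + (\<Sum>i<k. a i * case_nat s v i)\<bar>) \<longleftrightarrow>
        (\<exists>k\<le>n. L \<le> \<bar>(x + a 0 * s) + (\<Sum>i<k. a (Suc i) * v i)\<bar>)" for s v
    proof -
      have "(\<exists>k\<le>Suc n. Q k) \<longleftrightarrow> (\<exists>k\<le>n. Q (Suc k))" if "\<not> Q 0" for Q
        using that by (metis Suc_le_mono not0_implies_Suc)
      then show ?thesis
        using False by (subst \<open>\<And>Q. \<not> Q 0 \<Longrightarrow> _\<close>) (simp_all add: sum.lessThan_Suc_shift add.assoc del: sum.lessThan_Suc)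
    qed
    have "measure signs {v. \<exists>k\<le>Suc n. L \<le> \<bar>x + (\<Sum>i<k. a i * v i)\<bar>} =
      (measure signs {v. \<exists>k\<le>n. L \<le> \<bar>(x + a 0 * (-1)) + (\<Sum>i<k. a (Suc i) * v i)\<bar>} +
       measure signs {v. \<exists>k\<le>n. L \<le> \<bar>(x + a 0 * 1) + (\<Sum>i<k. a (Suc i) * v i)\<bar>}) / 2"
      by (subst measure_signs_first) (simp_all only: eq, measurable)
    also have "\<dots> \<le> (((x + a 0 * (-1))\<^sup>2 + (\<Sum>i<n. (a (Suc i))\<^sup>2)) / L\<^sup>2 +
        ((x + a 0 * 1)\<^sup>2 + (\<Sum>i<n. (a (Suc i))\<^sup>2)) / L\<^sup>2) / 2"
      by (intro divide_right_mono add_mono Suc.IH) auto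
    also have "\<dots> = (x\<^sup>2 + (\<Sum>i<Suc n. (a i)\<^sup>2)) / L\<^sup>2"
      unfolding sum.lessThan_Suc_shift add_divide_distrib[symmetric]
      by (simp add: power2_eq_square algebra_simps add_divide_distrib diff_divide_distrib)
    finally show ?thesis .
  qed
qed

lemma maximal_inequality:
  assumes L: "0 < L" and a: "summable (\<lambda>i. (a i)\<^sup>2)"
  shows "measure signs {v. \<exists>k. L \<le> \<bar>\<Sum>i<k. a i * v i\<bar>} \<le> (\<Sum>i. (a i)\<^sup>2) / L\<^sup>2"
proof -
  let ?B = "\<lambda>n. {v. \<exists>k\<le>n. L \<le> \<bar>0 + (\<Sum>i<k. a i * v i)\<bar>}"
  have "Measurable.pred signs (\<lambda>v. \<exists>k\<le>n. L \<le> \<bar>0 + (\<Sum>i<k. a i * v i)\<bar>)" for n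
    by measurable
  then have "range ?B \<subseteq> sets signs"
    by (auto simp: pred_def)
  moreover have "incseq ?B"
    by (auto simp: incseq_def intro: order_trans)
  ultimately have "(\<lambda>n. measure signs (?B n)) \<longlonglongrightarrow> measure signs (\<Union>n. ?B n)"
    by (rule signs.P.finite_Lim_measure_incseq)
  moreover have "measure signs (?B n) \<le> (\<Sum>i. (a i)\<^sup>2) / L\<^sup>2" for n
  proof -
    have "measure signs (?B n) \<le> (0\<^sup>2 + (\<Sum>i<n. (a i)\<^sup>2)) / L\<^sup>2"
      by (rule maximal_inequality_aux[OF L])
    also have "\<dots> \<le> (\<Sum>i. (a i)\<^sup>2) / L\<^sup>2"
      using a by (auto intro!: divide_right_mono sum_le_suminf)
    finally show ?thesis .
  qed
  ultimately have "measure signs (\<Union>n. ?B n) \<le> (\<Sum>i. (a i)\<^sup>2) / L\<^sup>2"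
    using LIMSEQ_le_const2 by blast
  moreover have "(\<Union>n. ?B n) = {v. \<exists>k. L \<le> \<bar>\<Sum>i<k. a i * v i\<bar>}"
    by auto
  ultimately show ?thesis
    by simp
qed

lemma AE_summable_signs:
  assumes a: "summable (\<lambda>i. (a i)\<^sup>2)"
  shows "AE v in signs. summable (\<lambda>i. a i * v i)"
proof -
  \<comment> \<open>With the first \<open>N\<close> coefficients set to zero, partial sums become
    blocks that start at \<open>N\<close>, and the maximal inequality controls all of them at once
    by the tail of the squares.\<close>
  define b where "b N i = (if i < N then 0 else a i)" for N i
  have b: "(\<Sum>i<k. b N i * v i) = (\<Sum>i\<in>{N..<k}. a i * v i)" for N k and v :: "nat \<Rightarrow> real"
    by (rule sum.mono_neutral_cong_right) (auto simp: b_def)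
  have AE: "AE v in signs. \<exists>N. \<forall>k. \<bar>\<Sum>i<k. b N i * v i\<bar> < e" if e: "0 < e" for e
  proof -
    let ?Z = "{v. \<forall>N. \<exists>k. e \<le> \<bar>\<Sum>i<k. b N i * v i\<bar>}"
    have pred: "Measurable.pred signs (\<lambda>v. \<forall>N. \<exists>k. e \<le> \<bar>\<Sum>i<k. b N i * v i\<bar>)"
      "Measurable.pred signs (\<lambda>v. \<exists>k. e \<le> \<bar>\<Sum>i<k. b N i * v i\<bar>)" for N
      by measurable
    have "measure signs ?Z \<le> (\<Sum>i. (a (i + N))\<^sup>2) / e\<^sup>2" for N
    proof -
      have sb: "summable (\<lambda>i. (b N i)\<^sup>2)"
        by (rule summable_comparison_test[OF _ a]) (auto simp: b_def)
      have "measure signs ?Z \<le> measure signs {v. \<exists>k. e \<le> \<bar>\<Sum>i<k. b N i * v i\<bar>}"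
        by (rule signs.P.finite_measure_mono) (use pred in \<open>auto simp: pred_def\<close>)
      also have "\<dots> \<le> (\<Sum>i. (b N i)\<^sup>2) / e\<^sup>2"
        by (rule maximal_inequality[OF e sb])
      also have "(\<Sum>i. (b N i)\<^sup>2) = (\<Sum>i. (b N (i + N))\<^sup>2) + (\<Sum>i<N. (b N i)\<^sup>2)"
        by (rule suminf_split_initial_segment[OF sb])
      also have "\<dots> = (\<Sum>i. (a (i + N))\<^sup>2)"
        by (simp add: b_def)
      finally show ?thesis .
    qed
    moreover have "(\<lambda>N. (\<Sum>i. (a (i + N))\<^sup>2) / e\<^sup>2) \<longlonglongrightarrow> 0 / e\<^sup>2"
      by (intro tendsto_divide suminf_exist_split2[OF a] tendsto_const) (use e in auto)
    ultimately have "measure signs ?Z \<le> 0"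
      using LIMSEQ_le_const by (metis (no_types, lifting) div_0)
    then have "AE v in signs. \<not> (\<forall>N. \<exists>k. e \<le> \<bar>\<Sum>i<k. b N i * v i\<bar>)"
      using pred by (subst (asm) measure_le_0_iff, subst (asm) signs.P.prob_eq_0) (auto simp: pred_def)
    then show ?thesis
      by (auto simp: not_le)
  qed
  have "AE v in signs. \<forall>j. \<exists>N. \<forall>k. \<bar>\<Sum>i<k. b N i * v i\<bar> < inverse (real (Suc j))"
    unfolding AE_all_countable by (intro allI AE) simp
  then show ?thesis
  proof eventually_elim
    case (elim v)
    show ?case
      unfolding summable_Cauchy
    proof (intro allI impI)
      fix e :: real assume "0 < e"
      \<comment> \<open>Half of \<open>e\<close> suffices because a block from \<open>m\<close> to
        \<open>n\<close> is the difference of two blocks that start at \<open>N\<close>.\<close>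
      then obtain j where j: "inverse (real (Suc j)) < e / 2"
        using reals_Archimedean[of "e / 2"] by auto
      from elim obtain N where N: "\<And>k. \<bar>\<Sum>i\<in>{N..<k}. a i * v i\<bar> < inverse (real (Suc j))"
        unfolding b by blast
      have "norm (\<Sum>i\<in>{m..<n}. a i * v i) < e" if "N \<le> m" for m n
      proof (cases "m \<le> n")
        case True
        have "(\<Sum>i\<in>{N..<m}. a i * v i) + (\<Sum>i\<in>{m..<n}. a i * v i) = (\<Sum>i\<in>{N..<n}. a i * v i)"
          using that True by (rule sum.atLeastLessThan_concat)
        then show ?thesis
          using N[of m] N[of n] j by auto
      qed (use \<open>0 < e\<close> in auto)
      then show "\<exists>N. \<forall>m\<ge>N. \<forall>n. norm (\<Sum>i\<in>{m..<n}. a i * v i) < e"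
        by blast
    qed
  qed
qed

section \<open>Characteristic functions\<close>

lemma borel_measurable_sum_rademacher [measurable]:
  "(\<lambda>v. \<Sum>i<n. \<theta> i * v i) \<in> borel_measurable (\<Pi>\<^sub>M i\<in>{..<n}. rademacher)"
proof (rule borel_measurable_sum)
  fix i assume "i \<in> {..<n}"
  then have "(\<lambda>v. v i) \<in> borel_measurable (\<Pi>\<^sub>M i\<in>{..<n}. rademacher)"
    by (rule measurable_component_rademacher[OF measurable_ident_sets[OF refl]])
  then show "(\<lambda>v. \<theta> i * v i) \<in> borel_measurable (\<Pi>\<^sub>M i\<in>{..<n}. rademacher)"
    by measurable
qed

lemma real_distribution_mu_discr: "real_distribution (mu_discr n \<theta>)"
proof -
  interpret prob_space "\<Pi>\<^sub>M i\<in>{..<n}. rademacher"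
    by (intro prob_space_PiM rademacher.prob_space_axioms)
  show ?thesis
    unfolding mu_discr_def by (rule real_distribution_distr) measurable
qed

lemma integral_iexp_sum_rademacher:
  fixes n :: nat
  shows "(\<integral>v. iexp (t * (\<Sum>i<n. \<theta> i * v i)) \<partial>(\<Pi>\<^sub>M i\<in>{..<n}. rademacher)) =
     of_real (\<Prod>i<n. cos (\<theta> i * t))"
proof -
  have "(\<integral>v. iexp (t * (\<Sum>i<n. \<theta> i * v i)) \<partial>(\<Pi>\<^sub>M i\<in>{..<n}. rademacher)) =
    (\<integral>v. (\<Prod>i<n. iexp (t * \<theta> i * v i)) \<partial>(\<Pi>\<^sub>M i\<in>{..<n}. rademacher))"
  proof (intro Bochner_Integration.integral_cong refl)
    fix v :: "nat \<Rightarrow> real"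
    have "iexp (t * (\<Sum>i<n. \<theta> i * v i)) = exp (\<Sum>i<n. \<i> * of_real (t * \<theta> i * v i))"
      by (simp add: sum_distrib_left mult.assoc)
    then show "iexp (t * (\<Sum>i<n. \<theta> i * v i)) = (\<Prod>i<n. iexp (t * \<theta> i * v i))"
      by (simp only: exp_sum finite_lessThan)
  qed
  also have "\<dots> = (\<Prod>i<n. \<integral>s. iexp (t * \<theta> i * s) \<partial>rademacher)"
    by (rule signs.product_integral_prod) auto
  also have "\<dots> = (\<Prod>i<n. of_real (cos (\<theta> i * t)))"
    by (intro prod.cong refl, subst integral_rademacher)
      (simp add: complex_eq_iff Re_exp Im_exp mult.commute scaleR_conv_of_real)
  finally show ?thesis by simp
qed

lemma char_mu_discr: "char (mu_discr n \<theta>) t = of_real (\<Prod>i<n. cos (\<theta> i * t))"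
  unfolding char_def mu_discr_def integral_iexp_sum_rademacher[symmetric]
  by (subst integral_distr) auto

lemma integral_iexp_sum_signs:
  "(\<integral>v. iexp (t * (\<Sum>i<n. \<theta> i * v i)) \<partial>signs) = of_real (\<Prod>i<n. cos (\<theta> i * t))"
proof -
  have "of_real (\<Prod>i<n. cos (\<theta> i * t)) =
    (\<integral>v. iexp (t * (\<Sum>i<n. \<theta> i * v i)) \<partial>distr signs (\<Pi>\<^sub>M i\<in>{..<n}. rademacher) (\<lambda>x. restrict x {..<n}))"
    unfolding signs.distr_PiM_restrict_finite[OF finite_lessThan subset_UNIV]
    by (rule integral_iexp_sum_rademacher[symmetric])
  also have "\<dots> = (\<integral>v. iexp (t * (\<Sum>i<n. \<theta> i * restrict v {..<n} i)) \<partial>signs)"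
    by (rule integral_distr) (auto intro: measurable_restrict_subset)
  finally show ?thesis by simp
qed

lemma integral_iexp_suminf_signs:
  assumes "summable (\<lambda>i. (\<alpha> i)\<^sup>2)"
  shows "(\<lambda>n. of_real (\<Prod>i<n. cos (\<alpha> i * t))) \<longlonglongrightarrow> (\<integral>v. iexp (t * (\<Sum>i. \<alpha> i * v i)) \<partial>signs)"
  unfolding integral_iexp_sum_signs[symmetric]
proof (rule integral_dominated_convergence[where w = "\<lambda>_. 1"])
  show "AE v in signs. (\<lambda>n. iexp (t * (\<Sum>i<n. \<alpha> i * v i))) \<longlonglongrightarrow> iexp (t * (\<Sum>i. \<alpha> i * v i))"
    using AE_summable_signs[OF assms]
    by eventually_elim (intro tendsto_intros summable_LIMSEQ)
qed auto

definition nu_fun :: "(nat \<Rightarrow> real) \<Rightarrow> real \<times> (nat \<Rightarrow> real) \<Rightarrow> real" where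
  "nu_fun \<alpha> = (\<lambda>(z, v). sqrt (1 - sq_norm \<alpha>) * z + (\<Sum>k. \<alpha> k * v k))"

interpretation std_normal: prob_space std_normal_distribution
  by (rule prob_space_normal_density) simp

interpretation normal_signs: pair_prob_space std_normal_distribution signs
  by unfold_locales

lemma measurable_nu_fun [measurable]:
  "nu_fun \<alpha> \<in> borel_measurable (std_normal_distribution \<Otimes>\<^sub>M signs)"
  unfolding nu_fun_def by measurable

lemma real_distribution_nu: "real_distribution (nu \<alpha>)"
  unfolding nu_def nu_fun_def[symmetric]
  by (rule normal_signs.P.real_distribution_distr) measurable

lemma char_nu_eq:
  assumes "sq_norm \<alpha> \<le> 1"
  shows "char (nu \<alpha>) t =
    of_real (exp (- (1 - sq_norm \<alpha>) * t\<^sup>2 / 2)) * (\<integral>v. iexp (t * (\<Sum>i. \<alpha> i * v i)) \<partial>signs)"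
proof -
  let ?c = "sqrt (1 - sq_norm \<alpha>)"
  have "char (nu \<alpha>) t = (\<integral>p. iexp (t * nu_fun \<alpha> p) \<partial>(std_normal_distribution \<Otimes>\<^sub>M signs))"
    unfolding char_def nu_def nu_fun_def[symmetric] by (subst integral_distr) auto
  also have "\<dots> = (\<integral>z. (\<integral>v. iexp (t * nu_fun \<alpha> (z, v)) \<partial>signs) \<partial>std_normal_distribution)"
    by (rule normal_signs.integral_fst'[symmetric], rule normal_signs.P.integrable_const_bound[of _ 1])
      (auto simp: split_beta')
  also have "\<dots> = (\<integral>z. iexp (t * ?c * z) * (\<integral>v. iexp (t * (\<Sum>i. \<alpha> i * v i)) \<partial>signs) \<partial>std_normal_distribution)"
    unfolding nu_fun_def
    by (simp add: distrib_left exp_add mult.assoc)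
  also have "\<dots> = char std_normal_distribution (t * ?c) * (\<integral>v. iexp (t * (\<Sum>i. \<alpha> i * v i)) \<partial>signs)"
    unfolding char_def by simp
  also have "char std_normal_distribution (t * ?c) = of_real (exp (- (1 - sq_norm \<alpha>) * t\<^sup>2 / 2))"
  proof -
    have "(t * ?c)\<^sup>2 = (1 - sq_norm \<alpha>) * t\<^sup>2"
      using assms by (simp add: power_mult_distrib)
    then show ?thesis
      by (simp only: char_std_normal_distribution minus_mult_left)
  qed
  finally show ?thesis .
qed

text \<open>If the first \<open>N\<close> squares of \<open>\<beta>\<close> sum to at most 1, this
  is the characteristic function of the Rademacher sum with the first \<open>N\<close> coefficients
  plus an independent centred Gaussian that raises the variance to 1. For a unit vector of length
  \<open>N\<close> the Gaussian disappears; for \<open>N\<close> tending to infinity the law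
  \<open>nu\<close> appears.\<close>

definition gauss_cos :: "nat \<Rightarrow> (nat \<Rightarrow> real) \<Rightarrow> real \<Rightarrow> real" where
  "gauss_cos N \<beta> t = exp (- (1 - (\<Sum>k<N. (\<beta> k)\<^sup>2)) * t\<^sup>2 / 2) * (\<Prod>k<N. cos (\<beta> k * t))"

lemma char_nu_LIMSEQ:
  assumes "admissible \<alpha>"
  shows "(\<lambda>N. of_real (gauss_cos N \<alpha> t)) \<longlonglongrightarrow> char (nu \<alpha>) t"
proof -
  from assms have s: "summable (\<lambda>k. (\<alpha> k)\<^sup>2)" "sq_norm \<alpha> \<le> 1"
    by (auto simp: admissible_def)
  show ?thesis
    unfolding char_nu_eq[OF s(2)] gauss_cos_def of_real_mult sq_norm_def
    by (rule tendsto_mult[OF _ integral_iexp_suminf_signs[OF s(1), unfolded of_real_mult]])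
      (intro tendsto_intros summable_LIMSEQ s, simp)
qed

section \<open>Replacing Rademacher factors by Gaussian ones\<close>

lemma abs_exp_minus_linear_le:
  fixes y :: real
  assumes "0 \<le> y"
  shows "\<bar>exp (- y) - (1 - y)\<bar> \<le> y\<^sup>2 / 2"
proof -
  have "1 - 0 + 0\<^sup>2 / 2 - exp (- 0) \<le> 1 - y + y\<^sup>2 / 2 - exp (- y)"
  proof (rule DERIV_nonneg_imp_nondecreasing[OF assms], intro exI conjI)
    fix x :: real assume "0 \<le> x"
    show "((\<lambda>y. 1 - y + y\<^sup>2 / 2 - exp (- y)) has_real_derivative (- 1 + x + exp (- x))) (at x)"
      by (auto intro!: derivative_eq_intros)
    show "0 \<le> - 1 + x + exp (- x)"
      using exp_ge_add_one_self[of "- x"] by simp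
  qed
  then show ?thesis
    using exp_ge_add_one_self[of "- y"] by simp
qed

lemma abs_cos_minus_exp_le:
  fixes x :: real
  shows "\<bar>cos x - exp (- x\<^sup>2 / 2)\<bar> \<le> x ^ 4"
proof -
  \<comment> \<open>The cubic Taylor term is imaginary, so the real part agrees with
    \<open>1 - x\<^sup>2 / 2\<close> up to fourth order. The two remainders carry the factors 1/24
    and 1/8, together less than 1.\<close>
  have "cmod (iexp x - (\<Sum>k\<le>3. (\<i> * x)^k / fact k)) \<le> \<bar>x\<bar>^4 / fact 4"
    using iexp_approx1[of x 3] by simp
  then have "\<bar>Re (iexp x - (\<Sum>k\<le>3. (\<i> * x)^k / fact k))\<bar> \<le> \<bar>x\<bar>^4 / fact 4"
    by (rule order_trans[OF abs_Re_le_cmod])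
  also have "Re (iexp x - (\<Sum>k\<le>3. (\<i> * x)^k / fact k)) = cos x - (1 - x\<^sup>2 / 2)"
    by (simp add: numeral_eq_Suc Re_exp power2_eq_square)
  finally have "\<bar>cos x - (1 - x\<^sup>2 / 2)\<bar> \<le> x ^ 4 / 24"
    by (simp add: fact_numeral)
  moreover have "\<bar>exp (- x\<^sup>2 / 2) - (1 - x\<^sup>2 / 2)\<bar> \<le> x ^ 4 / 8"
    using abs_exp_minus_linear_le[of "x\<^sup>2 / 2"] by (simp add: power2_eq_square numeral_eq_Suc)
  moreover have "0 \<le> x ^ 4"
    by simp
  ultimately show ?thesis
    by linarith
qed

text \<open>A Lindeberg exchange: the signs with index in \<open>{m..<N}\<close> are replaced by
  Gaussians of the same variance. Each exchange costs at most \<open>(\<beta> k * t) ^ 4\<close>;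
  bounding one factor \<open>(\<beta> k)\<^sup>2\<close> by \<open>e\<close> leaves a sum of squares
  that is at most 1.\<close>

lemma gauss_cos_diff:
  assumes "m \<le> N" and sum: "(\<Sum>k<N. (\<beta> k)\<^sup>2) \<le> 1"
    and "0 \<le> e" and e: "\<And>k. m \<le> k \<Longrightarrow> k < N \<Longrightarrow> (\<beta> k)\<^sup>2 \<le> e"
  shows "\<bar>gauss_cos N \<beta> t - gauss_cos m \<beta> t\<bar> \<le> e * t ^ 4"
proof -
  have split: "{..<N} = {..<m} \<union> {m..<N}" "{..<m} \<inter> {m..<N} = {}"
    using \<open>m \<le> N\<close> by auto
  \<comment> \<open>\<open>A\<close> is the common factor: the smaller Gaussian belonging to
    \<open>N\<close> and the first \<open>m\<close> cosines. Beyond it the two functions differ only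
    in cosines against Gaussian factors.\<close>
  define A where "A = exp (- (1 - (\<Sum>k<N. (\<beta> k)\<^sup>2)) * t\<^sup>2 / 2) * (\<Prod>k<m. cos (\<beta> k * t))"
  have "(- (1 - (\<Sum>k<N. (\<beta> k)\<^sup>2)) * t\<^sup>2 / 2) \<le> 0"
    using sum by (simp add: mult_nonpos_nonneg)
  then have "exp (- (1 - (\<Sum>k<N. (\<beta> k)\<^sup>2)) * t\<^sup>2 / 2) \<le> 1"
    by (simp only: exp_le_one_iff)
  moreover have "\<bar>\<Prod>k<m. cos (\<beta> k * t)\<bar> \<le> 1"
    unfolding abs_prod by (rule prod_le_1) auto
  ultimately have A: "\<bar>A\<bar> \<le> 1"
    unfolding A_def abs_mult by (intro mult_le_one) auto
  have "gauss_cos N \<beta> t = A * (\<Prod>k\<in>{m..<N}. cos (\<beta> k * t))"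
  proof -
    have "(\<Prod>k<N. cos (\<beta> k * t)) = (\<Prod>k<m. cos (\<beta> k * t)) * (\<Prod>k\<in>{m..<N}. cos (\<beta> k * t))"
      unfolding split(1) by (rule prod.union_disjoint) (use split(2) in auto)
    then show ?thesis
      by (simp add: gauss_cos_def A_def mult.assoc)
  qed
  moreover have "gauss_cos m \<beta> t = A * (\<Prod>k\<in>{m..<N}. exp (- (\<beta> k * t)\<^sup>2 / 2))"
  proof -
    have "(\<Prod>k\<in>{m..<N}. exp (- (\<beta> k * t)\<^sup>2 / 2)) = exp (- (\<Sum>k\<in>{m..<N}. (\<beta> k)\<^sup>2) * t\<^sup>2 / 2)"
      by (simp add: exp_sum[symmetric] power_mult_distrib sum_distrib_right sum_divide_distrib sum_negf)
    moreover have "(\<Sum>k<N. (\<beta> k)\<^sup>2) = (\<Sum>k<m. (\<beta> k)\<^sup>2) + (\<Sum>k\<in>{m..<N}. (\<beta> k)\<^sup>2)"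
      unfolding split(1) by (subst sum.union_disjoint) (use split(2) in auto)
    ultimately show ?thesis
      unfolding gauss_cos_def A_def by (simp add: exp_add[symmetric] field_simps)
  qed
  ultimately have "\<bar>gauss_cos N \<beta> t - gauss_cos m \<beta> t\<bar> =
      \<bar>A\<bar> * \<bar>(\<Prod>k\<in>{m..<N}. cos (\<beta> k * t)) - (\<Prod>k\<in>{m..<N}. exp (- (\<beta> k * t)\<^sup>2 / 2))\<bar>"
    by (simp add: abs_mult[symmetric] right_diff_distrib)
  \<comment> \<open>All factors lie in \<open>[-1, 1]\<close>, so a telescoping product differs by
    at most the sum of the differences of its factors.\<close>
  also have "\<dots> \<le> 1 * (\<Sum>k\<in>{m..<N}. \<bar>cos (\<beta> k * t) - exp (- (\<beta> k * t)\<^sup>2 / 2)\<bar>)"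
    using norm_prod_diff[of "{m..<N}" "\<lambda>k. cos (\<beta> k * t)" "\<lambda>k. exp (- (\<beta> k * t)\<^sup>2 / 2)"]
    by (intro mult_mono A) auto
  also have "\<dots> \<le> 1 * (\<Sum>k\<in>{m..<N}. e * t ^ 4 * (\<beta> k)\<^sup>2)"
  proof (intro mult_left_mono sum_mono)
    fix k assume k: "k \<in> {m..<N}"
    have "\<bar>cos (\<beta> k * t) - exp (- (\<beta> k * t)\<^sup>2 / 2)\<bar> \<le> (\<beta> k * t) ^ 4"
      by (rule abs_cos_minus_exp_le)
    also have "\<dots> = (\<beta> k)\<^sup>2 * (t ^ 4 * (\<beta> k)\<^sup>2)"
      by (simp add: power_mult_distrib numeral_eq_Suc)
    also have "\<dots> \<le> e * (t ^ 4 * (\<beta> k)\<^sup>2)"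
      using e[of k] k by (intro mult_right_mono) auto
    finally show "\<bar>cos (\<beta> k * t) - exp (- (\<beta> k * t)\<^sup>2 / 2)\<bar> \<le> e * t ^ 4 * (\<beta> k)\<^sup>2"
      by (simp add: mult.assoc)
  qed simp
  also have "\<dots> = e * t ^ 4 * (\<Sum>k\<in>{m..<N}. (\<beta> k)\<^sup>2)"
    by (simp add: sum_distrib_left)
  also have "\<dots> \<le> e * t ^ 4 * 1"
  proof (rule mult_left_mono)
    have "(\<Sum>k\<in>{m..<N}. (\<beta> k)\<^sup>2) \<le> (\<Sum>k<N. (\<beta> k)\<^sup>2)"
      by (rule sum_mono2) auto
    then show "(\<Sum>k\<in>{m..<N}. (\<beta> k)\<^sup>2) \<le> 1"
      using sum by simp
  qed (use \<open>0 \<le> e\<close> in simp)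
  finally show ?thesis by simp
qed

section \<open>Continuity in the coefficients\<close>

text \<open>The hypothesis \<open>approx\<close> holds when the coefficients \<open>\<beta> j k\<close> are uniformly small for large \<open>k\<close>:
  the tails of the coefficient sequences then act like Gaussian random variables.\<close>

lemma LIMSEQ_char:
  assumes \<alpha>: "admissible \<alpha>"
    and \<beta>: "\<And>k. (\<lambda>j. \<beta> j k) \<longlonglongrightarrow> \<alpha> k"
    and approx: "\<And>m. \<forall>\<^sub>F j in sequentially. cmod (\<phi> j - of_real (gauss_cos m (\<beta> j) t)) \<le> e m * t ^ 4"
    and e: "e \<longlonglongrightarrow> 0"
  shows "\<phi> \<longlonglongrightarrow> char (nu \<alpha>) t"
proof (rule tendstoI)
  fix d :: real assume d: "0 < d"
  have "(\<lambda>m. e m * t ^ 4) \<longlonglongrightarrow> 0 * t ^ 4"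
    by (intro tendsto_intros e)
  then have 1: "\<forall>\<^sub>F m in sequentially. e m * t ^ 4 < d / 3"
    by (rule order_tendstoD) (use d in simp)
  have 2: "\<forall>\<^sub>F m in sequentially. dist (of_real (gauss_cos m \<alpha> t)) (char (nu \<alpha>) t) < d / 3"
    by (rule tendstoD[OF char_nu_LIMSEQ[OF \<alpha>]]) (use d in simp)
  from eventually_conj[OF 1 2] obtain m where m: "e m * t ^ 4 < d / 3"
    "dist (of_real (gauss_cos m \<alpha> t)) (char (nu \<alpha>) t) < d / 3"
    by (auto simp: eventually_sequentially)
  have "(\<lambda>j. complex_of_real (gauss_cos m (\<beta> j) t)) \<longlonglongrightarrow> of_real (gauss_cos m \<alpha> t)"
    unfolding gauss_cos_def by (intro tendsto_intros \<beta>) simp_all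
  then have "\<forall>\<^sub>F j in sequentially. dist (complex_of_real (gauss_cos m (\<beta> j) t)) (of_real (gauss_cos m \<alpha> t)) < d / 3"
    by (rule tendstoD) (use d in simp)
  with approx[of m] show "\<forall>\<^sub>F j in sequentially. dist (\<phi> j) (char (nu \<alpha>) t) < d"
  proof eventually_elim
    case (elim j)
    have "dist (\<phi> j) (char (nu \<alpha>) t) \<le> dist (\<phi> j) (of_real (gauss_cos m (\<beta> j) t)) +
      dist (complex_of_real (gauss_cos m (\<beta> j) t)) (of_real (gauss_cos m \<alpha> t)) +
      dist (of_real (gauss_cos m \<alpha> t)) (char (nu \<alpha>) t)"
      using dist_triangle[of "\<phi> j" "char (nu \<alpha>) t" "of_real (gauss_cos m (\<beta> j) t)"]
        dist_triangle[of "of_real (gauss_cos m (\<beta> j) t)" "char (nu \<alpha>) t" "of_real (gauss_cos m \<alpha> t)"]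
      by simp
    then show ?case
      using elim m unfolding dist_norm by linarith
  qed
qed

lemma char_mu_discr_eq_gauss_cos:
  assumes "(\<Sum>i<n. (\<theta> i)\<^sup>2) = 1"
  shows "char (mu_discr n \<theta>) t = of_real (gauss_cos n \<theta> t)"
  using assms by (simp add: char_mu_discr gauss_cos_def)

section \<open>The compact space of coefficient sequences\<close>

lemma decseq_sq_le:
  fixes \<beta> :: "nat \<Rightarrow> real"
  assumes "decseq \<beta>" "\<And>k. 0 \<le> \<beta> k" "\<And>n. (\<Sum>k<n. (\<beta> k)\<^sup>2) \<le> c"
  shows "(\<beta> k)\<^sup>2 \<le> c / real (Suc k)"
proof -
  have "real (Suc k) * (\<beta> k)\<^sup>2 = (\<Sum>i<Suc k. (\<beta> k)\<^sup>2)"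
    by simp
  also have "\<dots> \<le> (\<Sum>i<Suc k. (\<beta> i)\<^sup>2)"
    by (intro sum_mono power_mono) (use assms in \<open>auto simp: decseq_def\<close>)
  also have "\<dots> \<le> c"
    by (rule assms)
  finally show ?thesis
    by (simp add: field_simps)
qed

text \<open>Bounding every partial sum, instead of \<open>sq_norm\<close>, makes each condition
  depend on finitely many coordinates, hence closed under coordinatewise limits. For
  \<open>c < 1\<close> these are exactly the admissible sequences with \<open>sq_norm\<close> at
  most \<open>c\<close>; for \<open>c = 1\<close> the set also contains limits that are not
  admissible.\<close>

definition coeff_seqs :: "real \<Rightarrow> (nat \<Rightarrow> real) set" where
  "coeff_seqs c = {\<beta>. decseq \<beta> \<and> (\<forall>k. 0 \<le> \<beta> k) \<and> (\<forall>n. (\<Sum>k<n. (\<beta> k)\<^sup>2) \<le> c)}"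

lemma admissible_imp_coeff_seqs:
  assumes "admissible \<alpha>" "sq_norm \<alpha> \<le> c"
  shows "\<alpha> \<in> coeff_seqs c"
proof -
  have "(\<Sum>k<n. (\<alpha> k)\<^sup>2) \<le> sq_norm \<alpha>" for n
    unfolding sq_norm_def by (rule sum_le_suminf) (use assms in \<open>auto simp: admissible_def\<close>)
  then have "(\<Sum>k<n. (\<alpha> k)\<^sup>2) \<le> c" for n
    using assms(2) order_trans by blast
  with assms(1) show ?thesis
    by (auto simp: admissible_def coeff_seqs_def)
qed

lemma coeff_seqs_imp_admissible:
  assumes "\<alpha> \<in> coeff_seqs c" "c < 1"
  shows "admissible \<alpha>" "sq_norm \<alpha> \<le> c"
proof -
  have s: "summable (\<lambda>k. (\<alpha> k)\<^sup>2)"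
    by (rule summableI_nonneg_bounded[where x = c]) (use assms in \<open>auto simp: coeff_seqs_def\<close>)
  then show "sq_norm \<alpha> \<le> c"
    unfolding sq_norm_def by (rule suminf_le_const) (use assms in \<open>auto simp: coeff_seqs_def\<close>)
  with s assms show "admissible \<alpha>"
    by (auto simp: admissible_def coeff_seqs_def)
qed

text \<open>A closed subset of a Tychonoff cube: a single square is at most a partial sum, so every
  coordinate lies in \<open>{0..sqrt c}\<close>.\<close>

lemma compact_coeff_seqs: "compact (coeff_seqs c)"
proof -
  have "compactin (product_topology (\<lambda>_::nat. euclidean::real topology) UNIV) (PiE UNIV (\<lambda>_. {0..sqrt c}))"
    by (subst compactin_PiE) (auto simp: compactin_euclidean_iff)
  then have "compact (PiE UNIV (\<lambda>_. {0..sqrt c}) :: (nat \<Rightarrow> real) set)"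
    by (simp add: euclidean_product_topology)
  moreover have "closed (coeff_seqs c)"
    unfolding coeff_seqs_def decseq_def
    by (intro closed_Collect_conj closed_Collect_all closed_Collect_imp closed_Collect_le open_Collect_const
          continuous_on_sum continuous_on_power continuous_on_product_coordinates continuous_on_const)
  moreover have "coeff_seqs c \<subseteq> PiE UNIV (\<lambda>_. {0..sqrt c})"
  proof
    fix \<beta> assume \<beta>: "\<beta> \<in> coeff_seqs c"
    have "\<beta> k \<le> sqrt c" for k
    proof (rule real_le_rsqrt)
      have "(\<beta> k)\<^sup>2 \<le> (\<Sum>i<Suc k. (\<beta> i)\<^sup>2)"
        by (rule member_le_sum) auto
      also have "\<dots> \<le> c"
        using \<beta> unfolding coeff_seqs_def by blast
      finally show "(\<beta> k)\<^sup>2 \<le> c" .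
    qed
    with \<beta> show "\<beta> \<in> PiE UNIV (\<lambda>_. {0..sqrt c})"
      by (auto simp: coeff_seqs_def)
  qed
  ultimately have "compact (PiE UNIV (\<lambda>_. {0..sqrt c}) \<inter> coeff_seqs c)"
    by (intro compact_Int_closed)
  with \<open>coeff_seqs c \<subseteq> _\<close> show ?thesis
    by (simp add: inf.absorb2)
qed

text \<open>Monotonicity forces \<open>(\<beta> k)\<^sup>2 \<le> 1 / Suc k\<close>, so
  \<open>gauss_cos_diff\<close> applies with \<open>e = 1 / Suc m\<close>, and \<open>N\<close>
  tends to infinity. The error does not depend on \<open>\<beta>\<close>; this uniformity gives
  continuity despite the leak of mass.\<close>

lemma char_nu_gauss_cos_le:
  assumes "\<beta> \<in> coeff_seqs c" "c < 1"
  shows "cmod (char (nu \<beta>) t - of_real (gauss_cos m \<beta> t)) \<le> (1 / real (Suc m)) * t ^ 4"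
proof (rule Lim_norm_ubound[OF sequentially_bot])
  have \<beta>: "decseq \<beta>" "\<And>k. 0 \<le> \<beta> k" "\<And>n. (\<Sum>k<n. (\<beta> k)\<^sup>2) \<le> c"
    using assms(1) by (simp_all add: coeff_seqs_def)
  have \<beta>1: "(\<Sum>k<n. (\<beta> k)\<^sup>2) \<le> 1" for n
    using \<beta>(3)[of n] assms(2) by simp
  show "(\<lambda>N. complex_of_real (gauss_cos N \<beta> t) - of_real (gauss_cos m \<beta> t)) \<longlonglongrightarrow> char (nu \<beta>) t - of_real (gauss_cos m \<beta> t)"
    by (intro tendsto_intros char_nu_LIMSEQ coeff_seqs_imp_admissible[OF assms])
  have "\<bar>gauss_cos N \<beta> t - gauss_cos m \<beta> t\<bar> \<le> (1 / real (Suc m)) * t ^ 4" if "m \<le> N" for N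
  proof (rule gauss_cos_diff[OF that \<beta>1])
    fix k assume "m \<le> k"
    show "(\<beta> k)\<^sup>2 \<le> 1 / real (Suc m)"
      by (rule order_trans[OF decseq_sq_le[OF \<beta>(1,2) \<beta>1]]) (use \<open>m \<le> k\<close> in \<open>simp add: frac_le\<close>)
  qed simp
  then show "\<forall>\<^sub>F N in sequentially. cmod (of_real (gauss_cos N \<beta> t) - of_real (gauss_cos m \<beta> t)) \<le> (1 / real (Suc m)) * t ^ 4"
    by (auto simp: eventually_sequentially of_real_diff[symmetric] simp del: of_real_diff)
qed

text \<open>The domain is metrizable as part of a countable product, so sequences suffice there; on
  the side of the laws only the generating integral conditions have to be pulled back.\<close>

lemma continuous_map_nu:
  assumes "c < 1"
  shows "continuous_map (top_of_set (coeff_seqs c)) weak_topology nu"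
proof -
  have lim: "(\<lambda>j. char (nu (\<beta> j)) t) \<longlonglongrightarrow> char (nu \<alpha>) t"
    if "\<And>j. \<beta> j \<in> coeff_seqs c" "\<alpha> \<in> coeff_seqs c" "\<beta> \<longlonglongrightarrow> \<alpha>" for \<beta> \<alpha> t
  proof (rule LIMSEQ_char)
    show "(\<lambda>j. \<beta> j k) \<longlonglongrightarrow> \<alpha> k" for k
      by (rule continuous_on_tendsto_compose[where f = "\<lambda>x. x k" and s = UNIV, OF _ that(3)]) auto
    show "\<forall>\<^sub>F j in sequentially. cmod (char (nu (\<beta> j)) t - of_real (gauss_cos m (\<beta> j) t)) \<le> (1 / real (Suc m)) * t ^ 4" for m
      using char_nu_gauss_cos_le[OF that(1) assms] by simp
    show "(\<lambda>m. 1 / real (Suc m)) \<longlonglongrightarrow> 0"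
      by (rule LIMSEQ_Suc[OF lim_1_over_n])
  qed (rule coeff_seqs_imp_admissible[OF that(2) assms])
  show ?thesis
    unfolding weak_topology_def
  proof (rule continuous_on_generated_topo, goal_cases)
    case (1 V)
    then obtain f :: "real \<Rightarrow> real" and U where V: "V = {\<mu>. real_distribution \<mu> \<and> (\<integral>x. f x \<partial>\<mu>) \<in> U}"
      and f: "continuous_on UNIV f" "bounded (range f)" and U: "open U"
      by blast
    from f(2) obtain B where B: "\<And>x. norm (f x) \<le> B"
      by (auto simp: bounded_iff)
    have "continuous_on (coeff_seqs c) (\<lambda>\<alpha>. \<integral>x. f x \<partial>nu \<alpha>)"
      unfolding continuous_on_sequentially comp_def
    proof (intro allI ballI impI)
      fix \<beta> :: "nat \<Rightarrow> nat \<Rightarrow> real" and \<alpha>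
      assume "\<alpha> \<in> coeff_seqs c" "(\<forall>n. \<beta> n \<in> coeff_seqs c) \<and> \<beta> \<longlonglongrightarrow> \<alpha>"
      then have "weak_conv_m (\<lambda>j. nu (\<beta> j)) (nu \<alpha>)"
        by (intro levy_continuity lim real_distribution_nu) auto
      then show "(\<lambda>n. \<integral>x. f x \<partial>nu (\<beta> n)) \<longlonglongrightarrow> (\<integral>x. f x \<partial>nu \<alpha>)"
        using real_distribution_nu B f(1)
        by (intro weak_conv_imp_integral_bdd_continuous_conv) (auto simp: continuous_on_eq_continuous_at)
    qed
    then have "openin (top_of_set (coeff_seqs c)) (coeff_seqs c \<inter> (\<lambda>\<alpha>. \<integral>x. f x \<partial>nu \<alpha>) -` U)"
      using U by (rule continuous_openin_preimage_gen)
    moreover have "nu -` V \<inter> topspace (top_of_set (coeff_seqs c)) = coeff_seqs c \<inter> (\<lambda>\<alpha>. \<integral>x. f x \<partial>nu \<alpha>) -` U"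
      by (auto simp: V real_distribution_nu)
    ultimately show ?case
      by simp
  next
    case 2
    have "topspace weak_topology = {\<mu>. real_distribution \<mu>}"
      by simp
    then show ?case
      unfolding weak_topology_def topology_generated_by_topspace by (auto simp: real_distribution_nu)
  qed
qed

lemma compactin_nu_image:
  assumes "c < 1"
  shows "compactin weak_topology (nu ` coeff_seqs c)"
  by (rule image_compactin[OF _ continuous_map_nu[OF assms]])
    (simp add: compactin_subtopology compact_coeff_seqs)

section \<open>The norm is determined by the law\<close>

lemma nn_integral_exp_sum_signs:
  "(\<integral>\<^sup>+v. ennreal (exp (\<Sum>k<N. a k * v k)) \<partial>signs) = ennreal (\<Prod>k<N. cosh (a k))"
proof (induction N arbitrary: a)
  case 0
  show ?case
    using signs.P.emeasure_space_1 by simp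
next
  case (Suc N)
  have *: "(\<integral>\<^sup>+v. ennreal (exp (\<Sum>k<Suc N. a k * case_nat s v k)) \<partial>signs) =
      ennreal (exp (a 0 * s) * (\<Prod>k<N. cosh (a (Suc k))))" for s
  proof -
    have "(\<integral>\<^sup>+v. ennreal (exp (\<Sum>k<Suc N. a k * case_nat s v k)) \<partial>signs) =
      (\<integral>\<^sup>+v. ennreal (exp (a 0 * s)) * ennreal (exp (\<Sum>k<N. a (Suc k) * v k)) \<partial>signs)"
      unfolding sum.lessThan_Suc_shift by (simp add: exp_add ennreal_mult')
    also have "\<dots> = ennreal (exp (a 0 * s)) * ennreal (\<Prod>k<N. cosh (a (Suc k)))"
      by (subst nn_integral_cmult) (auto simp: Suc.IH)
    finally show ?thesis
      by (simp add: ennreal_mult')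
  qed
  define p where "p = (\<Prod>k<N. cosh (a (Suc k)))"
  have p: "0 \<le> p"
    unfolding p_def by (intro prod_nonneg) (simp add: cosh_real_nonneg)
  have "(\<integral>\<^sup>+v. ennreal (exp (\<Sum>k<Suc N. a k * v k)) \<partial>signs) =
    (ennreal (exp (a 0 * (-1)) * p) + ennreal (exp (a 0 * 1) * p)) / 2"
    by (subst nn_integral_signs_first) (simp_all only: * p_def, measurable)
  also have "\<dots> = ennreal ((exp (a 0 * (-1)) * p + exp (a 0 * 1) * p) / 2)"
    using p by (simp add: ennreal_plus[symmetric] ennreal_divide_numeral[symmetric] del: ennreal_plus)
  also have "(exp (a 0 * (-1)) * p + exp (a 0 * 1) * p) / 2 = cosh (a 0) * p"
    by (simp add: cosh_field_def field_simps)
  also have "\<dots> = (\<Prod>k<Suc N. cosh (a k))"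
    unfolding prod.lessThan_Suc_shift p_def ..
  finally show ?case .
qed

section \<open>Elementary bounds for exponential moments\<close>

lemma tanh_le_self:
  fixes x :: real
  assumes "0 \<le> x"
  shows "tanh x \<le> x"
proof -
  have "0 - tanh 0 \<le> x - tanh x"
  proof (rule DERIV_nonneg_imp_nondecreasing[OF assms], intro exI conjI)
    fix y :: real
    show "((\<lambda>y. y - tanh y) has_real_derivative (tanh y)\<^sup>2) (at y)"
      by (auto intro!: derivative_eq_intros simp: cosh_real_pos less_imp_neq[symmetric])
  qed simp
  then show ?thesis by simp
qed

text \<open>The sub-Gaussian bound for a sign. The difference of the logarithms vanishes at 0 and
  has derivative \<open>y - tanh y\<close>, which is nonnegative for
  \<open>y \<ge> 0\<close>.\<close>

lemma cosh_le_exp_sq: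
  fixes x :: real
  shows "cosh x \<le> exp (x\<^sup>2 / 2)"
proof -
  have *: "cosh x \<le> exp (x\<^sup>2 / 2)" if "0 \<le> x" for x :: real
  proof -
    have "0\<^sup>2 / 2 - ln (cosh 0) \<le> x\<^sup>2 / 2 - ln (cosh x)"
    proof (rule DERIV_nonneg_imp_nondecreasing[OF that], intro exI conjI)
      fix y :: real assume "0 \<le> y"
      show "((\<lambda>y. y\<^sup>2 / 2 - ln (cosh y)) has_real_derivative (y - tanh y)) (at y)"
        by (auto intro!: derivative_eq_intros simp: cosh_real_pos tanh_def)
      show "0 \<le> y - tanh y"
        using tanh_le_self[OF \<open>0 \<le> y\<close>] by simp
    qed
    then show ?thesis
      using cosh_real_pos[of x] by (simp add: ln_le_cancel_iff[symmetric] del: ln_le_cancel_iff)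
  qed
  show ?thesis
    using *[of "\<bar>x\<bar>"] by simp
qed

text \<open>The exponent grows only linearly here, so finitely many coefficients do not affect the
  quadratic growth in \<open>u\<close> of the logarithm of the Laplace transform.\<close>

lemma cosh_le_exp_abs:
  fixes x :: real
  shows "cosh x \<le> exp \<bar>x\<bar>"
proof -
  have "exp x \<le> exp \<bar>x\<bar>" "exp (- x) \<le> exp \<bar>x\<bar>"
    by auto
  then have "exp x + exp (- x) \<le> 2 * exp \<bar>x\<bar>"
    by linarith
  then show ?thesis
    by (simp add: cosh_field_def)
qed

lemma nn_integral_exp_std_normal:
  "(\<integral>\<^sup>+z. ennreal (exp (a * z)) \<partial>std_normal_distribution) = ennreal (exp (a\<^sup>2 / 2))"
proof -
  have "(\<integral>\<^sup>+z. ennreal (exp (a * z)) \<partial>std_normal_distribution) =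
    (\<integral>\<^sup>+z. ennreal (exp (a\<^sup>2 / 2)) * ennreal (normal_density a 1 z) \<partial>lborel)"
    by (subst nn_integral_density)
      (auto intro!: nn_integral_cong simp: ennreal_mult'[symmetric] normal_density_def exp_add[symmetric]
        power2_eq_square field_simps)
  also have "\<dots> = ennreal (exp (a\<^sup>2 / 2)) * (\<integral>\<^sup>+z. ennreal (normal_density a 1 z) \<partial>lborel)"
    by (rule nn_integral_cmult) simp
  also have "(\<integral>\<^sup>+z. ennreal (normal_density a 1 z) \<partial>lborel) = 1"
    by (subst nn_integral_eq_integral) auto
  finally show ?thesis by simp
qed

lemma nn_integral_exp_nu:
  "(\<integral>\<^sup>+x. ennreal (exp (u * x)) \<partial>nu \<alpha>) =
    ennreal (exp ((u * sqrt (1 - sq_norm \<alpha>))\<^sup>2 / 2)) * (\<integral>\<^sup>+v. ennreal (exp (u * (\<Sum>k. \<alpha> k * v k))) \<partial>signs)"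
proof -
  let ?c = "sqrt (1 - sq_norm \<alpha>)"
  have "(\<integral>\<^sup>+x. ennreal (exp (u * x)) \<partial>nu \<alpha>) =
      (\<integral>\<^sup>+p. ennreal (exp (u * nu_fun \<alpha> p)) \<partial>(std_normal_distribution \<Otimes>\<^sub>M signs))"
    unfolding nu_def nu_fun_def[symmetric] by (subst nn_integral_distr) auto
  also have "\<dots> = (\<integral>\<^sup>+z. (\<integral>\<^sup>+v. ennreal (exp (u * nu_fun \<alpha> (z, v))) \<partial>signs) \<partial>std_normal_distribution)"
    by (subst signs.nn_integral_fst[symmetric]) auto
  also have "\<dots> = (\<integral>\<^sup>+z. ennreal (exp (u * ?c * z)) * (\<integral>\<^sup>+v. ennreal (exp (u * (\<Sum>k. \<alpha> k * v k))) \<partial>signs) \<partial>std_normal_distribution)"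
    unfolding nu_fun_def
    by (simp add: distrib_left exp_add mult.assoc ennreal_mult' nn_integral_cmult)
  also have "\<dots> = ennreal (exp ((u * ?c)\<^sup>2 / 2)) * (\<integral>\<^sup>+v. ennreal (exp (u * (\<Sum>k. \<alpha> k * v k))) \<partial>signs)"
    by (subst nn_integral_multc) (auto simp: nn_integral_exp_std_normal)
  finally show ?thesis .
qed

text \<open>The first \<open>m\<close> factors get the linear bound, the others the sub-Gaussian
  one; Fatou's lemma carries the bound to the infinite series. The free \<open>m\<close> makes the
  quadratic coefficient arbitrarily small.\<close>

lemma nn_integral_exp_signs_le:
  assumes "admissible \<alpha>" "0 \<le> u"
  shows "(\<integral>\<^sup>+v. ennreal (exp (u * (\<Sum>k. \<alpha> k * v k))) \<partial>signs) \<le>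
    ennreal (exp (u * (\<Sum>k<m. \<alpha> k) + u\<^sup>2 * (\<Sum>k. (\<alpha> (k + m))\<^sup>2) / 2))" (is "_ \<le> ennreal ?B")
proof -
  from assms have s: "summable (\<lambda>k. (\<alpha> k)\<^sup>2)" and nonneg: "\<And>k. 0 \<le> \<alpha> k"
    by (auto simp: admissible_def)
  have le: "(\<integral>\<^sup>+v. ennreal (exp (u * (\<Sum>k<N. \<alpha> k * v k))) \<partial>signs) \<le> ennreal ?B" if "m \<le> N" for N
  proof -
    have "(\<integral>\<^sup>+v. ennreal (exp (u * (\<Sum>k<N. \<alpha> k * v k))) \<partial>signs) = ennreal (\<Prod>k<N. cosh (u * \<alpha> k))"
      using nn_integral_exp_sum_signs[of "\<lambda>k. u * \<alpha> k" N] by (simp add: sum_distrib_left mult.assoc)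
    also have "\<dots> = ennreal ((\<Prod>k<m. cosh (u * \<alpha> k)) * (\<Prod>k\<in>{m..<N}. cosh (u * \<alpha> k)))"
      using that by (simp add: lessThan_atLeast0 prod.atLeastLessThan_concat)
    also have "\<dots> \<le> ennreal ((\<Prod>k<m. exp (u * \<alpha> k)) * (\<Prod>k\<in>{m..<N}. exp ((u * \<alpha> k)\<^sup>2 / 2)))"
    proof (intro ennreal_leI mult_mono prod_mono prod_nonneg conjI)
      fix k
      show "cosh (u * \<alpha> k) \<le> exp (u * \<alpha> k)"
        using cosh_le_exp_abs[of "u * \<alpha> k"] assms(2) nonneg[of k] by simp
    qed (auto simp: cosh_real_nonneg cosh_le_exp_sq)
    also have "(\<Prod>k<m. exp (u * \<alpha> k)) * (\<Prod>k\<in>{m..<N}. exp ((u * \<alpha> k)\<^sup>2 / 2)) =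
        exp (u * (\<Sum>k<m. \<alpha> k) + u\<^sup>2 * (\<Sum>k\<in>{m..<N}. (\<alpha> k)\<^sup>2) / 2)"
      by (simp add: exp_sum[symmetric] exp_add sum_distrib_left power_mult_distrib sum_divide_distrib)
    also have "ennreal \<dots> \<le> ennreal ?B"
    proof -
      have "(\<Sum>k\<in>{m..<N}. (\<alpha> k)\<^sup>2) = (\<Sum>k<N - m. (\<alpha> (k + m))\<^sup>2)"
        using sum.shift_bounds_nat_ivl[of "\<lambda>k. (\<alpha> k)\<^sup>2" 0 m "N - m"] that by (simp add: lessThan_atLeast0)
      also have "\<dots> \<le> (\<Sum>k. (\<alpha> (k + m))\<^sup>2)"
        using s by (intro sum_le_suminf) (auto intro: summable_ignore_initial_segment)
      finally show ?thesis
        by (intro ennreal_leI) (simp add: mult_left_mono)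
    qed
    finally show ?thesis .
  qed
  have "(\<integral>\<^sup>+v. ennreal (exp (u * (\<Sum>k. \<alpha> k * v k))) \<partial>signs) \<le>
      (\<integral>\<^sup>+v. liminf (\<lambda>N. ennreal (exp (u * (\<Sum>k<N. \<alpha> k * v k)))) \<partial>signs)"
  proof (rule nn_integral_mono_AE)
    show "AE v in signs. ennreal (exp (u * (\<Sum>k. \<alpha> k * v k))) \<le>
      liminf (\<lambda>N. ennreal (exp (u * (\<Sum>k<N. \<alpha> k * v k))))"
      using AE_summable_signs[OF s]
    proof eventually_elim
      case (elim v)
      have "(\<lambda>N. ennreal (exp (u * (\<Sum>k<N. \<alpha> k * v k)))) \<longlonglongrightarrow> ennreal (exp (u * (\<Sum>k. \<alpha> k * v k)))"
        by (intro tendsto_ennrealI tendsto_intros summable_LIMSEQ elim)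
      then show ?case
        by (rule eq_refl[OF lim_imp_Liminf[OF sequentially_bot, symmetric]])
    qed
  qed
  also have "\<dots> \<le> liminf (\<lambda>N. \<integral>\<^sup>+v. ennreal (exp (u * (\<Sum>k<N. \<alpha> k * v k))) \<partial>signs)"
    by (rule nn_integral_liminf) measurable
  also have "\<dots> \<le> liminf (\<lambda>N. ennreal ?B)"
    by (rule Liminf_mono) (use le in \<open>auto simp: eventually_sequentially\<close>)
  also have "\<dots> = ennreal ?B"
    by (simp add: Liminf_const)
  finally show ?thesis .
qed

text \<open>The series has a real value at every point, also where it diverges, so for some
  \<open>n\<close> it is at least \<open>- n\<close> with probability above 1/2. The logarithm thus
  decreases at most linearly in \<open>u\<close>.\<close>

lemma nn_integral_exp_signs_ge:
  "\<exists>K. \<forall>u\<ge>0. ennreal (exp (- (u * K)) / 2) \<le> (\<integral>\<^sup>+v. ennreal (exp (u * (\<Sum>k. \<alpha> k * v k))) \<partial>signs)"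
proof -
  let ?S = "\<lambda>v. \<Sum>k. \<alpha> k * v k"
  let ?E = "\<lambda>n. {v. - real n \<le> ?S v}"
  have pred: "Measurable.pred signs (\<lambda>v. - real n \<le> ?S v)" for n
    by measurable
  then have "range ?E \<subseteq> sets signs"
    by (auto simp: pred_def)
  moreover have "incseq ?E"
    by (auto simp: incseq_def)
  ultimately have "(\<lambda>n. measure signs (?E n)) \<longlonglongrightarrow> measure signs (\<Union>n. ?E n)"
    by (rule signs.P.finite_Lim_measure_incseq)
  also have "(\<Union>n. ?E n) = space signs"
  proof -
    have "\<exists>n. - real n \<le> ?S v" for v
    proof -
      obtain n where "- ?S v \<le> real n"
        using real_arch_simple by blast
      then show ?thesis
        by (intro exI[of _ n]) linarith
    qed
    then show ?thesis
      by auto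
  qed
  finally have "(\<lambda>n. measure signs (?E n)) \<longlonglongrightarrow> 1"
    by (simp only: signs.P.prob_space)
  then have "\<forall>\<^sub>F n in sequentially. 1/2 < measure signs (?E n)"
    by (rule order_tendstoD) simp
  then obtain n where n: "1/2 < measure signs (?E n)"
    by (auto simp: eventually_sequentially)
  show ?thesis
  proof (intro exI[of _ "real n"] allI impI)
    fix u :: real assume "0 \<le> u"
    have "ennreal (exp (- (u * real n)) / 2) \<le> ennreal (exp (- (u * real n)) * measure signs (?E n))"
      using n by (intro ennreal_leI) simp
    also have "\<dots> = ennreal (exp (- (u * real n))) * emeasure signs (?E n)"
      by (simp add: ennreal_mult' signs.P.emeasure_eq_measure)
    also have "\<dots> = (\<integral>\<^sup>+v. ennreal (exp (- (u * real n))) * indicator (?E n) v \<partial>signs)"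
      using pred by (subst nn_integral_cmult_indicator) (auto simp: pred_def)
    also have "\<dots> \<le> (\<integral>\<^sup>+v. ennreal (exp (u * ?S v)) \<partial>signs)"
    proof (intro nn_integral_mono)
      fix v
      show "ennreal (exp (- (u * real n))) * indicator (?E n) v \<le> ennreal (exp (u * ?S v))"
        using mult_left_mono[of "- real n" "?S v" u] \<open>0 \<le> u\<close>
        by (auto simp: indicator_def intro!: ennreal_leI)
    qed
    finally show "ennreal (exp (- (u * real n)) / 2) \<le> (\<integral>\<^sup>+v. ennreal (exp (u * ?S v)) \<partial>signs)" .
  qed
qed

text \<open>The Laplace transform of \<open>nu \<alpha>\<close> at \<open>u\<close> is \<open>exp ((1 - sq_norm \<alpha> + o(1)) * u\<^sup>2 / 2)\<close> for large \<open>u\<close>.\<close>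

lemma sq_norm_le_if_nu_eq:
  assumes \<alpha>: "admissible \<alpha>" and \<beta>: "admissible \<beta>" and eq: "nu \<alpha> = nu \<beta>"
  shows "sq_norm \<beta> \<le> sq_norm \<alpha>"
proof (rule ccontr)
  assume "\<not> ?thesis"
  define d where "d = sq_norm \<beta> - sq_norm \<alpha>"
  with \<open>\<not> ?thesis\<close> have d: "0 < d"
    by simp
  from \<beta> have "summable (\<lambda>k. (\<beta> k)\<^sup>2)"
    by (auto simp: admissible_def)
  \<comment> \<open>The Gaussian parts differ by \<open>d / 2 * u\<^sup>2\<close> in the exponent; a
    tail below \<open>d / 2\<close> takes back at most \<open>d / 4 * u\<^sup>2\<close>, so
    \<open>d / 4 * u\<^sup>2\<close> survives in \<open>key\<close>.\<close>
  from order_tendstoD(2)[OF suminf_exist_split2[OF this], of "d / 2"] d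
  obtain m where m: "(\<Sum>k. (\<beta> (k + m))\<^sup>2) < d / 2"
    by (auto simp: eventually_sequentially)
  obtain K where K: "\<And>u. 0 \<le> u \<Longrightarrow>
      ennreal (exp (- (u * K)) / 2) \<le> (\<integral>\<^sup>+v. ennreal (exp (u * (\<Sum>k. \<alpha> k * v k))) \<partial>signs)"
    using nn_integral_exp_signs_ge by blast
  define B where "B = (\<Sum>k<m. \<beta> k)"
  have key: "d / 4 * u\<^sup>2 \<le> u * (K + B) + ln 2" if u: "0 \<le> u" for u
  proof -
    have "ennreal (exp ((u * sqrt (1 - sq_norm \<alpha>))\<^sup>2 / 2)) * ennreal (exp (- (u * K)) / 2) \<le>
        (\<integral>\<^sup>+x. ennreal (exp (u * x)) \<partial>nu \<alpha>)"
      unfolding nn_integral_exp_nu by (intro mult_left_mono K u) simp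
    also have "\<dots> = (\<integral>\<^sup>+x. ennreal (exp (u * x)) \<partial>nu \<beta>)"
      by (simp only: eq)
    also have "\<dots> \<le> ennreal (exp ((u * sqrt (1 - sq_norm \<beta>))\<^sup>2 / 2)) *
        ennreal (exp (u * B + u\<^sup>2 * (\<Sum>k. (\<beta> (k + m))\<^sup>2) / 2))"
      unfolding nn_integral_exp_nu B_def by (intro mult_left_mono nn_integral_exp_signs_le[OF \<beta>] u) simp
    finally have "exp ((u * sqrt (1 - sq_norm \<alpha>))\<^sup>2 / 2) * (exp (- (u * K)) / 2) \<le>
        exp ((u * sqrt (1 - sq_norm \<beta>))\<^sup>2 / 2) * exp (u * B + u\<^sup>2 * (\<Sum>k. (\<beta> (k + m))\<^sup>2) / 2)"
      by (simp add: ennreal_mult'[symmetric])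
    also have "exp ((u * sqrt (1 - sq_norm \<alpha>))\<^sup>2 / 2) * (exp (- (u * K)) / 2) =
        exp (u\<^sup>2 * (1 - sq_norm \<alpha>) / 2 - u * K - ln 2)"
    proof -
      have "(u * sqrt (1 - sq_norm \<alpha>))\<^sup>2 = u\<^sup>2 * (1 - sq_norm \<alpha>)"
        using \<alpha> by (simp add: power_mult_distrib admissible_def)
      moreover have "exp a * (exp (- b) / 2) = exp (a - b - ln 2)" for a b :: real
        by (simp only: exp_diff exp_ln zero_less_numeral mult_exp_exp times_divide_eq_right add_uminus_conv_diff)
      ultimately show ?thesis
        by metis
    qed
    also have "exp ((u * sqrt (1 - sq_norm \<beta>))\<^sup>2 / 2) * exp (u * B + u\<^sup>2 * (\<Sum>k. (\<beta> (k + m))\<^sup>2) / 2) =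
        exp (u\<^sup>2 * (1 - sq_norm \<beta>) / 2 + (u * B + u\<^sup>2 * (\<Sum>k. (\<beta> (k + m))\<^sup>2) / 2))"
      using \<beta> by (simp add: exp_add[symmetric] power_mult_distrib admissible_def)
    finally have "u\<^sup>2 * (1 - sq_norm \<alpha>) / 2 - u * K - ln 2 \<le>
        u\<^sup>2 * (1 - sq_norm \<beta>) / 2 + (u * B + u\<^sup>2 * (\<Sum>k. (\<beta> (k + m))\<^sup>2) / 2)"
      by simp
    moreover have "u\<^sup>2 * (\<Sum>k. (\<beta> (k + m))\<^sup>2) \<le> u\<^sup>2 * (d / 2)"
      using m by (intro mult_left_mono) auto
    ultimately show ?thesis
      unfolding d_def by (simp add: field_simps)
  qed
  \<comment> \<open>Chosen so that \<open>d / 4 * u\<close> exceeds \<open>\<bar>K + B\<bar>\<close>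
    by at least 1; with \<open>u \<ge> 1\<close> and \<open>ln 2 < 1\<close> this contradicts
    \<open>key\<close>.\<close>
  define u where "u = max 1 (4 * (\<bar>K + B\<bar> + 1) / d)"
  have u: "1 \<le> u" "4 * (\<bar>K + B\<bar> + 1) / d \<le> u"
    by (auto simp: u_def)
  have "u * (\<bar>K + B\<bar> + 1) \<le> u * (d / 4 * u)"
    using u d by (intro mult_left_mono) (auto simp: field_simps)
  also have "\<dots> \<le> u * (K + B) + ln 2"
    using key[of u] u by (simp add: power2_eq_square mult_ac)
  also have "\<dots> \<le> u * \<bar>K + B\<bar> + ln 2"
    using u by (intro add_right_mono mult_left_mono) auto
  also have "ln (2::real) < 1"
    using ln_less_self[of 2] ln2_le_25_over_36 by simp
  also have "u * \<bar>K + B\<bar> + 1 \<le> u * (\<bar>K + B\<bar> + 1)"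
    using u by (simp add: distrib_left)
  finally show False by simp
qed

lemma sq_norm_eq_if_nu_eq:
  assumes "admissible \<alpha>" "admissible \<beta>" "nu \<alpha> = nu \<beta>"
  shows "sq_norm \<alpha> = sq_norm \<beta>"
  using sq_norm_le_if_nu_eq[OF assms] sq_norm_le_if_nu_eq[OF assms(2,1) assms(3)[symmetric]] by simp

section \<open>Coefficients of laws in open and closed sets\<close>

text \<open>The law \<open>mu_discr n \<theta>\<close> does not change when coordinates are permuted
  or change sign. Padding with zeros puts vectors of all dimensions into one sequence space, where
  compactness is available.\<close>

lemma decreasing_rearrangement:
  fixes \<theta> :: "nat \<Rightarrow> real"
  obtains \<pi> \<beta> where "bij_betw \<pi> {..<n} {..<n}" "decseq \<beta>" "\<And>k. 0 \<le> \<beta> k"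
    "\<And>k. n \<le> k \<Longrightarrow> \<beta> k = 0" "\<And>i. i < n \<Longrightarrow> \<beta> i = \<bar>\<theta> (\<pi> i)\<bar>"
proof -
  define xs where "xs = sort_key (\<lambda>i. - \<bar>\<theta> i\<bar>) [0..<n]"
  have xs: "length xs = n" "set xs = {..<n}" "distinct xs"
    by (auto simp: xs_def)
  have sorted: "sorted (map (\<lambda>i. - \<bar>\<theta> i\<bar>) xs)"
    unfolding xs_def by (rule sorted_sort_key)
  define \<beta> where "\<beta> k = (if k < n then \<bar>\<theta> (xs ! k)\<bar> else 0)" for k
  show thesis
  proof (rule that)
    show "bij_betw ((!) xs) {..<n} {..<n}"
      using bij_betw_nth[OF xs(3)] xs by simp
    show "decseq \<beta>"
      unfolding decseq_def
    proof (intro allI impI)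
      fix i j :: nat assume "i \<le> j"
      show "\<beta> j \<le> \<beta> i"
      proof (cases "j < n")
        case True
        with sorted \<open>i \<le> j\<close> show ?thesis
          using sorted_nth_mono[OF sorted \<open>i \<le> j\<close>] xs(1) by (simp add: \<beta>_def)
      qed (simp add: \<beta>_def)
    qed
  qed (auto simp: \<beta>_def)
qed

text \<open>Otherwise there are laws in \<open>C\<close> from higher and higher dimensions whose
  \<open>m\<close> largest coordinates carry less than \<open>c\<close>. A coordinatewise limit of
  their rearrangements lies in \<open>coeff_seqs c\<close>, and the laws converge to its
  \<open>nu\<close>, which is outside the closed set \<open>C\<close>.\<close>

lemma closedin_weak_topology_concentration:
  assumes C: "closedin weak_topology C" and c: "c < 1" and disj: "C \<inter> nu ` coeff_seqs c = {}"
  obtains m where "\<And>n \<theta>. m \<le> n \<Longrightarrow> (\<Sum>i<n. (\<theta> i)\<^sup>2) = 1 \<Longrightarrow> mu_discr n \<theta> \<in> C \<Longrightarrow>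
    \<exists>S\<subseteq>{..<n}. card S = m \<and> c \<le> (\<Sum>i\<in>S. (\<theta> i)\<^sup>2)"
proof (rule ccontr)
  assume "\<not> thesis"
  \<comment> \<open>One index \<open>m\<close> bounds both the dimension from below and the number
    of heavy coordinates, so both tend to infinity along the counterexamples.\<close>
  have "\<exists>n \<theta>. m \<le> n \<and> (\<Sum>i<n. (\<theta> i)\<^sup>2) = 1 \<and> mu_discr n \<theta> \<in> C \<and>
      (\<forall>S\<subseteq>{..<n}. card S = m \<longrightarrow> (\<Sum>i\<in>S. (\<theta> i)\<^sup>2) < c)" for m
  proof (rule ccontr)
    assume *: "\<not> ?thesis"
    show False
    proof (rule \<open>\<not> thesis\<close>[THEN notE], rule that)
      fix n and \<theta> :: "nat \<Rightarrow> real"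
      assume "m \<le> n" "(\<Sum>i<n. (\<theta> i)\<^sup>2) = 1" "mu_discr n \<theta> \<in> C"
      with * show "\<exists>S\<subseteq>{..<n}. card S = m \<and> c \<le> (\<Sum>i\<in>S. (\<theta> i)\<^sup>2)"
        by (auto simp: not_less)
    qed
  qed
  then obtain n \<theta> where n: "\<And>m. m \<le> n m" and unit: "\<And>m. (\<Sum>i<n m. (\<theta> m i)\<^sup>2) = 1"
    and inC: "\<And>m. mu_discr (n m) (\<theta> m) \<in> C"
    and lt: "\<And>m S. S \<subseteq> {..<n m} \<Longrightarrow> card S = m \<Longrightarrow> (\<Sum>i\<in>S. (\<theta> m i)\<^sup>2) < c"
    by metis
  have "\<forall>m. \<exists>\<beta> \<pi>. bij_betw \<pi> {..<n m} {..<n m} \<and> decseq \<beta> \<and> (\<forall>k. 0 \<le> \<beta> k) \<and>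
    (\<forall>k\<ge>n m. \<beta> k = 0) \<and> (\<forall>i<n m. \<beta> i = \<bar>\<theta> m (\<pi> i)\<bar>)"
  proof
    fix m
    obtain \<pi> \<beta> where "bij_betw \<pi> {..<n m} {..<n m}" "decseq \<beta>" "\<And>k. 0 \<le> \<beta> k"
      "\<And>k. n m \<le> k \<Longrightarrow> \<beta> k = 0" "\<And>i. i < n m \<Longrightarrow> \<beta> i = \<bar>\<theta> m (\<pi> i)\<bar>"
      using decreasing_rearrangement[of "n m" "\<theta> m"] by blast
    then show "\<exists>\<beta> \<pi>. bij_betw \<pi> {..<n m} {..<n m} \<and> decseq \<beta> \<and> (\<forall>k. 0 \<le> \<beta> k) \<and>
        (\<forall>k\<ge>n m. \<beta> k = 0) \<and> (\<forall>i<n m. \<beta> i = \<bar>\<theta> m (\<pi> i)\<bar>)"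
      by blast
  qed
  then obtain \<beta> \<pi> where \<pi>: "\<And>m. bij_betw (\<pi> m) {..<n m} {..<n m}" and \<beta>: "\<And>m. decseq (\<beta> m)"
    "\<And>m k. 0 \<le> \<beta> m k" "\<And>m k. n m \<le> k \<Longrightarrow> \<beta> m k = 0" "\<And>m i. i < n m \<Longrightarrow> \<beta> m i = \<bar>\<theta> m (\<pi> m i)\<bar>"
    by metis
  have \<beta>_unit: "(\<Sum>i<n m. (\<beta> m i)\<^sup>2) = 1" for m
    using sum.reindex_bij_betw[OF \<pi>[of m], of "\<lambda>i. (\<theta> m i)\<^sup>2"] by (simp add: \<beta>(4) unit)
  have \<beta>_le: "(\<Sum>i<p. (\<beta> m i)\<^sup>2) \<le> 1" for m p
  proof -
    have "(\<Sum>i<p. (\<beta> m i)\<^sup>2) \<le> (\<Sum>i<max p (n m). (\<beta> m i)\<^sup>2)"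
      by (rule sum_mono2) auto
    also have "\<dots> = (\<Sum>i<n m. (\<beta> m i)\<^sup>2)"
      by (rule sum.mono_neutral_right) (auto simp: \<beta>(3))
    finally show ?thesis
      by (simp add: \<beta>_unit)
  qed
  have \<beta>_lt: "(\<Sum>i<p. (\<beta> m i)\<^sup>2) \<le> c" if "p \<le> m" for m p
  proof -
    have inj: "inj_on (\<pi> m) {..<m}"
      using \<pi>[of m] n[of m] by (auto simp: bij_betw_def intro: inj_on_subset)
    have "(\<Sum>i<p. (\<beta> m i)\<^sup>2) \<le> (\<Sum>i<m. (\<beta> m i)\<^sup>2)"
      using that by (intro sum_mono2) auto
    also have "\<dots> = (\<Sum>i<m. (\<theta> m (\<pi> m i))\<^sup>2)"
      using n[of m] by (intro sum.cong) (auto simp: \<beta>(4))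
    also have "\<dots> = (\<Sum>i\<in>\<pi> m ` {..<m}. (\<theta> m i)\<^sup>2)"
      by (simp add: sum.reindex[OF inj])
    also have "\<dots> < c"
    proof (rule lt)
      show "\<pi> m ` {..<m} \<subseteq> {..<n m}"
        using \<pi>[of m] n[of m] by (auto simp: bij_betw_def)
      show "card (\<pi> m ` {..<m}) = m"
        using card_image[OF inj] by simp
    qed
    finally show ?thesis by simp
  qed
  have char_eq: "char (mu_discr (n m) (\<theta> m)) t = of_real (gauss_cos (n m) (\<beta> m) t)" for m t
  proof -
    have cos_abs: "cos (\<bar>x\<bar> * t) = cos (x * t)" for x :: real
      by (cases "0 \<le> x") auto
    have "(\<Prod>i<n m. cos (\<beta> m i * t)) = (\<Prod>i<n m. cos (\<theta> m (\<pi> m i) * t))"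
      by (intro prod.cong) (auto simp: \<beta>(4) cos_abs)
    also have "\<dots> = (\<Prod>i<n m. cos (\<theta> m i * t))"
      using prod.reindex_bij_betw[OF \<pi>[of m], of "\<lambda>i. cos (\<theta> m i * t)"] by simp
    finally show ?thesis
      by (simp add: char_mu_discr gauss_cos_def \<beta>_unit)
  qed
  have "\<forall>m. \<beta> m \<in> coeff_seqs 1"
    using \<beta> \<beta>_le by (auto simp: coeff_seqs_def)
  with compact_coeff_seqs[of 1] obtain \<alpha> r where r: "strict_mono r" and lim: "(\<beta> \<circ> r) \<longlonglongrightarrow> \<alpha>"
    and \<alpha>1: "\<alpha> \<in> coeff_seqs 1"
    unfolding compact_eq_seq_compact_metric seq_compact_def by metis
  have limk: "(\<lambda>j. \<beta> (r j) k) \<longlonglongrightarrow> \<alpha> k" for k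
    using continuous_on_tendsto_compose[where f = "\<lambda>x. x k" and s = UNIV, OF _ lim] by (simp add: comp_def)
  have r_ge: "j \<le> r j" for j
    using r by (rule seq_suble)
  have "(\<Sum>k<p. (\<alpha> k)\<^sup>2) \<le> c" for p
  proof (rule LIMSEQ_le_const2)
    show "(\<lambda>j. \<Sum>k<p. (\<beta> (r j) k)\<^sup>2) \<longlonglongrightarrow> (\<Sum>k<p. (\<alpha> k)\<^sup>2)"
      by (intro tendsto_intros limk)
    show "\<exists>N. \<forall>j\<ge>N. (\<Sum>k<p. (\<beta> (r j) k)\<^sup>2) \<le> c"
      using \<beta>_lt r_ge order_trans by blast
  qed
  with \<alpha>1 have \<alpha>: "\<alpha> \<in> coeff_seqs c"
    by (simp add: coeff_seqs_def)
  have "(\<lambda>j. char (mu_discr (n (r j)) (\<theta> (r j))) t) \<longlonglongrightarrow> char (nu \<alpha>) t" for t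
  proof (rule LIMSEQ_char[where \<beta> = "\<lambda>j. \<beta> (r j)" and e = "\<lambda>m. 1 / real (Suc m)"])
    show "admissible \<alpha>"
      using coeff_seqs_imp_admissible[OF \<alpha> c] by simp
    show "(\<lambda>m. 1 / real (Suc m)) \<longlonglongrightarrow> 0"
      by (rule LIMSEQ_Suc[OF lim_1_over_n])
    fix m
    have "cmod (char (mu_discr (n (r j)) (\<theta> (r j))) t - of_real (gauss_cos m (\<beta> (r j)) t)) \<le> 1 / real (Suc m) * t ^ 4"
      if "m \<le> j" for j
      unfolding char_eq of_real_diff[symmetric] norm_of_real
    proof (rule gauss_cos_diff[OF _ \<beta>_le])
      show "m \<le> n (r j)"
        using that r_ge[of j] n[of "r j"] by linarith
      fix k assume "m \<le> k"
      show "(\<beta> (r j) k)\<^sup>2 \<le> 1 / real (Suc m)"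
        by (rule order_trans[OF decseq_sq_le[OF \<beta>(1,2) \<beta>_le]]) (use \<open>m \<le> k\<close> in \<open>simp add: frac_le\<close>)
    qed simp
    then show "\<forall>\<^sub>F j in sequentially. cmod (char (mu_discr (n (r j)) (\<theta> (r j))) t -
        of_real (gauss_cos m (\<beta> (r j)) t)) \<le> 1 / real (Suc m) * t ^ 4"
      by (auto simp: eventually_sequentially)
  qed (rule limk)
  moreover have "openin weak_topology (topspace weak_topology - C)"
    using C unfolding closedin_def by blast
  ultimately have "\<forall>\<^sub>F j in sequentially. mu_discr (n (r j)) (\<theta> (r j)) \<in> topspace weak_topology - C"
    by (intro eventually_weak_topology[OF real_distribution_mu_discr])
      (use \<alpha> disj in \<open>auto simp: real_distribution_nu\<close>)
  then show False
    using inC by (auto simp: eventually_sequentially)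
qed

text \<open>Again by contradiction along sequences, with \<open>\<epsilon> j = 1 / Suc j\<close> and
  threshold \<open>m = j\<close>. The vectors are not sorted here, so uniform smallness of the late
  coordinates has to come from the hypotheses.\<close>

lemma openin_weak_topology_neighbourhood:
  assumes \<alpha>: "admissible \<alpha>" and U: "openin weak_topology U" "nu \<alpha> \<in> U"
  obtains m \<epsilon> where "0 < \<epsilon>" "\<And>n \<theta>. m \<le> n \<Longrightarrow> (\<Sum>i<n. (\<theta> i)\<^sup>2) = 1 \<Longrightarrow>
    (\<And>k. k < m \<Longrightarrow> \<bar>\<theta> k - \<alpha> k\<bar> < \<epsilon>) \<Longrightarrow> (\<And>k. m \<le> k \<Longrightarrow> k < n \<Longrightarrow> \<bar>\<theta> k\<bar> < \<epsilon>) \<Longrightarrow> mu_discr n \<theta> \<in> U"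
proof (rule ccontr)
  define \<epsilon> where "\<epsilon> j = 1 / real (Suc j)" for j
  have \<epsilon>: "0 < \<epsilon> j" for j
    by (simp add: \<epsilon>_def)
  have \<epsilon>_lim: "\<epsilon> \<longlonglongrightarrow> 0"
    unfolding \<epsilon>_def by (rule LIMSEQ_Suc[OF lim_1_over_n])
  have \<epsilon>_mono: "\<epsilon> j \<le> \<epsilon> i" if "i \<le> j" for i j
    using that by (simp add: \<epsilon>_def frac_le)
  assume "\<not> thesis"
  then have "\<exists>n \<theta>. j \<le> n \<and> (\<Sum>i<n. (\<theta> i)\<^sup>2) = 1 \<and> (\<forall>k<j. \<bar>\<theta> k - \<alpha> k\<bar> < \<epsilon> j) \<and>
      (\<forall>k\<ge>j. k < n \<longrightarrow> \<bar>\<theta> k\<bar> < \<epsilon> j) \<and> mu_discr n \<theta> \<notin> U" for j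
    using that[of "\<epsilon> j" j] \<epsilon>[of j] by blast
  then obtain n \<theta> where n: "\<And>j. j \<le> n j" and unit: "\<And>j. (\<Sum>i<n j. (\<theta> j i)\<^sup>2) = 1"
    and near: "\<And>j k. k < j \<Longrightarrow> \<bar>\<theta> j k - \<alpha> k\<bar> < \<epsilon> j"
    and small: "\<And>j k. j \<le> k \<Longrightarrow> k < n j \<Longrightarrow> \<bar>\<theta> j k\<bar> < \<epsilon> j" and notin: "\<And>j. mu_discr (n j) (\<theta> j) \<notin> U"
    by metis
  from \<alpha> have s: "summable (\<lambda>k. (\<alpha> k)\<^sup>2)" and nonneg: "\<And>k. 0 \<le> \<alpha> k" and dec: "decseq \<alpha>"
    by (auto simp: admissible_def)
  have "(\<lambda>j. char (mu_discr (n j) (\<theta> j)) t) \<longlonglongrightarrow> char (nu \<alpha>) t" for t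
  \<comment> \<open>From index \<open>m\<close> on, every coordinate is at most
    \<open>\<alpha> m + \<epsilon> m\<close>: either it is close to a term of the decreasing
    sequence \<open>\<alpha>\<close> or it is small itself. The error is the bound
    \<open>2 * a\<^sup>2 + 2 * b\<^sup>2\<close> for the square of \<open>a + b\<close>.\<close>
  proof (rule LIMSEQ_char[OF \<alpha>, where \<beta> = \<theta> and e = "\<lambda>m. 2 * (\<alpha> m)\<^sup>2 + 2 * (\<epsilon> m)\<^sup>2"])
    show "(\<lambda>j. \<theta> j k) \<longlonglongrightarrow> \<alpha> k" for k
    proof (rule LIM_zero_cancel, rule Lim_null_comparison[OF _ \<epsilon>_lim])
      show "\<forall>\<^sub>F j in sequentially. norm (\<theta> j k - \<alpha> k) \<le> \<epsilon> j"
        using eventually_gt_at_top[of k] by eventually_elim (use near in \<open>auto intro: less_imp_le\<close>)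
    qed
    have "(\<lambda>m. 2 * (\<alpha> m)\<^sup>2 + 2 * (\<epsilon> m)\<^sup>2) \<longlonglongrightarrow> 2 * 0 + 2 * 0\<^sup>2"
      by (intro tendsto_intros summable_LIMSEQ_zero s \<epsilon>_lim)
    then show "(\<lambda>m. 2 * (\<alpha> m)\<^sup>2 + 2 * (\<epsilon> m)\<^sup>2) \<longlonglongrightarrow> 0"
      by simp
    fix m
    have "cmod (char (mu_discr (n j) (\<theta> j)) t - of_real (gauss_cos m (\<theta> j) t)) \<le> (2 * (\<alpha> m)\<^sup>2 + 2 * (\<epsilon> m)\<^sup>2) * t ^ 4"
      if "m \<le> j" for j
      unfolding char_mu_discr_eq_gauss_cos[OF unit] of_real_diff[symmetric] norm_of_real
    proof (rule gauss_cos_diff)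
      show "m \<le> n j"
        using that n[of j] by linarith
      show "(\<Sum>k<n j. (\<theta> j k)\<^sup>2) \<le> 1"
        by (simp add: unit)
      fix k assume k: "m \<le> k" "k < n j"
      have "\<bar>\<theta> j k\<bar> \<le> \<alpha> m + \<epsilon> m"
      proof (cases "k < j")
        case True
        have "\<alpha> k \<le> \<alpha> m"
          using dec k by (auto simp: decseq_def)
        then show ?thesis
          using near[OF True] \<epsilon>_mono[OF that] nonneg[of k] by linarith
      next
        case False
        then show ?thesis
          using small[of j k] k \<epsilon>_mono[OF that] nonneg[of m] by linarith
      qed
      then have "(\<theta> j k)\<^sup>2 \<le> (\<alpha> m + \<epsilon> m)\<^sup>2"
        by (metis abs_ge_zero power2_abs power_mono)
      also have "\<dots> \<le> 2 * (\<alpha> m)\<^sup>2 + 2 * (\<epsilon> m)\<^sup>2"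
        using sum_squares_bound[of "\<alpha> m" "\<epsilon> m"] by (simp add: power2_sum)
      finally show "(\<theta> j k)\<^sup>2 \<le> 2 * (\<alpha> m)\<^sup>2 + 2 * (\<epsilon> m)\<^sup>2" .
    qed simp
    then show "\<forall>\<^sub>F j in sequentially. cmod (char (mu_discr (n j) (\<theta> j)) t - of_real (gauss_cos m (\<theta> j) t)) \<le>
        (2 * (\<alpha> m)\<^sup>2 + 2 * (\<epsilon> m)\<^sup>2) * t ^ 4"
      by (auto simp: eventually_sequentially)
  qed
  then have "\<forall>\<^sub>F j in sequentially. mu_discr (n j) (\<theta> j) \<in> U"
    by (rule eventually_weak_topology[OF real_distribution_mu_discr _ U])
  then show False
    using notin by (auto simp: eventually_sequentially)
qed

section \<open>Volumes\<close>

abbreviation lborel_PiM :: "nat set \<Rightarrow> (nat \<Rightarrow> real) measure" where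
  "lborel_PiM I \<equiv> \<Pi>\<^sub>M i\<in>I. lborel"

interpretation lborel_prod: product_sigma_finite "\<lambda>_::nat. lborel :: real measure"
  by unfold_locales

definition ball_PiM :: "nat set \<Rightarrow> real \<Rightarrow> (nat \<Rightarrow> real) set" where
  "ball_PiM I r = {x \<in> I \<rightarrow>\<^sub>E UNIV. L2_set x I \<le> r}"

lemma measurable_PiM_component [measurable (raw)]:
  assumes "i \<in> I"
  shows "(\<lambda>x. x i) \<in> borel_measurable (lborel_PiM I)"
  using measurable_component_singleton[OF assms, of "\<lambda>_. lborel :: real measure"] by simp

lemma measurable_L2_set [measurable]:
  "J \<subseteq> I \<Longrightarrow> (\<lambda>x. L2_set x J) \<in> borel_measurable (lborel_PiM I)"
  unfolding L2_set_def by (measurable, auto)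

lemma sets_ball_PiM [measurable]: "ball_PiM I r \<in> sets (lborel_PiM I)"
proof -
  have "{x \<in> space (lborel_PiM I). L2_set x I \<le> r} \<in> sets (lborel_PiM I)"
    by measurable
  then show ?thesis
    by (simp add: ball_PiM_def space_PiM)
qed

lemma emeasure_ball_PiM:
  assumes "finite I" "0 < r"
  shows "emeasure (lborel_PiM I) (ball_PiM I r) = ennreal (unit_ball_vol (card I) * r ^ card I)"
proof -
  have "ball_PiM I r = {f. sqrt (\<Sum>i\<in>I. (f i)\<^sup>2) \<le> r} \<inter> space (lborel_PiM I)"
    by (auto simp: ball_PiM_def L2_set_def space_PiM)
  then show ?thesis
    using emeasure_cball_aux[OF assms] by simp
qed

text \<open>Fubini's theorem for two disjoint blocks of coordinates, with \<open>merge\<close> as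
  the identification. The volume estimates place sets inside such products or such products inside
  sets.\<close>

lemma emeasure_PiM_split:
  assumes IJ: "finite I" "finite J" "I \<inter> J = {}"
    and A: "A \<in> sets (lborel_PiM I)" and B: "B \<in> sets (lborel_PiM J)"
  shows "{x \<in> (I \<union> J) \<rightarrow>\<^sub>E UNIV. restrict x I \<in> A \<and> restrict x J \<in> B} \<in> sets (lborel_PiM (I \<union> J))" (is "?X \<in> _")
    and "emeasure (lborel_PiM (I \<union> J)) {x \<in> (I \<union> J) \<rightarrow>\<^sub>E UNIV. restrict x I \<in> A \<and> restrict x J \<in> B} =
      emeasure (lborel_PiM I) A * emeasure (lborel_PiM J) B"
proof -
  have [measurable]: "(\<lambda>x. restrict x I) \<in> lborel_PiM (I \<union> J) \<rightarrow>\<^sub>M lborel_PiM I"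
    "(\<lambda>x. restrict x J) \<in> lborel_PiM (I \<union> J) \<rightarrow>\<^sub>M lborel_PiM J"
    by (auto intro: measurable_restrict_subset)
  have "{x \<in> space (lborel_PiM (I \<union> J)). restrict x I \<in> A \<and> restrict x J \<in> B} \<in> sets (lborel_PiM (I \<union> J))"
    using A B by measurable
  then show X: "?X \<in> sets (lborel_PiM (I \<union> J))"
    by (simp add: space_PiM)
  interpret J: sigma_finite_measure "lborel_PiM J"
    by (rule lborel_prod.sigma_finite) fact
  have "emeasure (lborel_PiM (I \<union> J)) ?X =
      emeasure (distr (lborel_PiM I \<Otimes>\<^sub>M lborel_PiM J) (lborel_PiM (I \<union> J)) (merge I J)) ?X"
    by (simp add: lborel_prod.distr_merge[OF IJ(3,1,2)])
  also have "\<dots> = emeasure (lborel_PiM I \<Otimes>\<^sub>M lborel_PiM J)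
      (merge I J -` ?X \<inter> space (lborel_PiM I \<Otimes>\<^sub>M lborel_PiM J))"
    by (rule emeasure_distr[OF measurable_merge X])
  also have "merge I J -` ?X \<inter> space (lborel_PiM I \<Otimes>\<^sub>M lborel_PiM J) = A \<times> B"
    using sets.sets_into_space[OF A] sets.sets_into_space[OF B] IJ(3)
    by (auto simp: space_pair_measure space_PiM PiE_def) (metis extensional_restrict subsetD)+
  also have "emeasure (lborel_PiM I \<Otimes>\<^sub>M lborel_PiM J) (A \<times> B) = emeasure (lborel_PiM I) A * emeasure (lborel_PiM J) B"
    by (rule J.emeasure_pair_measure_Times[OF A B])
  finally show "emeasure (lborel_PiM (I \<union> J)) ?X = emeasure (lborel_PiM I) A * emeasure (lborel_PiM J) B" .
qed

section \<open>Comparing volumes of unit balls in different dimensions\<close>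

lemma L2_set_sq: "(L2_set x I)\<^sup>2 = (\<Sum>i\<in>I. (x i)\<^sup>2)"
  by (simp add: L2_set_def sum_nonneg)

lemma L2_set_le_iff: "0 \<le> r \<Longrightarrow> L2_set x I \<le> r \<longleftrightarrow> (\<Sum>i\<in>I. (x i)\<^sup>2) \<le> r\<^sup>2"
  using abs_le_square_iff[of "L2_set x I" r] by (simp add: L2_set_sq)

abbreviation vol :: "nat \<Rightarrow> real" where
  "vol k \<equiv> unit_ball_vol (real k)"

lemma vol_pos: "0 < vol k"
  by simp

text \<open>The unit ball lies in the product of the unit balls of two coordinate blocks.\<close>

lemma vol_le_mult: "vol (k + l) \<le> vol k * vol l"
proof -
  let ?I = "{..<k}" and ?J = "{k..<k+l}"
  have IJ: "finite ?I" "finite ?J" "?I \<inter> ?J = {}" "?I \<union> ?J = {..<k+l}"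
    by auto
  note split = emeasure_PiM_split[OF IJ(1-3) sets_ball_PiM sets_ball_PiM, unfolded IJ(4)]
  have "ennreal (vol (k + l)) = emeasure (lborel_PiM {..<k+l}) (ball_PiM {..<k+l} 1)"
    by (subst emeasure_ball_PiM) auto
  also have "\<dots> \<le> emeasure (lborel_PiM {..<k+l})
      {x \<in> {..<k+l} \<rightarrow>\<^sub>E UNIV. restrict x ?I \<in> ball_PiM ?I 1 \<and> restrict x ?J \<in> ball_PiM ?J 1}"
  proof (rule emeasure_mono[OF _ split(1)], rule subsetI)
    fix x assume "x \<in> ball_PiM {..<k+l} 1"
    then have x: "x \<in> {..<k+l} \<rightarrow>\<^sub>E UNIV" "(\<Sum>i<k+l. (x i)\<^sup>2) \<le> 1"
      by (auto simp: ball_PiM_def L2_set_le_iff)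
    have "(\<Sum>i\<in>?I. (x i)\<^sup>2) \<le> (\<Sum>i<k+l. (x i)\<^sup>2)" "(\<Sum>i\<in>?J. (x i)\<^sup>2) \<le> (\<Sum>i<k+l. (x i)\<^sup>2)"
      by (auto intro!: sum_mono2)
    with x show "x \<in> {x \<in> {..<k+l} \<rightarrow>\<^sub>E UNIV. restrict x ?I \<in> ball_PiM ?I 1 \<and> restrict x ?J \<in> ball_PiM ?J 1}"
      by (auto simp: ball_PiM_def L2_set_le_iff)
  qed
  also have "\<dots> = ennreal (vol k * vol l)"
    by (subst split(2)) (simp add: emeasure_ball_PiM ennreal_mult')
  finally show ?thesis
    by (subst (asm) ennreal_le_iff) auto
qed

text \<open>A product of balls with radii \<open>r\<close> and \<open>q\<close> fits into the unit
  ball by Pythagoras.\<close>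

lemma vol_mult_le:
  assumes "0 < r" "0 < q" "r\<^sup>2 + q\<^sup>2 \<le> 1"
  shows "vol k * r ^ k * (vol l * q ^ l) \<le> vol (k + l)"
proof -
  let ?I = "{..<k}" and ?J = "{k..<k+l}"
  have IJ: "finite ?I" "finite ?J" "?I \<inter> ?J = {}" "?I \<union> ?J = {..<k+l}"
    by auto
  note split = emeasure_PiM_split[OF IJ(1-3) sets_ball_PiM sets_ball_PiM, unfolded IJ(4)]
  have "ennreal (vol k * r ^ k * (vol l * q ^ l)) = emeasure (lborel_PiM {..<k+l})
      {x \<in> {..<k+l} \<rightarrow>\<^sub>E UNIV. restrict x ?I \<in> ball_PiM ?I r \<and> restrict x ?J \<in> ball_PiM ?J q}"
    using assms by (subst split(2)) (simp add: emeasure_ball_PiM ennreal_mult'[symmetric])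
  also have "\<dots> \<le> emeasure (lborel_PiM {..<k+l}) (ball_PiM {..<k+l} 1)"
  proof (rule emeasure_mono[OF _ sets_ball_PiM], rule subsetI)
    fix x assume "x \<in> {x \<in> {..<k+l} \<rightarrow>\<^sub>E UNIV. restrict x ?I \<in> ball_PiM ?I r \<and> restrict x ?J \<in> ball_PiM ?J q}"
    then have x: "x \<in> {..<k+l} \<rightarrow>\<^sub>E UNIV" "(\<Sum>i\<in>?I. (x i)\<^sup>2) \<le> r\<^sup>2" "(\<Sum>i\<in>?J. (x i)\<^sup>2) \<le> q\<^sup>2"
      using assms by (auto simp: ball_PiM_def L2_set_le_iff)
    have "(\<Sum>i<k+l. (x i)\<^sup>2) = (\<Sum>i\<in>?I. (x i)\<^sup>2) + (\<Sum>i\<in>?J. (x i)\<^sup>2)"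
      unfolding IJ(4)[symmetric] by (rule sum.union_disjoint) auto
    with x assms show "x \<in> ball_PiM {..<k+l} 1"
      by (auto simp: ball_PiM_def L2_set_le_iff)
  qed
  also have "\<dots> = ennreal (vol (k + l))"
    by (subst emeasure_ball_PiM) auto
  finally show ?thesis
    by (subst (asm) ennreal_le_iff) auto
qed

lemma vol_ratio_le:
  assumes "1 \<le> n" "m \<le> n"
  shows "vol m * vol (n - m) \<le> 2 * (2 * real n) ^ m * vol n"
proof -
  \<comment> \<open>The radii satisfy \<open>?r\<^sup>2 + ?q\<^sup>2 = 1\<close>. The large block
    shrinks so little that Bernoulli's inequality keeps at least half of its volume, and the small
    block loses only a power of \<open>n\<close>.\<close>
  let ?r = "1 / sqrt (2 * real n)" and ?q = "sqrt (1 - 1 / (2 * real n))"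
  have q: "0 < ?q" "?q \<le> 1"
    using assms by auto
  have "vol m * ?r ^ m * (vol (n - m) * ?q ^ (n - m)) \<le> vol (m + (n - m))"
    using assms by (intro vol_mult_le) (auto simp: power_divide)
  then have le: "vol m * ?r ^ m * (vol (n - m) * ?q ^ (n - m)) \<le> vol n"
    using assms by simp
  have "1 / 2 \<le> (1 - 1 / (2 * real n)) ^ n"
    using Bernoulli_inequality[of "- 1 / (2 * real n)" n] assms by simp
  then have "sqrt ((1 / 2)\<^sup>2) \<le> sqrt ((1 - 1 / (2 * real n)) ^ n)"
    by (intro real_sqrt_le_mono) (simp add: power2_eq_square)
  also have "\<dots> = ?q ^ n"
    by (rule real_sqrt_power)
  also have "\<dots> \<le> ?q ^ (n - m)"
    using q by (intro power_decreasing) auto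
  finally have 1: "1 / 2 \<le> ?q ^ (n - m)"
    by simp
  have "2 * real n \<le> (2 * real n)\<^sup>2"
    using assms by (simp add: power2_eq_square)
  then have "sqrt (2 * real n) \<le> 2 * real n"
    by (intro real_le_lsqrt) auto
  then have "sqrt (2 * real n) ^ m \<le> (2 * real n) ^ m"
    by (intro power_mono) auto
  then have 2: "1 / (2 * real n) ^ m \<le> ?r ^ m"
    using assms by (simp add: power_divide frac_le)
  have "vol m * (1 / (2 * real n) ^ m) * (vol (n - m) * (1 / 2)) \<le> vol m * ?r ^ m * (vol (n - m) * ?q ^ (n - m))"
    using assms by (intro mult_mono mult_left_mono 1 2) auto
  also note le
  finally show ?thesis
    using assms by (simp add: field_simps)
qed

section \<open>The uniform distribution on the sphere\<close>

text \<open>The radial projection in \<open>uniform_sphere\<close>. At the origin division by zero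
  yields the zero vector, which is not on the sphere.\<close>

definition normalise :: "nat \<Rightarrow> (nat \<Rightarrow> real) \<Rightarrow> nat \<Rightarrow> real" where
  "normalise n x = (\<lambda>i\<in>{..<n}. x i / L2_set x {..<n})"

lemma measurable_normalise [measurable]:
  "normalise n \<in> lborel_PiM {..<n} \<rightarrow>\<^sub>M (\<Pi>\<^sub>M i\<in>{..<n}. borel)"
  unfolding normalise_def by (rule measurable_restrict) measurable

lemma sum_normalise_sq:
  assumes "S \<subseteq> {..<n}"
  shows "(\<Sum>i\<in>S. (normalise n x i)\<^sup>2) = (\<Sum>i\<in>S. (x i)\<^sup>2) / (\<Sum>i<n. (x i)\<^sup>2)"
proof -
  have "(\<Sum>i\<in>S. (normalise n x i)\<^sup>2) = (\<Sum>i\<in>S. (x i)\<^sup>2 / (\<Sum>i<n. (x i)\<^sup>2))"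
    using assms by (intro sum.cong) (auto simp: normalise_def power_divide L2_set_sq)
  then show ?thesis
    by (simp add: sum_divide_distrib)
qed

lemma measure_uniform_sphere:
  assumes "1 \<le> n" and A [measurable]: "A \<in> sets (\<Pi>\<^sub>M i\<in>{..<n}. borel)"
  shows "measure (uniform_sphere n) A =
    measure (lborel_PiM {..<n}) {x \<in> ball_PiM {..<n} 1. normalise n x \<in> A} / vol n"
proof -
  let ?B = "ball_PiM {..<n} 1" and ?M = "lborel_PiM {..<n}"
  have B: "emeasure ?M ?B = ennreal (vol n)"
    by (subst emeasure_ball_PiM) auto
  have "measure (uniform_sphere n) A = measure (uniform_measure ?M ?B) (normalise n -` A \<inter> space ?M)"
    unfolding uniform_sphere_def normalise_def[symmetric] ball_PiM_def[symmetric]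
    by (subst measure_distr) auto
  also have "\<dots> = measure ?M (?B \<inter> (normalise n -` A \<inter> space ?M)) / measure ?M ?B"
    using vol_pos[of n]
    by (intro measure_uniform_measure) (auto simp: B measurable_sets[OF measurable_normalise A] simp del: unit_ball_vol_pos)
  also have "?B \<inter> (normalise n -` A \<inter> space ?M) = {x \<in> ?B. normalise n x \<in> A}"
    by (auto simp: ball_PiM_def space_PiM)
  also have "measure ?M ?B = vol n"
    by (simp add: measure_def B)
  finally show ?thesis .
qed

lemma sets_normalise_ball:
  assumes "A \<in> sets (\<Pi>\<^sub>M i\<in>{..<n}. borel)"
  shows "{x \<in> ball_PiM {..<n} 1. normalise n x \<in> A} \<in> sets (lborel_PiM {..<n})"
proof -
  have "ball_PiM {..<n} 1 \<inter> (normalise n -` A \<inter> space (lborel_PiM {..<n})) \<in> sets (lborel_PiM {..<n})"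
    using measurable_sets[OF measurable_normalise assms] by auto
  moreover have "ball_PiM {..<n} 1 \<inter> (normalise n -` A \<inter> space (lborel_PiM {..<n})) =
      {x \<in> ball_PiM {..<n} 1. normalise n x \<in> A}"
    by (auto simp: ball_PiM_def space_PiM)
  ultimately show ?thesis by simp
qed

text \<open>A union bound over the positions \<open>S\<close>: the coordinates in \<open>S\<close>
  stay in a unit ball, the others in a ball of radius \<open>q\<close>. Both the number of positions
  and the ratio of volumes cost at most a factor \<open>(2 * real n) ^ m\<close>, hence the exponent
  \<open>2 * m\<close>.\<close>

lemma uniform_sphere_upper:
  assumes n: "1 \<le> n" "m \<le> n" and q: "0 < q" "q \<le> 1"
    and A: "A \<in> sets (\<Pi>\<^sub>M i\<in>{..<n}. borel)"
    and conc: "\<And>\<theta>. \<theta> \<in> A \<Longrightarrow> (\<Sum>i<n. (\<theta> i)\<^sup>2) = 1 \<Longrightarrow>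
      \<exists>S\<subseteq>{..<n}. card S = m \<and> 1 - q\<^sup>2 \<le> (\<Sum>i\<in>S. (\<theta> i)\<^sup>2)"
  shows "measure (uniform_sphere n) A \<le> 2 * (2 * real n) ^ (2 * m) * q ^ (n - m)"
proof -
  let ?M = "lborel_PiM {..<n}"
  define F where "F = {S. S \<subseteq> {..<n} \<and> card S = m}"
  define X where "X S = {x \<in> {..<n} \<rightarrow>\<^sub>E UNIV. restrict x S \<in> ball_PiM S 1 \<and>
      restrict x ({..<n} - S) \<in> ball_PiM ({..<n} - S) q}" for S
  have F: "finite F" "card F = n choose m"
    unfolding F_def using n_subsets[of "{..<n}" m] by auto
  have X: "X S \<in> sets ?M" "emeasure ?M (X S) = ennreal (vol m * (vol (n - m) * q ^ (n - m)))" if "S \<in> F" for S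
  proof -
    have S: "finite S" "finite ({..<n} - S)" "S \<inter> ({..<n} - S) = {}" "S \<union> ({..<n} - S) = {..<n}"
      and card: "card S = m" "card ({..<n} - S) = n - m"
      using that by (auto simp: F_def finite_subset[of S "{..<n}"] card_Diff_subset)
    note split = emeasure_PiM_split[OF S(1-3) sets_ball_PiM sets_ball_PiM, of 1 q, unfolded S(4), folded X_def]
    show "X S \<in> sets ?M"
      by (rule split(1))
    show "emeasure ?M (X S) = ennreal (vol m * (vol (n - m) * q ^ (n - m)))"
      using q by (subst split(2)) (simp add: emeasure_ball_PiM S card ennreal_mult'[symmetric])
  qed
  have sub: "{x \<in> ball_PiM {..<n} 1. normalise n x \<in> A} \<subseteq> (\<Union>S\<in>F. X S)"
  proof
    fix x assume "x \<in> {x \<in> ball_PiM {..<n} 1. normalise n x \<in> A}"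
    then have x: "x \<in> {..<n} \<rightarrow>\<^sub>E UNIV" "(\<Sum>i<n. (x i)\<^sup>2) \<le> 1" and xA: "normalise n x \<in> A"
      by (auto simp: ball_PiM_def L2_set_le_iff)
    define R where "R = (\<Sum>i<n. (x i)\<^sup>2)"
    have R: "0 \<le> R" "R \<le> 1"
      using x(2) by (auto simp: R_def sum_nonneg)
    have "\<exists>S\<in>F. (1 - q\<^sup>2) * R \<le> (\<Sum>i\<in>S. (x i)\<^sup>2)"
    proof (cases "R = 0")
      \<comment> \<open>The origin does not project to the sphere, so \<open>conc\<close> says
        nothing about it; any set of size \<open>m\<close> serves.\<close>
      case True
      have "{..<m} \<in> F"
        using n by (auto simp: F_def)
      then show ?thesis
        using True by (intro bexI[of _ "{..<m}"]) (auto simp: sum_nonneg)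
    next
      case False
      then have "(\<Sum>i<n. (normalise n x i)\<^sup>2) = 1"
        by (simp add: sum_normalise_sq R_def)
      from conc[OF xA this] obtain S where S: "S \<subseteq> {..<n}" "card S = m" "1 - q\<^sup>2 \<le> (\<Sum>i\<in>S. (normalise n x i)\<^sup>2)"
        by blast
      then have "1 - q\<^sup>2 \<le> (\<Sum>i\<in>S. (x i)\<^sup>2) / R"
        by (simp add: sum_normalise_sq R_def)
      then show ?thesis
        using False R S by (intro bexI[of _ S]) (auto simp: F_def field_simps)
    qed
    then obtain S where S: "S \<in> F" "(1 - q\<^sup>2) * R \<le> (\<Sum>i\<in>S. (x i)\<^sup>2)"
      by blast
    have SI: "S \<subseteq> {..<n}"
      using S by (auto simp: F_def)
    have eq: "R = (\<Sum>i\<in>{..<n} - S. (x i)\<^sup>2) + (\<Sum>i\<in>S. (x i)\<^sup>2)"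
      unfolding R_def by (rule sum.subset_diff[OF SI]) simp
    have "(\<Sum>i\<in>{..<n} - S. (x i)\<^sup>2) \<le> q\<^sup>2 * R"
      using S(2) eq by (simp add: algebra_simps)
    also have "\<dots> \<le> q\<^sup>2"
      using R by (simp add: mult_left_le)
    finally have "(\<Sum>i\<in>{..<n} - S. (x i)\<^sup>2) \<le> q\<^sup>2" .
    moreover have "(\<Sum>i\<in>S. (x i)\<^sup>2) \<le> 1"
      using eq R sum_nonneg[of "{..<n} - S" "\<lambda>i. (x i)\<^sup>2"] by simp
    ultimately have "x \<in> X S"
      using x(1) q by (simp add: X_def ball_PiM_def L2_set_le_iff)
    with S(1) show "x \<in> (\<Union>S\<in>F. X S)"
      by blast
  qed
  have "emeasure ?M {x \<in> ball_PiM {..<n} 1. normalise n x \<in> A} \<le> emeasure ?M (\<Union>S\<in>F. X S)"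
    by (rule emeasure_mono[OF sub]) (use X F in auto)
  also have "\<dots> \<le> (\<Sum>S\<in>F. emeasure ?M (X S))"
    by (rule emeasure_subadditive_finite) (use X F in auto)
  also have "\<dots> = ennreal (real (n choose m) * (vol m * (vol (n - m) * q ^ (n - m))))"
    using q by (simp add: X F ennreal_mult' ennreal_of_nat_eq_real_of_nat)
  finally have "measure ?M {x \<in> ball_PiM {..<n} 1. normalise n x \<in> A} \<le>
      real (n choose m) * (vol m * (vol (n - m) * q ^ (n - m)))"
    using q unfolding measure_def by (intro enn2real_leI) auto
  also have "\<dots> \<le> (2 * real n) ^ m * ((2 * (2 * real n) ^ m * vol n) * q ^ (n - m))"
    unfolding mult.assoc[of "vol m", symmetric]
  proof (rule mult_mono[OF _ mult_right_mono[OF vol_ratio_le[OF n]]])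
    have "real (n choose m) \<le> real (n ^ m)"
      using binomial_le_pow[OF n(2)] by (simp only: of_nat_le_iff)
    also have "\<dots> \<le> (2 * real n) ^ m"
      unfolding of_nat_power by (intro power_mono) auto
    finally show "real (n choose m) \<le> (2 * real n) ^ m" .
  qed (use q in auto)
  also have "\<dots> = 2 * (2 * real n) ^ (2 * m) * q ^ (n - m) * vol n"
    unfolding mult_2[of m] power_add by (simp only: mult_ac)
  finally have "measure ?M {x \<in> ball_PiM {..<n} 1. normalise n x \<in> A} / vol n \<le>
      2 * (2 * real n) ^ (2 * m) * q ^ (n - m)"
    by (subst pos_divide_le_eq[OF vol_pos])
  then show ?thesis
    by (simp add: measure_uniform_sphere[OF n(1) A])
qed

text \<open>A coordinate above \<open>\<eta>\<close> forces the others into the radius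
  \<open>sqrt (\<rho>\<^sup>2 - \<eta>\<^sup>2)\<close>, exponentially less volume than radius
  \<open>\<rho>\<close>. The factor \<open>4 * real N\<close> is \<open>vol_ratio_le\<close> with
  \<open>m = 1\<close>.\<close>

lemma measure_ball_large_coordinate:
  assumes J: "finite J" "k \<in> J" "card J = N" and \<eta>: "0 < \<eta>" "\<eta> < \<rho>"
  shows "emeasure (lborel_PiM J) {y \<in> ball_PiM J \<rho>. \<eta> < \<bar>y k\<bar>} \<le>
    ennreal (4 * real N * vol N * \<rho> * sqrt (\<rho>\<^sup>2 - \<eta>\<^sup>2) ^ (N - 1))"
proof -
  let ?\<kappa> = "sqrt (\<rho>\<^sup>2 - \<eta>\<^sup>2)"
  have "\<eta>\<^sup>2 < \<rho>\<^sup>2"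
    using \<eta> by (intro power_strict_mono) auto
  then have \<kappa>: "0 < ?\<kappa>" "?\<kappa>\<^sup>2 = \<rho>\<^sup>2 - \<eta>\<^sup>2"
    by auto
  have I: "finite {k}" "finite (J - {k})" "{k} \<inter> (J - {k}) = {}" "{k} \<union> (J - {k}) = J"
    and N: "1 \<le> N" "card (J - {k}) = N - 1"
    using J by (auto simp: Suc_le_eq card_gt_0_iff)
  note split = emeasure_PiM_split[OF I(1-3) sets_ball_PiM sets_ball_PiM, of \<rho> ?\<kappa>, unfolded I(4)]
  have "emeasure (lborel_PiM J) {y \<in> ball_PiM J \<rho>. \<eta> < \<bar>y k\<bar>} \<le> emeasure (lborel_PiM J)
      {x \<in> J \<rightarrow>\<^sub>E UNIV. restrict x {k} \<in> ball_PiM {k} \<rho> \<and> restrict x (J - {k}) \<in> ball_PiM (J - {k}) ?\<kappa>}"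
  proof (rule emeasure_mono[OF _ split(1)], rule subsetI)
    fix x assume "x \<in> {y \<in> ball_PiM J \<rho>. \<eta> < \<bar>y k\<bar>}"
    then have x: "x \<in> J \<rightarrow>\<^sub>E UNIV" "(\<Sum>i\<in>J. (x i)\<^sup>2) \<le> \<rho>\<^sup>2" "\<eta> < \<bar>x k\<bar>"
      using \<eta> by (auto simp: ball_PiM_def L2_set_le_iff)
    have eq: "(\<Sum>i\<in>J. (x i)\<^sup>2) = (x k)\<^sup>2 + (\<Sum>i\<in>J - {k}. (x i)\<^sup>2)"
      using J by (simp add: sum.remove)
    have "\<eta>\<^sup>2 \<le> \<bar>x k\<bar>\<^sup>2"
      using x(3) \<eta> by (intro power_mono) auto
    then have "(\<Sum>i\<in>J - {k}. (x i)\<^sup>2) \<le> ?\<kappa>\<^sup>2"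
      using x(2) eq \<kappa>(2) by simp
    moreover have "(x k)\<^sup>2 \<le> \<rho>\<^sup>2"
      using x(2) eq sum_nonneg[of "J - {k}" "\<lambda>i. (x i)\<^sup>2"] by simp
    then have "\<bar>x k\<bar> \<le> \<rho>"
      using abs_le_square_iff[of "x k" \<rho>] \<eta> by simp
    ultimately show "x \<in> {x \<in> J \<rightarrow>\<^sub>E UNIV. restrict x {k} \<in> ball_PiM {k} \<rho> \<and> restrict x (J - {k}) \<in> ball_PiM (J - {k}) ?\<kappa>}"
      using x(1) \<kappa>(1) \<eta> by (simp add: ball_PiM_def L2_set_le_iff)
  qed
  also have "\<dots> = ennreal (vol 1 * \<rho> * (vol (N - 1) * ?\<kappa> ^ (N - 1)))"
    using \<kappa>(1) \<eta> J N by (subst split(2)) (simp add: emeasure_ball_PiM ennreal_mult'[symmetric])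
  also have "vol 1 * \<rho> * (vol (N - 1) * ?\<kappa> ^ (N - 1)) = (vol 1 * vol (N - 1)) * (\<rho> * ?\<kappa> ^ (N - 1))"
    by simp
  also have "ennreal \<dots> \<le> ennreal ((2 * (2 * real N) ^ 1 * vol N) * (\<rho> * ?\<kappa> ^ (N - 1)))"
    using N \<kappa>(1) \<eta> by (intro ennreal_leI mult_right_mono vol_ratio_le) auto
  finally show ?thesis
    by (simp add: mult_ac)
qed

definition flat_shell :: "nat set \<Rightarrow> real \<Rightarrow> real \<Rightarrow> (nat \<Rightarrow> real) set" where
  "flat_shell J \<eta> \<rho> = {y \<in> ball_PiM J \<rho>. (1 - \<eta>) * \<rho> < L2_set y J \<and> (\<forall>k\<in>J. \<bar>y k\<bar> \<le> \<eta>)}"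

text \<open>What is missing from the ball is a smaller concentric ball and one set with a large
  coordinate for each of the \<open>N\<close> indices. The additive form avoids subtraction in
  \<open>ennreal\<close>.\<close>

lemma measure_flat_shell:
  assumes J: "finite J" "card J = N" and \<eta>: "0 < \<eta>" "\<eta> < 1" "\<eta> < \<rho>"
  shows "flat_shell J \<eta> \<rho> \<in> sets (lborel_PiM J)"
    and "ennreal (vol N * \<rho> ^ N) \<le> emeasure (lborel_PiM J) (flat_shell J \<eta> \<rho>) +
      ennreal (vol N * ((1 - \<eta>) * \<rho>) ^ N + 4 * (real N)\<^sup>2 * vol N * \<rho> * sqrt (\<rho>\<^sup>2 - \<eta>\<^sup>2) ^ (N - 1))"
proof -
  let ?M = "lborel_PiM J"
  define L where "L k = {y \<in> ball_PiM J \<rho>. \<eta> < \<bar>y k\<bar>}" for k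
  have L: "L k \<in> sets ?M" if "k \<in> J" for k
  proof -
    have "ball_PiM J \<rho> \<inter> {y \<in> space ?M. \<eta> < \<bar>y k\<bar>} \<in> sets ?M"
      using that by measurable
    also have "ball_PiM J \<rho> \<inter> {y \<in> space ?M. \<eta> < \<bar>y k\<bar>} = L k"
      by (auto simp: L_def ball_PiM_def space_PiM)
    finally show ?thesis .
  qed
  have eq: "flat_shell J \<eta> \<rho> = ball_PiM J \<rho> - (ball_PiM J ((1 - \<eta>) * \<rho>) \<union> (\<Union>k\<in>J. L k))"
    by (auto simp: flat_shell_def L_def ball_PiM_def not_le not_less)
  have LU: "(\<Union>k\<in>J. L k) \<in> sets ?M"
    using J L by auto
  then show sets: "flat_shell J \<eta> \<rho> \<in> sets ?M"
    unfolding eq by auto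
  have "emeasure ?M (\<Union>k\<in>J. L k) \<le> (\<Sum>k\<in>J. emeasure ?M (L k))"
    by (rule emeasure_subadditive_finite) (use L J in auto)
  also have "\<dots> \<le> (\<Sum>k\<in>J. ennreal (4 * real N * vol N * \<rho> * sqrt (\<rho>\<^sup>2 - \<eta>\<^sup>2) ^ (N - 1)))"
    unfolding L_def by (intro sum_mono measure_ball_large_coordinate) (use J \<eta> in auto)
  also have "\<dots> = ennreal (real N * (4 * real N * vol N * \<rho> * sqrt (\<rho>\<^sup>2 - \<eta>\<^sup>2) ^ (N - 1)))"
    using J by (subst ennreal_mult') (simp_all add: ennreal_of_nat_eq_real_of_nat)
  also have "real N * (4 * real N * vol N * \<rho> * sqrt (\<rho>\<^sup>2 - \<eta>\<^sup>2) ^ (N - 1)) =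
      4 * (real N)\<^sup>2 * vol N * \<rho> * sqrt (\<rho>\<^sup>2 - \<eta>\<^sup>2) ^ (N - 1)"
    by (simp add: power2_eq_square mult_ac)
  finally have large: "emeasure ?M (\<Union>k\<in>J. L k) \<le>
      ennreal (4 * (real N)\<^sup>2 * vol N * \<rho> * sqrt (\<rho>\<^sup>2 - \<eta>\<^sup>2) ^ (N - 1))" .
  have small: "emeasure ?M (ball_PiM J ((1 - \<eta>) * \<rho>)) = ennreal (vol N * ((1 - \<eta>) * \<rho>) ^ N)"
    using \<eta> J by (subst emeasure_ball_PiM) auto
  have "\<eta>\<^sup>2 \<le> \<rho>\<^sup>2"
    using \<eta> by (intro power_mono) auto
  then have nonneg: "0 \<le> vol N * ((1 - \<eta>) * \<rho>) ^ N"
      "0 \<le> 4 * (real N)\<^sup>2 * vol N * \<rho> * sqrt (\<rho>\<^sup>2 - \<eta>\<^sup>2) ^ (N - 1)"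
    using \<eta> by auto
  have "emeasure ?M (ball_PiM J ((1 - \<eta>) * \<rho>) \<union> (\<Union>k\<in>J. L k)) \<le>
      emeasure ?M (ball_PiM J ((1 - \<eta>) * \<rho>)) + emeasure ?M (\<Union>k\<in>J. L k)"
    by (rule emeasure_subadditive) (use LU in auto)
  also have "\<dots> \<le> ennreal (vol N * ((1 - \<eta>) * \<rho>) ^ N) +
      ennreal (4 * (real N)\<^sup>2 * vol N * \<rho> * sqrt (\<rho>\<^sup>2 - \<eta>\<^sup>2) ^ (N - 1))"
    by (intro add_mono large eq_refl[OF small])
  also have "\<dots> = ennreal (vol N * ((1 - \<eta>) * \<rho>) ^ N + 4 * (real N)\<^sup>2 * vol N * \<rho> * sqrt (\<rho>\<^sup>2 - \<eta>\<^sup>2) ^ (N - 1))"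
    by (rule ennreal_plus[OF nonneg, symmetric])
  finally have rest: "emeasure ?M (ball_PiM J ((1 - \<eta>) * \<rho>) \<union> (\<Union>k\<in>J. L k)) \<le>
      ennreal (vol N * ((1 - \<eta>) * \<rho>) ^ N + 4 * (real N)\<^sup>2 * vol N * \<rho> * sqrt (\<rho>\<^sup>2 - \<eta>\<^sup>2) ^ (N - 1))" .
  have "ennreal (vol N * \<rho> ^ N) = emeasure ?M (ball_PiM J \<rho>)"
    using \<eta> J by (simp add: emeasure_ball_PiM)
  also have "\<dots> \<le> emeasure ?M (flat_shell J \<eta> \<rho> \<union> (ball_PiM J ((1 - \<eta>) * \<rho>) \<union> (\<Union>k\<in>J. L k)))"
    by (rule emeasure_mono) (use sets LU in \<open>auto simp: eq\<close>)
  also have "\<dots> \<le> emeasure ?M (flat_shell J \<eta> \<rho>) + emeasure ?M (ball_PiM J ((1 - \<eta>) * \<rho>) \<union> (\<Union>k\<in>J. L k))"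
    by (rule emeasure_subadditive) (use sets LU in auto)
  also have "\<dots> \<le> emeasure ?M (flat_shell J \<eta> \<rho>) +
      ennreal (vol N * ((1 - \<eta>) * \<rho>) ^ N + 4 * (real N)\<^sup>2 * vol N * \<rho> * sqrt (\<rho>\<^sup>2 - \<eta>\<^sup>2) ^ (N - 1))"
    by (intro add_left_mono rest)
  finally show "ennreal (vol N * \<rho> ^ N) \<le> emeasure (lborel_PiM J) (flat_shell J \<eta> \<rho>) +
      ennreal (vol N * ((1 - \<eta>) * \<rho>) ^ N + 4 * (real N)\<^sup>2 * vol N * \<rho> * sqrt (\<rho>\<^sup>2 - \<eta>\<^sup>2) ^ (N - 1))" .
qed

text \<open>The targets are shrunk by \<open>1 - \<eta>\<close> so that the deviations in the box do
  not push the point out of the unit ball. The radius stays close to 1, so normalising moves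
  coordinates by a multiple of \<open>\<eta>\<close> only.\<close>

lemma normalise_near:
  assumes \<eta>: "0 < \<eta>" "\<eta> \<le> 1 / 10" and n: "m \<le> n"
    and \<alpha>: "\<And>k. 0 \<le> \<alpha> k" and s: "(\<Sum>k<m. (\<alpha> k)\<^sup>2) = s" "s < 1" and \<rho>: "\<rho> = (1 - \<eta>) * sqrt (1 - s)"
    and box: "\<And>k. k < m \<Longrightarrow> \<bar>x k - (1 - \<eta>) * \<alpha> k\<bar> \<le> \<eta> / (3 * real m + 3)"
    and shell: "((1 - \<eta>) * \<rho>)\<^sup>2 \<le> (\<Sum>k\<in>{m..<n}. (x k)\<^sup>2)" "(\<Sum>k\<in>{m..<n}. (x k)\<^sup>2) \<le> \<rho>\<^sup>2"
    and flat: "\<And>k. m \<le> k \<Longrightarrow> k < n \<Longrightarrow> \<bar>x k\<bar> \<le> \<eta>"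
  shows "0 < (\<Sum>k<n. (x k)\<^sup>2)" "(\<Sum>k<n. (x k)\<^sup>2) \<le> 1"
    and "\<And>k. k < m \<Longrightarrow> \<bar>normalise n x k - \<alpha> k\<bar> \<le> 14 * \<eta>"
    and "\<And>k. m \<le> k \<Longrightarrow> k < n \<Longrightarrow> \<bar>normalise n x k\<bar> \<le> 14 * \<eta>"
proof -
  \<comment> \<open>Inside this half-width each of the \<open>m\<close> squares changes by at most
    \<open>3 * \<eta>'\<close>, in total by at most \<open>\<eta>\<close>; the summand 3 in the
    denominator covers \<open>m = 0\<close>.\<close>
  define \<eta>' where "\<eta>' = \<eta> / (3 * real m + 3)"
  have \<eta>': "0 < \<eta>'" "\<eta>' \<le> \<eta>" "3 * real m * \<eta>' \<le> \<eta>"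
    using \<eta> by (auto simp: \<eta>'_def field_simps)
  have \<alpha>1: "\<alpha> k \<le> 1" if "k < m" for k
  proof (rule power2_le_imp_le)
    have "(\<alpha> k)\<^sup>2 \<le> (\<Sum>k<m. (\<alpha> k)\<^sup>2)"
      using that by (intro member_le_sum) auto
    then show "(\<alpha> k)\<^sup>2 \<le> 1\<^sup>2"
      using s by simp
  qed simp
  define y where "y k = (1 - \<eta>) * \<alpha> k" for k
  have y: "0 \<le> y k" "y k \<le> 1" if "k < m" for k
    using \<eta> \<alpha>[of k] \<alpha>1[OF that] mult_mono[of "1 - \<eta>" 1 "\<alpha> k" 1] by (auto simp: y_def)
  have sq: "\<bar>(x k)\<^sup>2 - (y k)\<^sup>2\<bar> \<le> 3 * \<eta>'" if "k < m" for k
  proof -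
    have xy: "\<bar>x k - y k\<bar> \<le> \<eta>'"
      using box[OF that] by (simp add: y_def \<eta>'_def)
    have "\<bar>(x k)\<^sup>2 - (y k)\<^sup>2\<bar> = \<bar>x k - y k\<bar> * \<bar>x k + y k\<bar>"
      by (simp add: abs_mult[symmetric] power2_eq_square algebra_simps)
    also have "\<dots> \<le> \<eta>' * 3"
      using xy y[OF that] \<eta>' \<eta> by (intro mult_mono) auto
    finally show ?thesis by simp
  qed
  define X where "X = (\<Sum>k<m. (x k)\<^sup>2)"
  have ys: "(\<Sum>k<m. (y k)\<^sup>2) = (1 - \<eta>)\<^sup>2 * s"
    by (simp add: y_def power_mult_distrib sum_distrib_left[symmetric] s)
  have "\<bar>X - (1 - \<eta>)\<^sup>2 * s\<bar> = \<bar>\<Sum>k<m. (x k)\<^sup>2 - (y k)\<^sup>2\<bar>"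
    unfolding X_def ys[symmetric] by (simp add: sum_subtractf)
  also have "\<dots> \<le> (\<Sum>k<m. \<bar>(x k)\<^sup>2 - (y k)\<^sup>2\<bar>)"
    by (rule sum_abs)
  also have "\<dots> \<le> (\<Sum>k<m. 3 * \<eta>')"
    by (intro sum_mono sq) auto
  also have "\<dots> \<le> \<eta>"
    using \<eta>'(3) by simp
  finally have X: "\<bar>X - (1 - \<eta>)\<^sup>2 * s\<bar> \<le> \<eta>" .
  define R where "R = (\<Sum>k<n. (x k)\<^sup>2)"
  have R: "R = X + (\<Sum>k\<in>{m..<n}. (x k)\<^sup>2)"
    unfolding R_def X_def using n by (simp add: lessThan_atLeast0 sum.atLeastLessThan_concat)
  have s0: "0 \<le> s"
    unfolding s(1)[symmetric] by (simp add: sum_nonneg)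
  have \<rho>2: "\<rho>\<^sup>2 = (1 - \<eta>)\<^sup>2 * (1 - s)"
    using s by (simp add: \<rho> power_mult_distrib)
  have "R \<le> (1 - \<eta>)\<^sup>2 * s + \<eta> + (1 - \<eta>)\<^sup>2 * (1 - s)"
    using R X shell(2) \<rho>2 by linarith
  also have "\<dots> = 1 - \<eta> * (1 - \<eta>)"
    by (simp add: power2_eq_square algebra_simps)
  also have "\<dots> \<le> 1"
    using \<eta> by simp
  finally have R1: "R \<le> 1" .
  \<comment> \<open>Bernoulli's inequality at exponent 4: two factors \<open>1 - \<eta>\<close> come
    from the shrinking and two from the inner radius of the shell. The box takes another
    \<open>\<eta>\<close>.\<close>
  have "1 - 5 * \<eta> \<le> (1 - \<eta>) ^ 4 - \<eta>"
    using Bernoulli_inequality[of "- \<eta>" 4] \<eta> by simp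
  also have "(1 - \<eta>) ^ 4 = (1 - \<eta>)\<^sup>2 * (1 - \<eta>)\<^sup>2 * s + (1 - \<eta>)\<^sup>2 * ((1 - \<eta>)\<^sup>2 * (1 - s))"
    by (simp add: numeral_eq_Suc algebra_simps)
  also have "\<dots> - \<eta> \<le> (1 - \<eta>)\<^sup>2 * s - \<eta> + ((1 - \<eta>) * \<rho>)\<^sup>2"
  proof -
    have "(1 - \<eta>)\<^sup>2 * ((1 - \<eta>)\<^sup>2 * s) \<le> 1 * ((1 - \<eta>)\<^sup>2 * s)"
      using \<eta> s0 by (intro mult_right_mono power_le_one) auto
    then show ?thesis
      by (simp add: power_mult_distrib \<rho>2 mult.assoc)
  qed
  also have "\<dots> \<le> R"
    using R X shell(1) by linarith
  finally have R2: "1 - 5 * \<eta> \<le> R" .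
  then show "0 < (\<Sum>k<n. (x k)\<^sup>2)" "(\<Sum>k<n. (x k)\<^sup>2) \<le> 1"
    using \<eta> R1 by (auto simp: R_def)
  define L where "L = L2_set x {..<n}"
  have L: "L = sqrt R"
    by (simp add: L_def L2_set_def R_def)
  have "R * R \<le> R"
    using R1 R2 \<eta> by (intro mult_left_le) auto
  then have "R \<le> L"
    unfolding L by (intro real_le_rsqrt) (simp add: power2_eq_square)
  then have L1: "1 - 5 * \<eta> \<le> L" "1 / 2 \<le> L" "L \<le> 1"
    using R2 R1 \<eta> by (auto simp: L)
  show "\<bar>normalise n x k - \<alpha> k\<bar> \<le> 14 * \<eta>" if k: "k < m" for k
  proof -
    have "\<bar>x k - \<alpha> k\<bar> \<le> \<bar>x k - (1 - \<eta>) * \<alpha> k\<bar> + \<eta> * \<alpha> k"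
      using abs_triangle_ineq4[of "x k - (1 - \<eta>) * \<alpha> k" "\<eta> * \<alpha> k"] \<eta> \<alpha>[of k]
      by (simp add: algebra_simps)
    also have "\<dots> \<le> \<eta> + \<eta> * 1"
      using box[OF k] \<eta>' \<eta> \<alpha>1[OF k] by (intro add_mono mult_left_mono) (auto simp: \<eta>'_def)
    finally have 1: "\<bar>x k - \<alpha> k\<bar> \<le> 2 * \<eta>"
      by simp
    have 2: "\<bar>(1 - L) * \<alpha> k\<bar> \<le> (5 * \<eta>) * 1"
      unfolding abs_mult using L1 \<alpha>[of k] \<alpha>1[OF k] \<eta> by (intro mult_mono) auto
    have "\<bar>normalise n x k - \<alpha> k\<bar> = \<bar>(x k - \<alpha> k) + (1 - L) * \<alpha> k\<bar> / L"
      using k n L1 by (simp add: normalise_def L_def[symmetric] field_simps)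
    \<comment> \<open>The constant 14: \<open>2 * \<eta>\<close> from the box and the shrinking,
      \<open>5 * \<eta>\<close> from the radius, divided by a radius of at least 1/2.\<close>
    also have "\<dots> \<le> (7 * \<eta>) / (1 / 2)"
      using 1 2 L1 \<eta> by (intro frac_le) auto
    finally show ?thesis by simp
  qed
  show "\<bar>normalise n x k\<bar> \<le> 14 * \<eta>" if k: "m \<le> k" "k < n" for k
  proof -
    have "\<bar>normalise n x k\<bar> = \<bar>x k\<bar> / L"
      using k L1 by (simp add: normalise_def L_def[symmetric])
    also have "\<dots> \<le> \<eta> / (1 / 2)"
      using flat[OF k] L1 \<eta> by (intro frac_le) auto
    finally show ?thesis
      using \<eta> by simp
  qed
qed

lemma eventually_shell_dominates:
  fixes \<eta> c :: real
  assumes "0 < \<eta>" "\<eta> < 1" "0 < c" "c < 1"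
  shows "\<forall>\<^sub>F N in sequentially. (1 - \<eta>) ^ N + 4 * (real N)\<^sup>2 * c ^ (N - 1) \<le> 1 / 2"
proof -
  \<comment> \<open>The square root turns the quadratic factor into the square of
    \<open>N * b ^ N\<close>, which tends to 0.\<close>
  define b where "b = sqrt c"
  have b: "0 < b" "b < 1" "b\<^sup>2 = c"
    using assms by (auto simp: b_def)
  have "(\<lambda>N. (1 - \<eta>) ^ N + 4 * (real N * b ^ N)\<^sup>2 / c) \<longlonglongrightarrow> 0 + 4 * 0\<^sup>2 / c"
    using assms b by (intro tendsto_intros LIMSEQ_realpow_zero powser_times_n_limit_0) auto
  then have "\<forall>\<^sub>F N in sequentially. (1 - \<eta>) ^ N + 4 * (real N * b ^ N)\<^sup>2 / c < 1 / 2"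
    by (rule order_tendstoD) simp
  then show ?thesis
    using eventually_ge_at_top[of 1]
  proof eventually_elim
    case (elim N)
    have "(b ^ N)\<^sup>2 = c ^ N"
      unfolding b(3)[symmetric] by (simp only: power_mult[symmetric] mult.commute)
    also have "c ^ N = c * c ^ (N - 1)"
      using elim(2) by (cases N) auto
    finally have "(real N * b ^ N)\<^sup>2 = (real N)\<^sup>2 * (c * c ^ (N - 1))"
      by (simp add: power_mult_distrib)
    then show ?case
      using elim(1) assms by simp
  qed
qed

lemma emeasure_flat_shell_ge:
  assumes J: "finite J" "card J = N" and \<eta>: "0 < \<eta>" "\<eta> < 1" "\<eta> < \<rho>" and N: "1 \<le> N"
    and dom: "(1 - \<eta>) ^ N + 4 * (real N)\<^sup>2 * (sqrt (\<rho>\<^sup>2 - \<eta>\<^sup>2) / \<rho>) ^ (N - 1) \<le> 1 / 2"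
  shows "ennreal (vol N * \<rho> ^ N / 2) \<le> emeasure (lborel_PiM J) (flat_shell J \<eta> \<rho>)"
proof -
  let ?F = "emeasure (lborel_PiM J) (flat_shell J \<eta> \<rho>)"
  let ?a = "vol N * \<rho> ^ N"
  let ?b = "vol N * ((1 - \<eta>) * \<rho>) ^ N + 4 * (real N)\<^sup>2 * vol N * \<rho> * sqrt (\<rho>\<^sup>2 - \<eta>\<^sup>2) ^ (N - 1)"
  have "\<eta>\<^sup>2 \<le> \<rho>\<^sup>2"
    using \<eta> by (intro power_mono) auto
  then have b0: "0 \<le> ?b"
    using \<eta> by (intro add_nonneg_nonneg mult_nonneg_nonneg) auto
  have \<rho>N: "\<rho> ^ N = \<rho> * \<rho> ^ (N - 1)"
    using N by (cases N) auto
  have "?b = ?a * ((1 - \<eta>) ^ N + 4 * (real N)\<^sup>2 * (sqrt (\<rho>\<^sup>2 - \<eta>\<^sup>2) / \<rho>) ^ (N - 1))"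
    using \<eta> unfolding power_mult_distrib power_divide distrib_left \<rho>N by simp
  also have "\<dots> \<le> ?a * (1 / 2)"
    using \<eta> dom by (intro mult_left_mono) auto
  finally have b: "?b \<le> ?a / 2"
    by simp
  have le: "ennreal ?a \<le> ?F + ennreal ?b"
    by (rule measure_flat_shell(2)[OF J \<eta>])
  show ?thesis
  proof (cases ?F)
    case (real f)
    from le have "ennreal ?a \<le> ennreal (f + ?b)"
      using real b0 by (simp only: ennreal_plus)
    then have "?a \<le> f + ?b"
      using real b0 by (subst (asm) ennreal_le_iff) auto
    with b have "?a / 2 \<le> f"
      by simp
    then show ?thesis
      unfolding real by (intro ennreal_leI)
  qed simp
qed

text \<open>A box for the first \<open>m\<close> coordinates times a flat shell for the others
  projects into \<open>A\<close>. The constant \<open>K\<close> depends neither on \<open>n\<close>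
  nor on \<open>A\<close>, so it vanishes at the exponential scale.\<close>

lemma uniform_sphere_lower:
  assumes \<eta>: "0 < \<eta>" "\<eta> \<le> 1 / 10"
    and \<alpha>: "\<And>k. 0 \<le> \<alpha> k" and s: "(\<Sum>k<m. (\<alpha> k)\<^sup>2) = s" "s < 1" and \<rho>: "\<rho> = (1 - \<eta>) * sqrt (1 - s)" "\<eta> < \<rho>"
  obtains K where "0 < K" "\<forall>\<^sub>F n in sequentially. \<forall>A \<in> sets (\<Pi>\<^sub>M i\<in>{..<n}. borel).
    (\<forall>\<theta> \<in> {..<n} \<rightarrow>\<^sub>E UNIV. (\<Sum>i<n. (\<theta> i)\<^sup>2) = 1 \<and> (\<forall>k<m. \<bar>\<theta> k - \<alpha> k\<bar> \<le> 14 * \<eta>) \<and>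
      (\<forall>k. m \<le> k \<and> k < n \<longrightarrow> \<bar>\<theta> k\<bar> \<le> 14 * \<eta>) \<longrightarrow> \<theta> \<in> A) \<longrightarrow> K * \<rho> ^ n \<le> measure (uniform_sphere n) A"
proof -
  define \<eta>' where "\<eta>' = \<eta> / (3 * real m + 3)"
  \<comment> \<open>The volume of the box, halved for the part lost by the shell, and divided by
    \<open>vol m\<close> because \<open>vol n\<close> is at most
    \<open>vol m * vol N\<close>.\<close>
  define K where "K = (2 * \<eta>') ^ m / (2 * vol m)"
  have \<eta>': "0 < \<eta>'"
    using \<eta> by (simp add: \<eta>'_def)
  then have K: "0 < K"
    by (simp add: K_def)
  have "0 \<le> s"
    unfolding s(1)[symmetric] by (simp add: sum_nonneg)
  then have "sqrt (1 - s) \<le> 1" "0 < sqrt (1 - s)"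
    using s by auto
  then have \<rho>': "0 < \<rho>" "\<rho> \<le> 1"
    using \<eta> \<rho> mult_mono[of "1 - \<eta>" 1 "sqrt (1 - s)" 1] by auto
  define \<kappa> where "\<kappa> = sqrt (\<rho>\<^sup>2 - \<eta>\<^sup>2) / \<rho>"
  have "\<eta>\<^sup>2 < \<rho>\<^sup>2"
    using \<eta> \<rho> by (intro power_strict_mono) auto
  moreover have "sqrt (\<rho>\<^sup>2 - \<eta>\<^sup>2) < sqrt (\<rho>\<^sup>2)"
    using \<eta> by (intro real_sqrt_less_mono) simp
  ultimately have "0 < \<kappa>" "\<kappa> < 1"
    using \<rho>' by (auto simp: \<kappa>_def)
  with eventually_shell_dominates[of \<eta> \<kappa>] \<eta> obtain N0 where
    N0: "\<And>N. N0 \<le> N \<Longrightarrow> (1 - \<eta>) ^ N + 4 * (real N)\<^sup>2 * \<kappa> ^ (N - 1) \<le> 1 / 2"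
    by (auto simp: eventually_sequentially)
  have main: "K * \<rho> ^ n \<le> measure (uniform_sphere n) A"
    if n: "m + N0 + 1 \<le> n" and A: "A \<in> sets (\<Pi>\<^sub>M i\<in>{..<n}. borel)"
      and near: "\<forall>\<theta> \<in> {..<n} \<rightarrow>\<^sub>E UNIV. (\<Sum>i<n. (\<theta> i)\<^sup>2) = 1 \<and> (\<forall>k<m. \<bar>\<theta> k - \<alpha> k\<bar> \<le> 14 * \<eta>) \<and>
        (\<forall>k. m \<le> k \<and> k < n \<longrightarrow> \<bar>\<theta> k\<bar> \<le> 14 * \<eta>) \<longrightarrow> \<theta> \<in> A" for n A
  proof -
    let ?M = "lborel_PiM {..<n}" and ?I = "{..<m}" and ?J = "{m..<n}"
    define N where "N = n - m"
    have IJ: "finite ?I" "finite ?J" "?I \<inter> ?J = {}" "?I \<union> ?J = {..<n}"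
      using n by auto
    have N: "card ?J = N" "1 \<le> N" "N0 \<le> N" "n = m + N"
      using n by (auto simp: N_def)
    define Box where "Box = Pi\<^sub>E ?I (\<lambda>k. {(1 - \<eta>) * \<alpha> k - \<eta>'..(1 - \<eta>) * \<alpha> k + \<eta>'})"
    have Box_sets: "Box \<in> sets (lborel_PiM ?I)"
      unfolding Box_def by (rule sets_PiM_I_finite) auto
    have Box: "emeasure (lborel_PiM ?I) Box = ennreal ((2 * \<eta>') ^ m)"
      unfolding Box_def using \<eta>' by (subst lborel_prod.emeasure_PiM) (auto simp: ennreal_power)
    have \<eta>1: "\<eta> < 1"
      using \<eta> by simp
    note shell_sets = measure_flat_shell(1)[OF IJ(2) N(1) \<eta>(1) \<eta>1 \<rho>(2)]
    note split = emeasure_PiM_split[OF IJ(1-3) Box_sets shell_sets, unfolded IJ(4)]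
    let ?X = "{x \<in> {..<n} \<rightarrow>\<^sub>E UNIV. restrict x ?I \<in> Box \<and> restrict x ?J \<in> flat_shell ?J \<eta> \<rho>}"
    have sub: "?X \<subseteq> {x \<in> ball_PiM {..<n} 1. normalise n x \<in> A}"
    proof
      fix x assume "x \<in> ?X"
      then have x: "x \<in> {..<n} \<rightarrow>\<^sub>E UNIV" and xB: "restrict x ?I \<in> Box" and xJ: "restrict x ?J \<in> flat_shell ?J \<eta> \<rho>"
        by auto
      have box: "\<bar>x k - (1 - \<eta>) * \<alpha> k\<bar> \<le> \<eta> / (3 * real m + 3)" if "k < m" for k
        using xB that unfolding Box_def \<eta>'_def[symmetric] by (force simp: PiE_iff abs_le_iff)
      have shell: "((1 - \<eta>) * \<rho>)\<^sup>2 \<le> (\<Sum>k\<in>?J. (x k)\<^sup>2)" "(\<Sum>k\<in>?J. (x k)\<^sup>2) \<le> \<rho>\<^sup>2"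
      proof -
        have "(1 - \<eta>) * \<rho> \<le> L2_set x ?J" "L2_set x ?J \<le> \<rho>"
          using xJ by (auto simp: flat_shell_def ball_PiM_def L2_set_def)
        then have "((1 - \<eta>) * \<rho>)\<^sup>2 \<le> (L2_set x ?J)\<^sup>2" "(L2_set x ?J)\<^sup>2 \<le> \<rho>\<^sup>2"
          using \<eta>1 \<rho>' by (auto intro!: power_mono)
        then show "((1 - \<eta>) * \<rho>)\<^sup>2 \<le> (\<Sum>k\<in>?J. (x k)\<^sup>2)" "(\<Sum>k\<in>?J. (x k)\<^sup>2) \<le> \<rho>\<^sup>2"
          by (simp_all only: L2_set_sq)
      qed
      have flat: "\<bar>x k\<bar> \<le> \<eta>" if "m \<le> k" "k < n" for k
        using xJ that by (auto simp: flat_shell_def)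
      have mn: "m \<le> n"
        using n by simp
      note nn = normalise_near[OF \<eta> mn \<alpha> s \<rho>(1) box shell flat]
      have "normalise n x \<in> {..<n} \<rightarrow>\<^sub>E UNIV"
        by (simp add: normalise_def)
      moreover have "(\<Sum>i<n. (normalise n x i)\<^sup>2) = 1"
        using nn(1) by (simp add: sum_normalise_sq)
      ultimately have "normalise n x \<in> A"
        using near nn(3,4) by blast
      then show "x \<in> {x \<in> ball_PiM {..<n} 1. normalise n x \<in> A}"
        using x nn(2) by (simp add: ball_PiM_def L2_set_le_iff)
    qed
    have ball: "emeasure ?M (ball_PiM {..<n} 1) = ennreal (vol n)"
      by (subst emeasure_ball_PiM) auto
    have fin: "emeasure ?M {x \<in> ball_PiM {..<n} 1. normalise n x \<in> A} \<noteq> \<top>"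
    proof -
      have "emeasure ?M {x \<in> ball_PiM {..<n} 1. normalise n x \<in> A} \<le> ennreal (vol n)"
        unfolding ball[symmetric] by (rule emeasure_mono) auto
      then show ?thesis
        by (auto simp: top_unique)
    qed
    have "ennreal ((2 * \<eta>') ^ m * (vol N * \<rho> ^ N / 2)) =
        ennreal ((2 * \<eta>') ^ m) * ennreal (vol N * \<rho> ^ N / 2)"
      using \<eta>' by (intro ennreal_mult') simp
    also have "\<dots> \<le> ennreal ((2 * \<eta>') ^ m) * emeasure (lborel_PiM ?J) (flat_shell ?J \<eta> \<rho>)"
      using N0[OF N(3)] by (intro mult_left_mono emeasure_flat_shell_ge[OF IJ(2) N(1) \<eta>(1) \<eta>1 \<rho>(2) N(2)])
        (simp_all add: \<kappa>_def)
    also have "\<dots> = emeasure ?M ?X"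
      by (simp add: split(2) Box)
    also have "\<dots> \<le> emeasure ?M {x \<in> ball_PiM {..<n} 1. normalise n x \<in> A}"
      by (rule emeasure_mono[OF sub sets_normalise_ball[OF A]])
    also have "\<dots> = ennreal (measure ?M {x \<in> ball_PiM {..<n} 1. normalise n x \<in> A})"
      by (rule emeasure_eq_ennreal_measure[OF fin])
    finally have le: "(2 * \<eta>') ^ m * (vol N * \<rho> ^ N / 2) \<le> measure ?M {x \<in> ball_PiM {..<n} 1. normalise n x \<in> A}"
      by (subst (asm) ennreal_le_iff) auto
    have "K * \<rho> ^ n * vol n \<le> K * \<rho> ^ N * (vol m * vol N)"
      using K \<rho>' N vol_le_mult[of m N] by (intro mult_mono mult_left_mono power_decreasing) auto
    also have "\<dots> = (2 * \<eta>') ^ m * (vol N * \<rho> ^ N / 2)"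
    proof -
      have "vol m \<noteq> 0"
        using vol_pos[of m] by linarith
      then show ?thesis
        by (simp add: K_def)
    qed
    also note le
    finally have "K * \<rho> ^ n \<le> measure ?M {x \<in> ball_PiM {..<n} 1. normalise n x \<in> A} / vol n"
      by (subst pos_le_divide_eq[OF vol_pos])
    then show ?thesis
      using n by (subst measure_uniform_sphere[OF _ A]) auto
  qed
  show thesis
    by (rule that[OF K], unfold eventually_sequentially, rule exI[of _ "m + N0 + 1"]) (use main in blast)
qed

section \<open>The rate function\<close>

text \<open>The value does not depend on the chosen sequence, since all admissible sequences of one
  law share the same \<open>sq_norm\<close>.\<close>

definition rate :: "real measure \<Rightarrow> ereal" where
  "rate \<nu> = (if \<exists>\<alpha>. admissible \<alpha> \<and> \<nu> = nu \<alpha>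
     then ereal (- (1 / 2) * ln (1 - sq_norm (SOME \<alpha>. admissible \<alpha> \<and> \<nu> = nu \<alpha>))) else \<infinity>)"

lemma rate_nu:
  assumes "admissible \<alpha>"
  shows "rate (nu \<alpha>) = ereal (- (1 / 2) * ln (1 - sq_norm \<alpha>))"
proof -
  define \<beta> where "\<beta> = (SOME \<beta>. admissible \<beta> \<and> nu \<alpha> = nu \<beta>)"
  have "admissible \<beta> \<and> nu \<alpha> = nu \<beta>"
    unfolding \<beta>_def by (rule someI[of _ \<alpha>]) (use assms in simp)
  then have "sq_norm \<alpha> = sq_norm \<beta>"
    using sq_norm_eq_if_nu_eq assms by blast
  then show ?thesis
    using assms by (auto simp: rate_def \<beta>_def)
qed

lemma rate_eq_infinity: "\<not> (\<exists>\<alpha>. admissible \<alpha> \<and> \<nu> = nu \<alpha>) \<Longrightarrow> rate \<nu> = \<infinity>"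
  by (simp add: rate_def)

lemma sq_norm_nonneg: "admissible \<alpha> \<Longrightarrow> 0 \<le> sq_norm \<alpha>"
  by (auto simp: admissible_def sq_norm_def intro!: suminf_nonneg)

lemma rate_nonneg: "0 \<le> rate \<nu>"
proof (cases "\<exists>\<alpha>. admissible \<alpha> \<and> \<nu> = nu \<alpha>")
  case True
  then obtain \<alpha> where \<alpha>: "admissible \<alpha>" "\<nu> = nu \<alpha>"
    by blast
  then have "ln (1 - sq_norm \<alpha>) \<le> 0"
    using sq_norm_nonneg[OF \<alpha>(1)] by (simp add: admissible_def)
  then show ?thesis
    by (simp add: \<alpha> rate_nu)
qed (simp add: rate_eq_infinity)

text \<open>The inequality \<open>- (1 / 2) * ln (1 - s) \<le> c\<close> is solved for
  \<open>s\<close>. Level sets thus become continuous images of compact sets; for negative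
  \<open>c\<close> both sides are empty.\<close>

lemma rate_level_set:
  "{\<nu> \<in> topspace weak_topology. rate \<nu> \<le> ereal c} = nu ` coeff_seqs (1 - exp (- 2 * c))"
proof -
  have iff: "rate (nu \<alpha>) \<le> ereal c \<longleftrightarrow> sq_norm \<alpha> \<le> 1 - exp (- 2 * c)" if "admissible \<alpha>" for \<alpha>
  proof -
    have "0 < 1 - sq_norm \<alpha>"
      using that by (simp add: admissible_def)
    then have "- 2 * c \<le> ln (1 - sq_norm \<alpha>) \<longleftrightarrow> exp (- 2 * c) \<le> 1 - sq_norm \<alpha>"
      by (rule ln_ge_iff)
    then show ?thesis
      by (auto simp: rate_nu[OF that])
  qed
  have "1 - exp (- 2 * c) < 1"
    by simp
  show ?thesis
  proof (intro equalityI subsetI)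
    fix \<nu> assume "\<nu> \<in> {\<nu> \<in> topspace weak_topology. rate \<nu> \<le> ereal c}"
    then have \<nu>: "rate \<nu> \<le> ereal c"
      by simp
    then obtain \<alpha> where \<alpha>: "admissible \<alpha>" "\<nu> = nu \<alpha>"
      using rate_eq_infinity by fastforce
    then have "\<alpha> \<in> coeff_seqs (1 - exp (- 2 * c))"
      using \<nu> iff by (intro admissible_imp_coeff_seqs) auto
    then show "\<nu> \<in> nu ` coeff_seqs (1 - exp (- 2 * c))"
      using \<alpha> by blast
  next
    fix \<nu> assume "\<nu> \<in> nu ` coeff_seqs (1 - exp (- 2 * c))"
    then obtain \<alpha> where \<alpha>: "\<alpha> \<in> coeff_seqs (1 - exp (- 2 * c))" "\<nu> = nu \<alpha>"
      by blast
    note coeff_seqs_imp_admissible[OF \<alpha>(1) \<open>1 - exp (- 2 * c) < 1\<close>]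
    then show "\<nu> \<in> {\<nu> \<in> topspace weak_topology. rate \<nu> \<le> ereal c}"
      using iff \<alpha>(2) by (simp add: real_distribution_nu)
  qed
qed

lemma good_rate_function_rate: "good_rate_function weak_topology rate"
proof -
  have compact: "compactin weak_topology {\<nu> \<in> topspace weak_topology. rate \<nu> \<le> ereal c}" for c
    unfolding rate_level_set by (rule compactin_nu_image) simp
  have "openin weak_topology {\<nu> \<in> topspace weak_topology. c < rate \<nu>}" for c
  proof (cases c)
    case (real r)
    have "closedin weak_topology {\<nu> \<in> topspace weak_topology. rate \<nu> \<le> c}"
      unfolding real by (rule compactin_imp_closedin[OF Hausdorff_weak_topology compact])
    moreover have "{\<nu> \<in> topspace weak_topology. c < rate \<nu>} =
        topspace weak_topology - {\<nu> \<in> topspace weak_topology. rate \<nu> \<le> c}"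
      by auto
    ultimately show ?thesis
      unfolding closedin_def by simp
  next
    \<comment> \<open>At minus infinity the set is the whole space, as the rate is
      nonnegative.\<close>
    case MInf
    have "- \<infinity> < rate \<nu>" for \<nu>
      using rate_nonneg[of \<nu>] by auto
    then have "{\<nu> \<in> topspace weak_topology. c < rate \<nu>} = topspace weak_topology"
      unfolding MInf by blast
    then show ?thesis
      by (simp only: openin_topspace)
  qed simp
  with compact rate_nonneg show ?thesis
    by (auto simp: good_rate_function_def rate_function_def lower_semicontinuous_on_topology_def
        simp del: topspace_weak_topology)
qed

section \<open>The large deviation principle\<close>

lemma mu_discr_cong: "(\<And>i. i < n \<Longrightarrow> \<theta> i = \<theta>' i) \<Longrightarrow> mu_discr n \<theta> = mu_discr n \<theta>'"
  unfolding mu_discr_def by (intro distr_cong sum.cong) auto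

lemma open_mu_discr_vimage:
  assumes "openin weak_topology U"
  shows "open {\<theta>. mu_discr n \<theta> \<in> U}"
proof -
  have "closed {\<theta>. mu_discr n \<theta> \<notin> U}"
    unfolding closed_sequential_limits
  proof (intro allI impI)
    fix x :: "nat \<Rightarrow> nat \<Rightarrow> real" and l
    assume x: "(\<forall>j. x j \<in> {\<theta>. mu_discr n \<theta> \<notin> U}) \<and> x \<longlonglongrightarrow> l"
    have coord: "(\<lambda>j. x j k) \<longlonglongrightarrow> l k" for k
      by (rule continuous_on_tendsto_compose[where f = "\<lambda>x. x k" and s = UNIV]) (use x in auto)
    have "(\<lambda>j. char (mu_discr n (x j)) t) \<longlonglongrightarrow> char (mu_discr n l) t" for t
      unfolding char_mu_discr by (intro tendsto_intros coord)
    then have "mu_discr n l \<in> U \<Longrightarrow> \<forall>\<^sub>F j in sequentially. mu_discr n (x j) \<in> U"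
      by (rule eventually_weak_topology[OF real_distribution_mu_discr _ assms])
    then show "l \<in> {\<theta>. mu_discr n \<theta> \<notin> U}"
      using x by (auto simp: eventually_sequentially)
  qed
  then show ?thesis
    by (simp add: closed_def Collect_neg_eq)
qed

lemma measurable_mu_discr:
  "mu_discr n \<in> (\<Pi>\<^sub>M i\<in>{..<n}. borel) \<rightarrow>\<^sub>M borel_of_topology weak_topology"
  unfolding borel_of_topology_def
proof (rule measurable_measure_of)
  show "{U. openin weak_topology U} \<subseteq> Pow (topspace weak_topology)"
    using openin_subset by blast
  show "mu_discr n \<in> space (\<Pi>\<^sub>M i\<in>{..<n}. borel) \<rightarrow> topspace weak_topology"
    by (simp add: real_distribution_mu_discr)
  fix U assume "U \<in> {U. openin weak_topology U}"
  then have U: "{\<theta>. mu_discr n \<theta> \<in> U} \<in> sets borel"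
    using open_mu_discr_vimage by auto
  \<comment> \<open>Openness is known for full sequences with the product topology, whereas the
    sphere consists of extensional functions on \<open>{..<n}\<close>. Extension by zero connects
    the two without changing the law.\<close>
  define ext where "ext = (\<lambda>\<theta> i. if i < n then \<theta> i else 0 :: real)"
  have "ext \<in> borel_measurable (\<Pi>\<^sub>M i\<in>{..<n}. borel)"
  proof (rule measurable_coordinatewise_then_product)
    fix i
    show "(\<lambda>\<theta>. ext \<theta> i) \<in> borel_measurable (\<Pi>\<^sub>M i\<in>{..<n}. borel)"
      unfolding ext_def by (cases "i < n") auto
  qed
  from measurable_sets[OF this U]
  have "ext -` {\<theta>. mu_discr n \<theta> \<in> U} \<inter> space (\<Pi>\<^sub>M i\<in>{..<n}. borel) \<in> sets (\<Pi>\<^sub>M i\<in>{..<n}. borel)" .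
  moreover have "mu_discr n (ext \<theta>) = mu_discr n \<theta>" for \<theta>
    by (rule mu_discr_cong) (simp add: ext_def)
  ultimately show "mu_discr n -` U \<inter> space (\<Pi>\<^sub>M i\<in>{..<n}. borel) \<in> sets (\<Pi>\<^sub>M i\<in>{..<n}. borel)"
    by (simp add: vimage_def)
qed

section \<open>Exponential rates from probability bounds\<close>

lemma limsup_log_prob_le:
  assumes q: "0 < q" and p: "\<And>n. 0 \<le> p n"
    and le: "\<forall>\<^sub>F n in sequentially. p n \<le> 2 * (2 * real n) ^ (2 * m) * q ^ (n - m)"
  shows "limsup (\<lambda>n. ereal (1 / real n) * log_prob (p n)) \<le> ereal (ln q)"
proof -
  \<comment> \<open>The logarithm of the bound divided by \<open>n\<close>: the constants, the fixed
    loss of \<open>m\<close> in the exponent and the power of \<open>n\<close> all tend to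
    0.\<close>
  let ?b = "\<lambda>n::nat. (ln 2 + real (2 * m) * ln 2 - real m * ln q) / real n + real (2 * m) * (ln (real n) / real n) + ln q"
  have "\<forall>\<^sub>F n in sequentially. ereal (1 / real n) * log_prob (p n) \<le> ereal (?b n)"
    using le eventually_ge_at_top[of "max 1 m"]
  proof eventually_elim
    case (elim n)
    then have n: "1 \<le> n" "m \<le> n"
      by auto
    show ?case
    proof (cases "p n = 0")
      case True
      then show ?thesis
        using n by (simp add: log_prob_def)
    next
      case False
      then have pos: "0 < p n"
        using p[of n] by simp
      then have "ln (p n) \<le> ln (2 * (2 * real n) ^ (2 * m) * q ^ (n - m))"
        by (intro ln_mono pos elim(1))
      also have "\<dots> = ln 2 + real (2 * m) * (ln 2 + ln (real n)) + (real n - real m) * ln q"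
        using n q by (simp add: ln_mult ln_realpow of_nat_diff distrib_left)
      finally have "ln (p n) / real n \<le>
          (ln 2 + real (2 * m) * (ln 2 + ln (real n)) + (real n - real m) * ln q) / real n"
        using n by (intro divide_right_mono) auto
      also have "\<dots> = ?b n"
        using n by (simp add: field_simps)
      finally show ?thesis
        using False by (simp add: log_prob_def)
    qed
  qed
  then have "limsup (\<lambda>n. ereal (1 / real n) * log_prob (p n)) \<le> limsup (\<lambda>n. ereal (?b n))"
    by (rule Limsup_mono)
  also have "?b \<longlonglongrightarrow> 0 + real (2 * m) * 0 + ln q"
    by (intro tendsto_intros lim_ln_over_n lim_const_over_n)
  then have "limsup (\<lambda>n. ereal (?b n)) = ereal (ln q)"
    by (intro lim_imp_Limsup) auto
  finally show ?thesis .
qed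

lemma liminf_log_prob_ge:
  assumes K: "0 < K" and \<rho>: "0 < \<rho>"
    and ge: "\<forall>\<^sub>F n in sequentially. K * \<rho> ^ n \<le> p n"
  shows "ereal (ln \<rho>) \<le> liminf (\<lambda>n. ereal (1 / real n) * log_prob (p n))"
proof -
  let ?b = "\<lambda>n::nat. ln K / real n + ln \<rho>"
  have "\<forall>\<^sub>F n in sequentially. ereal (?b n) \<le> ereal (1 / real n) * log_prob (p n)"
    using ge eventually_ge_at_top[of 1]
  proof eventually_elim
    case (elim n)
    have pos: "0 < K * \<rho> ^ n"
      using K \<rho> by simp
    with elim have p: "0 < p n"
      by linarith
    have "ln K + real n * ln \<rho> = ln (K * \<rho> ^ n)"
      using K \<rho> by (simp add: ln_mult ln_realpow)
    also have "\<dots> \<le> ln (p n)"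
      using pos p elim by simp
    finally have "(ln K + real n * ln \<rho>) / real n \<le> ln (p n) / real n"
      using elim by (intro divide_right_mono) auto
    moreover have "(ln K + real n * ln \<rho>) / real n = ?b n"
      using elim by (simp add: field_simps)
    ultimately show ?case
      using p by (simp add: log_prob_def)
  qed
  then have "liminf (\<lambda>n. ereal (?b n)) \<le> liminf (\<lambda>n. ereal (1 / real n) * log_prob (p n))"
    by (rule Liminf_mono)
  moreover have "?b \<longlonglongrightarrow> 0 + ln \<rho>"
    by (intro tendsto_intros lim_const_over_n)
  then have "liminf (\<lambda>n. ereal (?b n)) = ereal (ln \<rho>)"
    by (intro lim_imp_Liminf) auto
  ultimately show ?thesis
    by simp
qed

section \<open>Upper and lower bounds for events on the sphere\<close>

definition mu_event :: "nat \<Rightarrow> real measure set \<Rightarrow> (nat \<Rightarrow> real) set" where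
  "mu_event n A = {\<theta> \<in> {..<n} \<rightarrow>\<^sub>E UNIV. mu_discr n \<theta> \<in> A}"

lemma sets_mu_event:
  assumes "A \<in> sets (borel_of_topology weak_topology)"
  shows "mu_event n A \<in> sets (\<Pi>\<^sub>M i\<in>{..<n}. borel)"
proof -
  have "mu_event n A = mu_discr n -` A \<inter> space (\<Pi>\<^sub>M i\<in>{..<n}. borel)"
    by (auto simp: mu_event_def space_PiM)
  then show ?thesis
    using measurable_sets[OF measurable_mu_discr assms] by simp
qed

lemma sphere_upper_bound:
  assumes A: "A \<in> sets (borel_of_topology weak_topology)" and p: "\<And>n. 0 \<le> p n" "\<And>n. p n \<le> 1"
    and p_eq: "\<And>n. 1 \<le> n \<Longrightarrow> p n = measure (uniform_sphere n) (mu_event n A)"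
  shows "limsup (\<lambda>n. ereal (1 / real n) * log_prob (p n)) \<le>
    - (INF x \<in> weak_topology closure_of A. rate x)" (is "limsup ?a \<le> - ?L")
proof (rule ccontr)
  assume "\<not> limsup ?a \<le> - ?L"
  then have "- ?L < limsup ?a"
    by simp
  \<comment> \<open>A real \<open>z\<close> strictly between the two sides gives room: the level
    \<open>- z\<close> is finite and strictly below the infimum of the rate over the
    closure.\<close>
  then obtain z where z: "- ?L < ereal z" "ereal z < limsup ?a"
    using ereal_dense2 by blast
  have "limsup ?a \<le> ereal z"
  proof (cases "0 \<le> z")
    case True
    have "?a n \<le> 0" for n
      using p[of n] by (auto simp: log_prob_def ereal_mult_le_0_iff divide_nonneg_nonneg)
    then have "limsup ?a \<le> 0"
      by (intro Limsup_bounded always_eventually allI)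
    then show ?thesis
      using True by (metis ereal_less_eq(5) order_trans)
  next
    case False
    \<comment> \<open>With \<open>q = exp z\<close> the level \<open>- z\<close> corresponds to
      coefficient mass \<open>1 - q\<^sup>2\<close>, so the other coordinates have radius
      \<open>q\<close>, and volume comparison returns exactly the rate \<open>z\<close>.\<close>
    define q where "q = exp z"
    have q: "0 < q" "q \<le> 1"
      using False by (auto simp: q_def)
    let ?C = "weak_topology closure_of A"
    have "?C \<inter> nu ` coeff_seqs (1 - exp (- 2 * (- z))) = {}"
    proof -
      have "\<not> rate x \<le> ereal (- z)" if "x \<in> ?C" for x
      proof -
        have "?L \<le> rate x"
          using that by (rule INF_lower)
        moreover have "ereal (- z) < ?L"
          using z(1) by (simp add: ereal_uminus_less_reorder)
        ultimately show ?thesis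
          by (simp add: not_le)
      qed
      then show ?thesis
        unfolding rate_level_set[symmetric] by blast
    qed
    moreover have "exp (- 2 * (- z)) = q\<^sup>2"
      by (simp add: q_def exp_double)
    ultimately have "?C \<inter> nu ` coeff_seqs (1 - q\<^sup>2) = {}"
      by simp
    from closedin_weak_topology_concentration[OF closedin_closure_of _ this] q
    obtain m where m: "\<And>n \<theta>. m \<le> n \<Longrightarrow> (\<Sum>i<n. (\<theta> i)\<^sup>2) = 1 \<Longrightarrow> mu_discr n \<theta> \<in> ?C \<Longrightarrow>
        \<exists>S\<subseteq>{..<n}. card S = m \<and> 1 - q\<^sup>2 \<le> (\<Sum>i\<in>S. (\<theta> i)\<^sup>2)"
      by auto
    have "A \<subseteq> topspace weak_topology"
      using sets.sets_into_space[OF A] by (simp add: borel_of_topology_def space_measure_of_conv)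
    then have AC: "A \<subseteq> ?C"
      by (rule closure_of_subset)
    have "limsup ?a \<le> ereal (ln q)"
    proof (rule limsup_log_prob_le[OF q(1) p(1)])
      show "\<forall>\<^sub>F n in sequentially. p n \<le> 2 * (2 * real n) ^ (2 * m) * q ^ (n - m)"
        using eventually_ge_at_top[of "max 1 m"]
      proof eventually_elim
        case (elim n)
        then have n: "1 \<le> n" "m \<le> n"
          by auto
        show ?case
          unfolding p_eq[OF n(1)]
        proof (rule uniform_sphere_upper[OF n q sets_mu_event[OF A]])
          fix \<theta> assume "\<theta> \<in> mu_event n A" "(\<Sum>i<n. (\<theta> i)\<^sup>2) = 1"
          then show "\<exists>S\<subseteq>{..<n}. card S = m \<and> 1 - q\<^sup>2 \<le> (\<Sum>i\<in>S. (\<theta> i)\<^sup>2)"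
            using m[OF n(2)] AC by (auto simp: mu_event_def)
        qed
      qed
    qed
    then show ?thesis
      by (simp add: q_def)
  qed
  with z(2) show False
    by simp
qed

lemma sphere_lower_bound:
  assumes A: "A \<in> sets (borel_of_topology weak_topology)"
    and p_eq: "\<And>n. 1 \<le> n \<Longrightarrow> p n = measure (uniform_sphere n) (mu_event n A)"
  shows "- (INF x \<in> weak_topology interior_of A. rate x) \<le>
    liminf (\<lambda>n. ereal (1 / real n) * log_prob (p n))" (is "_ \<le> ?l")
proof -
  have "- ?l \<le> rate x" if x: "x \<in> weak_topology interior_of A" for x
  proof (cases "\<exists>\<alpha>. admissible \<alpha> \<and> x = nu \<alpha>")
    case False
    then show ?thesis
      by (simp add: rate_eq_infinity)
  next
    case True
    then obtain \<alpha> where \<alpha>: "admissible \<alpha>" and x_eq: "x = nu \<alpha>"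
      by blast
    obtain m \<epsilon> where \<epsilon>: "0 < \<epsilon>" and nbhd: "\<And>n \<theta>. m \<le> n \<Longrightarrow> (\<Sum>i<n. (\<theta> i)\<^sup>2) = 1 \<Longrightarrow>
        (\<And>k. k < m \<Longrightarrow> \<bar>\<theta> k - \<alpha> k\<bar> < \<epsilon>) \<Longrightarrow> (\<And>k. m \<le> k \<Longrightarrow> k < n \<Longrightarrow> \<bar>\<theta> k\<bar> < \<epsilon>) \<Longrightarrow>
        mu_discr n \<theta> \<in> weak_topology interior_of A"
      using openin_weak_topology_neighbourhood[OF \<alpha> openin_interior_of] x unfolding x_eq by metis
    define s where "s = (\<Sum>k<m. (\<alpha> k)\<^sup>2)"
    have nonneg: "\<And>k. 0 \<le> \<alpha> k" and s_le: "s \<le> sq_norm \<alpha>" "sq_norm \<alpha> < 1"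
      using \<alpha> unfolding s_def sq_norm_def by (auto simp: admissible_def sq_norm_def intro: sum_le_suminf)
    then have s: "s < 1"
      by simp
    define g where "g \<eta> = ln ((1 - \<eta>) * sqrt (1 - s))" for \<eta>
    \<comment> \<open>The bounds on \<open>\<eta>\<close> serve in turn
      \<open>normalise_near\<close>, the neighbourhood of radius \<open>\<epsilon>\<close>, and
      \<open>\<eta> < \<rho>\<close>, which holds because \<open>\<rho>\<close> is at least
      \<open>sqrt (1 - s) / 2\<close>.\<close>
    have small: "ereal (g \<eta>) \<le> ?l"
      if \<eta>: "0 < \<eta>" "\<eta> < 1 / 10" "14 * \<eta> < \<epsilon>" "\<eta> < sqrt (1 - s) / 2" for \<eta>
    proof -
      define \<rho> where "\<rho> = (1 - \<eta>) * sqrt (1 - s)"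
      have "1 / 2 * sqrt (1 - s) \<le> \<rho>"
        unfolding \<rho>_def using \<eta> s by (intro mult_right_mono) auto
      then have \<rho>: "\<eta> < \<rho>" "0 < \<rho>"
        using \<eta> by auto
      obtain K where K: "0 < K" and low: "\<forall>\<^sub>F n in sequentially. \<forall>A \<in> sets (\<Pi>\<^sub>M i\<in>{..<n}. borel).
        (\<forall>\<theta> \<in> {..<n} \<rightarrow>\<^sub>E UNIV. (\<Sum>i<n. (\<theta> i)\<^sup>2) = 1 \<and> (\<forall>k<m. \<bar>\<theta> k - \<alpha> k\<bar> \<le> 14 * \<eta>) \<and>
          (\<forall>k. m \<le> k \<and> k < n \<longrightarrow> \<bar>\<theta> k\<bar> \<le> 14 * \<eta>) \<longrightarrow> \<theta> \<in> A) \<longrightarrow> K * \<rho> ^ n \<le> measure (uniform_sphere n) A"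
        using uniform_sphere_lower[OF \<eta>(1) less_imp_le[OF \<eta>(2)] nonneg s_def[symmetric] s \<rho>_def \<rho>(1)] by blast
      have "\<forall>\<^sub>F n in sequentially. K * \<rho> ^ n \<le> p n"
        using low eventually_ge_at_top[of "max 1 m"]
      proof eventually_elim
        case (elim n)
        then have n: "1 \<le> n" "m \<le> n"
          by auto
        have "\<theta> \<in> mu_event n A" if "\<theta> \<in> {..<n} \<rightarrow>\<^sub>E UNIV" "(\<Sum>i<n. (\<theta> i)\<^sup>2) = 1"
          "\<forall>k<m. \<bar>\<theta> k - \<alpha> k\<bar> \<le> 14 * \<eta>" "\<forall>k. m \<le> k \<and> k < n \<longrightarrow> \<bar>\<theta> k\<bar> \<le> 14 * \<eta>" for \<theta>
        proof -
          have "mu_discr n \<theta> \<in> weak_topology interior_of A"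
            using that \<eta>(3) by (intro nbhd[OF n(2)]) (auto intro: le_less_trans)
          then show ?thesis
            using that(1) interior_of_subset[of weak_topology A] by (auto simp: mu_event_def)
        qed
        with elim(1) sets_mu_event[OF A, of n] show ?case
          unfolding p_eq[OF n(1)] by blast
      qed
      from liminf_log_prob_ge[OF K \<rho>(2) this] show ?thesis
        by (simp add: g_def \<rho>_def)
    qed
    define \<eta> where "\<eta> j = 1 / real (Suc j)" for j
    have \<eta>: "\<eta> \<longlonglongrightarrow> 0" "\<And>j. 0 < \<eta> j"
      unfolding \<eta>_def by (rule LIMSEQ_Suc[OF lim_1_over_n]) simp
    have "(\<lambda>j. g (\<eta> j)) \<longlonglongrightarrow> ln ((1 - 0) * sqrt (1 - s))"
      unfolding g_def using s by (intro tendsto_intros \<eta>(1)) auto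
    then have lim: "(\<lambda>j. ereal (g (\<eta> j))) \<longlonglongrightarrow> ereal (ln (sqrt (1 - s)))"
      by simp
    have "\<forall>\<^sub>F j in sequentially. \<eta> j < Min {1 / 10, \<epsilon> / 14, sqrt (1 - s) / 2}"
      by (rule order_tendstoD(2)[OF \<eta>(1)]) (use \<epsilon> s in simp)
    then have "\<forall>\<^sub>F j in sequentially. ereal (g (\<eta> j)) \<le> ?l"
      by eventually_elim (use \<eta>(2) in \<open>intro small, auto\<close>)
    with lim have "ereal (ln (sqrt (1 - s))) \<le> ?l"
      by (rule tendsto_upperbound) simp
    \<comment> \<open>Truncating after \<open>m\<close> coefficients only helps: the partial sum
      \<open>s\<close> is at most \<open>sq_norm \<alpha>\<close>, so the exponent obtained is no
      worse than the required one.\<close>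
    moreover have "ln (1 - sq_norm \<alpha>) / 2 \<le> ln (sqrt (1 - s))"
      using s s_le by (simp add: ln_sqrt)
    ultimately have "ereal (ln (1 - sq_norm \<alpha>) / 2) \<le> ?l"
      by (metis ereal_less_eq(3) order_trans)
    moreover have "rate x = - ereal (ln (1 - sq_norm \<alpha>) / 2)"
      by (simp add: x_eq rate_nu[OF \<alpha>])
    ultimately show ?thesis
      by (simp only: ereal_minus_le_minus)
  qed
  then have "- ?l \<le> (INF x \<in> weak_topology interior_of A. rate x)"
    by (rule INF_greatest)
  then show ?thesis
    by (simp only: ereal_uminus_le_reorder)
qed

theorem theorem2:
  fixes P :: "nat \<Rightarrow> 'a measure" and \<Theta> :: "nat \<Rightarrow> 'a \<Rightarrow> (nat \<Rightarrow> real)"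
  assumes prob: "\<And>n. n \<ge> 1 \<Longrightarrow> prob_space (P n)"
    and rv: "\<And>n. n \<ge> 1 \<Longrightarrow> \<Theta> n \<in> P n \<rightarrow>\<^sub>M (\<Pi>\<^sub>M i\<in>{..<n}. borel)"
    and unif: "\<And>n. n \<ge> 1 \<Longrightarrow> distr (P n) (\<Pi>\<^sub>M i\<in>{..<n}. borel) (\<Theta> n) = uniform_sphere n"
  shows "\<exists>I :: real measure \<Rightarrow> ereal.
           (\<forall>\<alpha>. admissible \<alpha> \<longrightarrow> I (nu \<alpha>) = ereal (- (1 / 2) * ln (1 - sq_norm \<alpha>))) \<and>
           (\<forall>\<nu>. real_distribution \<nu> \<and> \<not> (\<exists>\<alpha>. admissible \<alpha> \<and> \<nu> = nu \<alpha>) \<longrightarrow> I \<nu> = \<infinity>) \<and>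
           good_rate_function weak_topology I \<and>
           satisfies_LDP P weak_topology (\<lambda>n \<omega>. mu_discr n (\<Theta> n \<omega>)) (\<lambda>n. real n) I"
proof (intro exI[of _ rate] conjI allI impI)
  show "satisfies_LDP P weak_topology (\<lambda>n \<omega>. mu_discr n (\<Theta> n \<omega>)) (\<lambda>n. real n) rate"
    unfolding satisfies_LDP_def Let_def
  proof (intro conjI allI impI ballI)
    fix n :: nat assume "1 \<le> n"
    then show "prob_space (P n)"
      by (rule prob)
    show "(\<lambda>\<omega>. mu_discr n (\<Theta> n \<omega>)) \<in> P n \<rightarrow>\<^sub>M borel_of_topology weak_topology"
      by (rule measurable_compose[OF rv[OF \<open>1 \<le> n\<close>] measurable_mu_discr])
    show "0 < real n"
      using \<open>1 \<le> n\<close> by simp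
  next
    show "mono_on {1..} (\<lambda>n. real n)"
      by (auto simp: mono_on_def)
    show "filterlim (\<lambda>n. real n) at_top sequentially"
      by (rule filterlim_real_sequentially)
    show "rate_function weak_topology rate"
      using good_rate_function_rate by (simp add: good_rate_function_def)
  next
    fix A assume A: "A \<in> sets (borel_of_topology weak_topology)"
    \<comment> \<open>The value 0 at \<open>n = 0\<close>, where \<open>P 0\<close> is arbitrary,
      keeps \<open>p\<close> within \<open>[0, 1]\<close> everywhere; the limits do not see this
      index.\<close>
    define p where "p n = (if 1 \<le> n then measure (P n) {\<omega> \<in> space (P n). mu_discr n (\<Theta> n \<omega>) \<in> A} else 0)" for n
    have p: "0 \<le> p n" "p n \<le> 1" for n
      using prob_space.prob_le_1[OF prob[of n]] by (auto simp: p_def)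
    have p_eq: "p n = measure (uniform_sphere n) (mu_event n A)" if n: "1 \<le> n" for n
    proof -
      have "\<Theta> n -` mu_event n A \<inter> space (P n) = {\<omega> \<in> space (P n). mu_discr n (\<Theta> n \<omega>) \<in> A}"
        using measurable_space[OF rv[OF n]] by (auto simp: mu_event_def space_PiM)
      then show ?thesis
        using n unfolding unif[OF n, symmetric]
        by (subst measure_distr[OF rv[OF n] sets_mu_event[OF A]]) (simp add: p_def)
    qed
    let ?a = "\<lambda>n. ereal (1 / real n) * log_prob (measure (P n) {\<omega> \<in> space (P n). mu_discr n (\<Theta> n \<omega>) \<in> A})"
    have ev: "\<forall>\<^sub>F n in sequentially. ereal (1 / real n) * log_prob (p n) = ?a n"
      using eventually_ge_at_top[of 1] by eventually_elim (simp add: p_def)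
    show "- (INF x \<in> weak_topology interior_of A. rate x) \<le> liminf ?a"
      using sphere_lower_bound[OF A p_eq] by (simp only: Liminf_eq[OF ev])
    show "limsup ?a \<le> - (INF x \<in> weak_topology closure_of A. rate x)"
      using sphere_upper_bound[OF A p p_eq] by (simp only: Limsup_eq[OF ev])
    show "liminf ?a \<le> limsup ?a"
      by (rule Liminf_le_Limsup) simp
  qed
qed (auto simp: rate_nu rate_eq_infinity good_rate_function_rate)

end
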